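(* Let $L\ge2$. For each $d=1,2,\dots$, the algebra $P_{d,L}$ is freely generated, as a graded unital commutative algebra, by the homogeneous elements of the form $p(\widehat w)$, where $\widehat w$ ranges over $\widehat W_L$, and of the form $p_{ij}(w)$, where $w$ ranges over $W_L$ and $1\le i,j\le d$.
   Context: The ground field is $\mathbb C$. $E_{ij\mid\alpha}$ denotes the matrix unit $E_{ij}$ in the $\alpha$-th copy of $\mathfrak{gl}(N,\mathbb C)$ in $\mathfrak{gl}(N,\mathbb C)^{\oplus L}$, $\alpha\in[L]=\{1,\dots,L\}$; $S(\cdot)$ is the symmetric algebra. For $0\le d\le N$, $\mathfrak{gl}_d(N,\mathbb C)$ is the span of $E_{ij}$ with $d<i,j\le N$; $\operatorname{diag}$ is the diagonal embedding into $\mathfrak{gl}(N,\mathbb C)^{\oplus L}$; $P_{d,L}(N):=S(\mathfrak{gl}(N,\mathbb C)^{\oplus L})^{\operatorname{diag}\mathfrak{gl}_d(N,\mathbb C)}$ (invariants of the adjoint action). Let $\mathcal I^+(N)$ be the ideal of $S(\mathfrak{gl}(N,\mathbb C)^{\oplus L})$ generated by all $E_{iN\mid\alpha}$, $1\le i\le N$, $\alpha\in[L]$. Then $P_{N-1,L}(N)=S(\mathfrak{gl}(N-1,\mathbb C)^{\oplus L})\oplus(P_{N-1,L}(N)\cap\mathcal I^+(N))$; the projection $\pi_{N,N-1}$ onto the first summand is a graded algebra morphism mapping $P_{d,L}(N)$ into $P_{d,L}(N-1)$ for $d\le N-1$. $P_{d,L}:=\varprojlim(P_{d,L}(N),\pi_{N,N-1})$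 as $N\to\infty$, in the category of graded algebras (its $n$-th homogeneous component is the projective limit of the $n$-th homogeneous components). $P_{0,L}\subset P_{d,L}$ by restricting sequences to $N\ge d$. $W_L$ is the set of nonempty words in the alphabet $[L]$; $\widehat W_L$ is the set of circular words, i.e. equivalence classes of $W_L$ under cyclic permutations of letters. For $w=w_1\dots w_n\in W_L$ with class $\widehat w$, set $$p(\widehat w;N)=\sum_{a_1,\dots,a_n=1}^N E_{a_1a_2\mid w_1}E_{a_2a_3\mid w_2}\cdots E_{a_na_1\mid w_n}\in P_{0,L}(N),$$ $$p_{ij}(w;N)=\sum_{a_1,\dots,a_{n-1}=1}^N E_{ia_1\mid w_1}E_{a_1a_2\mid w_2}\cdots E_{a_{n-1}j\mid w_n}\in P_{d,L}(N),\quad 1\le i,j\le d.$$ These elements are consistent with the projections $\pi_{N,N-1}$ and so define homogeneous elements $p(\widehat w)\in P_{0,L}\subset P_{d,L}$ and $p_{ij}(w)\in P_{d,L}$ of degree $n$. *)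

theory Defs
  imports Complex_Main "HOL-Library.Poly_Mapping" "HOL-Library.Function_Algebras"
begin

section \<open>Polynomial algebras over the complex numbers\<close>

text \<open>Polynomials in variables of type \<open>'x\<close>: finitely supported families of complex
  coefficients, indexed by finitely supported exponent functions.\<close>

type_synonym 'x cpoly = "('x \<Rightarrow>\<^sub>0 nat) \<Rightarrow>\<^sub>0 complex"

definition cconst :: "complex \<Rightarrow> 'x cpoly" where
  "cconst c = Poly_Mapping.single 0 c"

definition cvar :: "'x \<Rightarrow> 'x cpoly" where
  "cvar x = Poly_Mapping.single (Poly_Mapping.single x 1) 1"

definition polys_in :: "'x set \<Rightarrow> 'x cpoly set" where
  "polys_in X = {f. \<forall>m\<in>Poly_Mapping.keys f. Poly_Mapping.keys m \<subseteq> X}"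

definition mon_degree :: "('x \<Rightarrow> nat) \<Rightarrow> ('x \<Rightarrow>\<^sub>0 nat) \<Rightarrow> nat" where
  "mon_degree w m = (\<Sum>x\<in>Poly_Mapping.keys m. w x * Poly_Mapping.lookup m x)"

text \<open>Homogeneity for the grading in which the variable \<open>x\<close> has degree \<open>w x\<close>;
  the zero polynomial is homogeneous of every degree.\<close>

definition homogeneous :: "('x \<Rightarrow> nat) \<Rightarrow> nat \<Rightarrow> 'x cpoly \<Rightarrow> bool" where
  "homogeneous w n f \<longleftrightarrow> (\<forall>m\<in>Poly_Mapping.keys f. mon_degree w m = n)"

definition partial :: "'x \<Rightarrow> 'x cpoly \<Rightarrow> 'x cpoly" where
  "partial x f = (\<Sum>m\<in>Poly_Mapping.keys f.
     Poly_Mapping.single (m - Poly_Mapping.single x 1)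
       (of_nat (Poly_Mapping.lookup m x) * Poly_Mapping.lookup f m))"

text \<open>Evaluation at the family \<open>x\<close> in a commutative complex algebra whose structure map is \<open>c\<close>.\<close>

definition cpoly_eval :: "(complex \<Rightarrow> 'b::comm_ring_1) \<Rightarrow> ('s \<Rightarrow> 'b) \<Rightarrow> 's cpoly \<Rightarrow> 'b" where
  "cpoly_eval c x f = (\<Sum>m\<in>Poly_Mapping.keys f.
     c (Poly_Mapping.lookup f m) * (\<Prod>s\<in>Poly_Mapping.keys m. x s ^ Poly_Mapping.lookup m s))"

text \<open>The graded algebra \<open>A\<close>, with homogeneous components \<open>gr n\<close>, is freely generated, as a
  graded unital commutative algebra, by the family \<open>x s\<close> (\<open>s \<in> I\<close>) of homogeneous elements of
  degrees \<open>deg s\<close>: the canonical morphism from the polynomial algebra on \<open>I\<close>, in which the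
  variable \<open>s\<close> has degree \<open>deg s\<close>, is an isomorphism of graded algebras onto \<open>A\<close>.\<close>

definition graded_freely_generated ::
  "(complex \<Rightarrow> 'b::comm_ring_1) \<Rightarrow> 'b set \<Rightarrow> (nat \<Rightarrow> 'b set) \<Rightarrow> 's set \<Rightarrow> ('s \<Rightarrow> nat) \<Rightarrow> ('s \<Rightarrow> 'b) \<Rightarrow> bool"
where
  "graded_freely_generated c A gr I deg x \<longleftrightarrow>
     (\<forall>s\<in>I. x s \<in> gr (deg s)) \<and>
     bij_betw (cpoly_eval c x) (polys_in I) A \<and>
     (\<forall>n. cpoly_eval c x ` {f \<in> polys_in I. homogeneous deg n f} = gr n)"


section \<open>Matrix Lie algebras and their symmetric algebras\<close>

text \<open>Matrices are functions of 1-based row and column indices, vanishing outside the stated range;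
  \<open>gl 0 N\<close> is the full matrix Lie algebra. Elements of the direct sum of \<open>L\<close> copies are families
  of matrices indexed by \<open>1, \<dots>, L\<close>.\<close>

type_synonym cmat = "nat \<Rightarrow> nat \<Rightarrow> complex"

definition gl :: "nat \<Rightarrow> nat \<Rightarrow> cmat set" where
  "gl d N = {X. \<forall>i j. X i j \<noteq> 0 \<longrightarrow> d < i \<and> i \<le> N \<and> d < j \<and> j \<le> N}"

definition mat_prod :: "nat \<Rightarrow> cmat \<Rightarrow> cmat \<Rightarrow> cmat" where
  "mat_prod N X Y = (\<lambda>i j. \<Sum>k=1..N. X i k * Y k j)"

definition commutator :: "nat \<Rightarrow> cmat \<Rightarrow> cmat \<Rightarrow> cmat" where
  "commutator N X Y = (\<lambda>i j. mat_prod N X Y i j - mat_prod N Y X i j)"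

definition diag_emb :: "nat \<Rightarrow> cmat \<Rightarrow> (nat \<Rightarrow> cmat)" where
  "diag_emb L X = (\<lambda>\<alpha>. if 1 \<le> \<alpha> \<and> \<alpha> \<le> L then X else (\<lambda>_ _. 0))"

definition matrix_unit :: "nat \<Rightarrow> nat \<Rightarrow> nat \<Rightarrow> (nat \<Rightarrow> cmat)" where
  "matrix_unit i j \<alpha> = (\<lambda>\<beta> k l. if \<beta> = \<alpha> \<and> k = i \<and> l = j then 1 else 0)"

text \<open>The symmetric algebra of the direct sum is the polynomial algebra on its basis of matrix units;
  the variable \<open>(i, j, \<alpha>)\<close> is the matrix unit \<open>E\<^sub>i\<^sub>j\<close> in the copy \<open>\<alpha>\<close>.\<close>

type_synonym salg = "(nat \<times> nat \<times> nat) cpoly"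

definition basis_index :: "nat \<Rightarrow> nat \<Rightarrow> (nat \<times> nat \<times> nat) set" where
  "basis_index L N = {1..N} \<times> {1..N} \<times> {1..L}"

definition E :: "nat \<Rightarrow> nat \<Rightarrow> nat \<Rightarrow> salg" where
  "E i j \<alpha> = cvar (i, j, \<alpha>)"

definition sym_alg :: "nat \<Rightarrow> nat \<Rightarrow> salg set" where
  "sym_alg L N = polys_in (basis_index L N)"

definition lin_emb :: "nat \<Rightarrow> nat \<Rightarrow> (nat \<Rightarrow> cmat) \<Rightarrow> salg" where
  "lin_emb L N Y = (\<Sum>(i, j, \<alpha>)\<in>basis_index L N. cconst (Y \<alpha> i j) * E i j \<alpha>)"

text \<open>The adjoint action of \<open>X\<close>: the derivation of the symmetric algebra that sends each basis
  element \<open>v\<close> to the bracket of \<open>X\<close> and \<open>v\<close>.\<close>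

definition ad_action :: "nat \<Rightarrow> nat \<Rightarrow> (nat \<Rightarrow> cmat) \<Rightarrow> salg \<Rightarrow> salg" where
  "ad_action L N X f = (\<Sum>(i, j, \<alpha>)\<in>basis_index L N.
     lin_emb L N (\<lambda>\<beta>. commutator N (X \<beta>) (matrix_unit i j \<alpha> \<beta>)) * partial (i, j, \<alpha>) f)"

definition inv_alg :: "nat \<Rightarrow> nat \<Rightarrow> nat \<Rightarrow> salg set" where
  "inv_alg d L N = {f \<in> sym_alg L N. \<forall>X\<in>gl d N. ad_action L N (diag_emb L X) f = 0}"


section \<open>The projections and the projective limit\<close>

definition ideal_plus :: "nat \<Rightarrow> nat \<Rightarrow> salg set" where
  "ideal_plus L N = {(\<Sum>(i, \<alpha>)\<in>{1..N} \<times> {1..L}. q i \<alpha> * E i N \<alpha>) | q. \<forall>i \<alpha>. q i \<alpha> \<in> sym_alg L N}"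

text \<open>Projection of \<open>inv_alg (N - 1) L N\<close> to the first summand of its decomposition into
  \<open>sym_alg L (N - 1)\<close> and \<open>inv_alg (N - 1) L N \<inter> ideal_plus L N\<close>; see \<open>proj_unique_exists\<close>
  below.\<close>

definition proj :: "nat \<Rightarrow> nat \<Rightarrow> salg \<Rightarrow> salg" where
  "proj L N f = (THE g. g \<in> sym_alg L (N - 1) \<and> f - g \<in> inv_alg (N - 1) L N \<inter> ideal_plus L N)"

text \<open>A sequence \<open>(f\<^sub>N)\<close>, \<open>N \<ge> d\<close>, is encoded as \<open>\<lambda>k. f\<^sub>N\<close> with \<open>N = d + k\<close>, so that the
  componentwise ring structure of functions has the right unit.\<close>

definition lim_comp :: "nat \<Rightarrow> nat \<Rightarrow> nat \<Rightarrow> (nat \<Rightarrow> salg) set" where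
  "lim_comp d L n = {f. \<forall>k. f k \<in> inv_alg d L (d + k) \<and> homogeneous (\<lambda>_. 1) n (f k) \<and>
                            proj L (Suc (d + k)) (f (Suc k)) = f k}"

text \<open>The limit in the category of graded algebras is the direct sum of its homogeneous components,
  here an internal direct sum in the algebra of all sequences.\<close>

definition lim_alg :: "nat \<Rightarrow> nat \<Rightarrow> (nat \<Rightarrow> salg) set" where
  "lim_alg d L = {(\<Sum>n\<le>m. g n) | g m. \<forall>n. g n \<in> lim_comp d L n}"

definition seq_const :: "complex \<Rightarrow> (nat \<Rightarrow> salg)" where
  "seq_const c = (\<lambda>k. cconst c)"


section \<open>Words, circular words and the generators\<close>

definition words :: "nat \<Rightarrow> nat list set" where
  "words L = {w. w \<noteq> [] \<and> set w \<subseteq> {1..L}}"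

definition rotation_rel :: "nat \<Rightarrow> (nat list \<times> nat list) set" where
  "rotation_rel L = {(u, v). u \<in> words L \<and> v \<in> words L \<and> (\<exists>k. v = rotate k u)}"

definition circular_words :: "nat \<Rightarrow> nat list set set" where
  "circular_words L = words L // rotation_rel L"

definition index_lists :: "nat \<Rightarrow> nat \<Rightarrow> nat list set" where
  "index_lists N n = {a. length a = n \<and> set a \<subseteq> {1..N}}"

definition p_word :: "nat list \<Rightarrow> nat \<Rightarrow> salg" where
  "p_word w N = (\<Sum>a\<in>index_lists N (length w).
     \<Prod>r<length w. E (a ! r) (a ! (Suc r mod length w)) (w ! r))"

text \<open>Value of \<open>p_word\<close>, respectively of the length, at any representative of the circular word;
  see \<open>p_circ_class\<close> and \<open>circ_length_class\<close> below.\<close>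

definition p_circ :: "nat list set \<Rightarrow> nat \<Rightarrow> salg" where
  "p_circ c N = (THE y. \<forall>w\<in>c. p_word w N = y)"

definition circ_length :: "nat list set \<Rightarrow> nat" where
  "circ_length c = (THE n. \<forall>w\<in>c. length w = n)"

text \<open>The list \<open>i # a @ [j]\<close> consists of the successive matrix indices
  \<open>i, a\<^sub>1, \<dots>, a\<^sub>n\<^sub>-\<^sub>1, j\<close>.\<close>

definition p_path :: "nat \<Rightarrow> nat \<Rightarrow> nat list \<Rightarrow> nat \<Rightarrow> salg" where
  "p_path i j w N = (\<Sum>a\<in>index_lists N (length w - 1).
     \<Prod>r<length w. E ((i # a @ [j]) ! r) ((i # a @ [j]) ! Suc r) (w ! r))"

datatype gen_index = Circ "nat list set" | Path nat nat "nat list"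

definition gen_indices :: "nat \<Rightarrow> nat \<Rightarrow> gen_index set" where
  "gen_indices d L = Circ ` circular_words L \<union>
     {Path i j w | i j w. i \<in> {1..d} \<and> j \<in> {1..d} \<and> w \<in> words L}"

fun gen_degree :: "gen_index \<Rightarrow> nat" where
  "gen_degree (Circ c) = circ_length c"
| "gen_degree (Path i j w) = length w"

fun gen_elem :: "nat \<Rightarrow> gen_index \<Rightarrow> (nat \<Rightarrow> salg)" where
  "gen_elem d (Circ c) = (\<lambda>k. p_circ c (d + k))"
| "gen_elem d (Path i j w) = (\<lambda>k. p_path i j w (d + k))"


section \<open>Well-definedness\<close>

lemma words_rotate: "w \<in> words L \<Longrightarrow> rotate k w \<in> words L"
  by (auto simp: words_def)

lemma equiv_rotation_rel: "equiv (words L) (rotation_rel L)"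
proof (rule equivI)
  show "rotation_rel L \<subseteq> words L \<times> words L" by (auto simp: rotation_rel_def)
  show "refl_on (words L) (rotation_rel L)"
    by (auto simp: refl_on_def rotation_rel_def intro: exI[of _ 0])
  show "sym (rotation_rel L)"
  proof (rule symI)
    fix u v assume "(u, v) \<in> rotation_rel L"
    then obtain k where k: "u \<in> words L" "v \<in> words L" "v = rotate k u"
      by (auto simp: rotation_rel_def)
    have "length u dvd (length u - k mod length u + k)"
    proof -
      have "k mod length u < length u" using k(1) by (simp add: words_def)
      then have "length u - k mod length u + k = length u * (1 + k div length u)"
        using mult_div_mod_eq[of "length u" k] unfolding distrib_left by linarith
      then show ?thesis by (simp only: dvd_triv_left)
    qed
    then have "rotate (length u - k mod length u) v = u"
      by (simp add: k(3) rotate_rotate rotate_id)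
    then show "(v, u) \<in> rotation_rel L" using k(1,2) unfolding rotation_rel_def by (metis (mono_tags, lifting) case_prodI mem_Collect_eq)
  qed
  show "trans (rotation_rel L)"
    by (rule transI) (auto simp: rotation_rel_def rotate_rotate)
qed

lemma p_word_rotate1: "p_word (rotate1 w) N = p_word w N"
proof (cases "w = []")
  case False
  define n where "n = length w"
  have n: "n > 0" using False by (simp add: n_def)
  have inj: "inj_on rotate1 (index_lists N n)"
  proof (rule inj_onI)
    fix a b :: "nat list" assume "rotate1 a = rotate1 b"
    then show "a = b" by (cases a; cases b) auto
  qed
  have img: "rotate1 ` index_lists N n = index_lists N n"
  proof
    show "rotate1 ` index_lists N n \<subseteq> index_lists N n" by (auto simp: index_lists_def)
    show "index_lists N n \<subseteq> rotate1 ` index_lists N n"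
    proof
      fix a assume a: "a \<in> index_lists N n"
      then have "rotate (Suc (n - 1)) a = a" using n by (intro rotate_id) (simp add: index_lists_def)
      then have "a = rotate1 (rotate (n - 1) a)" by (simp only: rotate_Suc)
      moreover have "rotate (n - 1) a \<in> index_lists N n" using a by (auto simp: index_lists_def)
      ultimately show "a \<in> rotate1 ` index_lists N n" by blast
    qed
  qed
  have "p_word (rotate1 w) N = (\<Sum>a\<in>rotate1 ` index_lists N n.
      \<Prod>r<n. E (a ! r) (a ! (Suc r mod n)) (rotate1 w ! r))"
    unfolding p_word_def length_rotate1 n_def[symmetric] img ..
  also have "\<dots> = (\<Sum>a\<in>index_lists N n.
      \<Prod>r<n. E (rotate1 a ! r) (rotate1 a ! (Suc r mod n)) (rotate1 w ! r))"
    by (subst sum.reindex[OF inj]) simp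
  also have "\<dots> = (\<Sum>a\<in>index_lists N n. \<Prod>r<n. E (a ! r) (a ! (Suc r mod n)) (w ! r))"
  proof (rule sum.cong[OF refl])
    fix a assume "a \<in> index_lists N n"
    then have la: "length a = n" by (simp add: index_lists_def)
    let ?g = "\<lambda>r. E (a ! r) (a ! (Suc r mod n)) (w ! r)"
    have bij: "bij_betw (\<lambda>r. Suc r mod n) {..<n} {..<n}"
    proof -
      have "inj_on (\<lambda>r. Suc r mod n) {..<n}"
        by (rule inj_onI) (auto simp: mod_Suc split: if_splits)
      moreover have "(\<lambda>r. Suc r mod n) ` {..<n} \<subseteq> {..<n}" using n by auto
      ultimately show ?thesis
        by (simp add: bij_betw_def endo_inj_surj)
    qed
    have "(\<Prod>r<n. E (rotate1 a ! r) (rotate1 a ! (Suc r mod n)) (rotate1 w ! r))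
        = (\<Prod>r<n. ?g (Suc r mod n))"
      by (rule prod.cong[OF refl]) (use n la in \<open>simp add: nth_rotate1 n_def\<close>)
    also have "\<dots> = (\<Prod>r<n. ?g r)" by (rule prod.reindex_bij_betw[OF bij])
    finally show "(\<Prod>r<n. E (rotate1 a ! r) (rotate1 a ! (Suc r mod n)) (rotate1 w ! r))
        = (\<Prod>r<n. ?g r)" .
  qed
  finally show ?thesis by (simp add: p_word_def n_def)
qed simp

lemma p_word_rotate: "p_word (rotate k w) N = p_word w N"
  by (induction k) (simp_all add: p_word_rotate1)

lemma p_circ_class:
  assumes "w \<in> words L"
  shows "p_circ (rotation_rel L `` {w}) N = p_word w N"
  unfolding p_circ_def
proof (rule the_equality)
  show "\<forall>v\<in>rotation_rel L `` {w}. p_word v N = p_word w N"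
    by (auto simp: rotation_rel_def p_word_rotate)
  have "w \<in> rotation_rel L `` {w}" using assms by (auto simp: rotation_rel_def intro: exI[of _ 0])
  fix y assume "\<forall>v\<in>rotation_rel L `` {w}. p_word v N = y"
  with \<open>w \<in> rotation_rel L `` {w}\<close> show "y = p_word w N" by force
qed

lemma circ_length_class:
  assumes "w \<in> words L"
  shows "circ_length (rotation_rel L `` {w}) = length w"
  unfolding circ_length_def
proof (rule the_equality)
  show "\<forall>v\<in>rotation_rel L `` {w}. length v = length w"
    by (auto simp: rotation_rel_def)
  have "w \<in> rotation_rel L `` {w}" using assms by (auto simp: rotation_rel_def intro: exI[of _ 0])
  fix y assume "\<forall>v\<in>rotation_rel L `` {w}. length v = y"
  with \<open>w \<in> rotation_rel L `` {w}\<close> show "y = length w" by force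
qed

lemma lookup_sum_single:
  "finite A \<Longrightarrow> Poly_Mapping.lookup (\<Sum>m\<in>A. Poly_Mapping.single m (c m)) k = (if k \<in> A then c k else 0)"
  by (simp add: lookup_sum lookup_single when_def)

lemma sum_single_keys: "(\<Sum>m\<in>Poly_Mapping.keys f. Poly_Mapping.single m (Poly_Mapping.lookup f m)) = f"
  by (rule poly_mapping_eqI) (simp add: lookup_sum_single in_keys_iff)

lemma minus_single_add:
  fixes m :: "'x \<Rightarrow>\<^sub>0 nat"
  assumes "Poly_Mapping.lookup m x \<noteq> 0"
  shows "m - Poly_Mapping.single x 1 + Poly_Mapping.single x 1 = m"
  using assms by (intro poly_mapping_eqI) (auto simp: lookup_add lookup_minus lookup_single when_def)

lemma lookup_partial:
  "Poly_Mapping.lookup (partial x f) m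
     = of_nat (Poly_Mapping.lookup m x + 1) * Poly_Mapping.lookup f (m + Poly_Mapping.single x 1)"
proof -
  let ?e = "Poly_Mapping.single x (1::nat)"
  have "Poly_Mapping.lookup (partial x f) m
      = (\<Sum>k\<in>Poly_Mapping.keys f. if k = m + ?e
           then of_nat (Poly_Mapping.lookup m x + 1) * Poly_Mapping.lookup f (m + ?e) else 0)"
    unfolding partial_def lookup_sum
  proof (rule sum.cong[OF refl])
    fix k assume "k \<in> Poly_Mapping.keys f"
    show "Poly_Mapping.lookup (Poly_Mapping.single (k - ?e)
            (of_nat (Poly_Mapping.lookup k x) * Poly_Mapping.lookup f k)) m
        = (if k = m + ?e
           then of_nat (Poly_Mapping.lookup m x + 1) * Poly_Mapping.lookup f (m + ?e) else 0)"
    proof (cases "Poly_Mapping.lookup k x = 0")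
      case True
      then have "k \<noteq> m + ?e" by (auto simp: lookup_add)
      with True show ?thesis by simp
    next
      case False
      then have "k - ?e = m \<longleftrightarrow> k = m + ?e"
        using minus_single_add[OF False] by auto
      then show ?thesis by (auto simp: lookup_single when_def lookup_add)
    qed
  qed
  then show ?thesis by (simp add: in_keys_iff)
qed

lemma partial_diff: "partial x (f - g) = partial x f - partial x g"
  by (rule poly_mapping_eqI) (simp add: lookup_partial lookup_minus algebra_simps)

lemma partial_notin: "\<forall>m\<in>Poly_Mapping.keys f. x \<notin> Poly_Mapping.keys m \<Longrightarrow> partial x f = 0"
  by (auto simp: partial_def in_keys_iff)

lemma cvar_partial:
  "cvar x * partial x f = (\<Sum>m\<in>Poly_Mapping.keys f.
     Poly_Mapping.single m (of_nat (Poly_Mapping.lookup m x) * Poly_Mapping.lookup f m))"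
  unfolding partial_def sum_distrib_left
proof (rule sum.cong[OF refl])
  fix m
  show "cvar x * Poly_Mapping.single (m - Poly_Mapping.single x 1)
          (of_nat (Poly_Mapping.lookup m x) * Poly_Mapping.lookup f m)
      = Poly_Mapping.single m (of_nat (Poly_Mapping.lookup m x) * Poly_Mapping.lookup f m)"
  proof (cases "Poly_Mapping.lookup m x = 0")
    case False
    then have "Poly_Mapping.single x 1 + (m - Poly_Mapping.single x 1) = m"
      by (metis add.commute minus_single_add)
    then show ?thesis unfolding cvar_def mult_single by simp
  qed simp
qed

lemma ad_action_diff: "ad_action L N X (f - g) = ad_action L N X f - ad_action L N X g"
  by (simp add: ad_action_def partial_diff right_diff_distrib sum_subtractf case_prod_beta)

lemma commutator_corner:
  assumes X: "X \<in> gl (N - 1) N" and "1 \<le> N" and i: "i \<in> {1..N}" and j: "j \<in> {1..N}"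
  shows "commutator N (diag_emb L X \<beta>) (matrix_unit i j \<alpha> \<beta>) k l
    = (if \<beta> = \<alpha> \<and> k = i \<and> l = j \<and> 1 \<le> \<alpha> \<and> \<alpha> \<le> L
       then X N N * (of_bool (i = N) - of_bool (j = N)) else 0)"
proof -
  have X0: "X a b = (if a = N \<and> b = N then X N N else 0)" for a b
    using X unfolding gl_def by (cases "X a b = 0") force+
  show ?thesis
  proof (cases "1 \<le> \<beta> \<and> \<beta> \<le> L \<and> \<beta> = \<alpha>")
    case True
    have "(\<Sum>m=1..N. X k m * (if m = i \<and> l = j then 1 else 0)) = (if l = j then X k i else 0)"
      using i by (cases "l = j") (simp_all add: if_distrib[of "\<lambda>t. _ * t"] cong: if_cong)
    moreover have "(\<Sum>m=1..N. (if k = i \<and> m = j then 1 else 0) * X m l) = (if k = i then X j l else 0)"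
      using j by (cases "k = i") (simp_all add: if_distrib[of "\<lambda>t. t * _"] cong: if_cong)
    ultimately show ?thesis
      using True X0[of k i] X0[of j l]
      by (auto simp: commutator_def mat_prod_def diag_emb_def matrix_unit_def simp flip: One_nat_def)
  next
    case False
    then show ?thesis
      by (auto simp: commutator_def mat_prod_def diag_emb_def matrix_unit_def)
  qed
qed

lemma ad_action_corner:
  assumes X: "X \<in> gl (N - 1) N" and N: "1 \<le> N"
  shows "ad_action L N (diag_emb L X) f = (\<Sum>(i, j, \<alpha>)\<in>basis_index L N.
     cconst (X N N * (of_bool (i = N) - of_bool (j = N))) * (E i j \<alpha> * partial (i, j, \<alpha>) f))"
  unfolding ad_action_def
proof (rule sum.cong[OF refl], clarify)
  fix i j \<alpha> assume v: "(i, j, \<alpha>) \<in> basis_index L N"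
  let ?c = "X N N * (of_bool (i = N) - of_bool (j = N))"
  have ij: "i \<in> {1..N}" "j \<in> {1..N}" "1 \<le> \<alpha>" "\<alpha> \<le> L" using v by (auto simp: basis_index_def)
  have "lin_emb L N (\<lambda>\<beta>. commutator N (diag_emb L X \<beta>) (matrix_unit i j \<alpha> \<beta>))
      = (\<Sum>u\<in>basis_index L N. if u = (i, j, \<alpha>) then cconst ?c * E i j \<alpha> else 0)"
    unfolding lin_emb_def
  proof (rule sum.cong[OF refl], clarify)
    fix k l \<beta>
    show "cconst (commutator N (diag_emb L X \<beta>) (matrix_unit i j \<alpha> \<beta>) k l) * E k l \<beta>
      = (if (k, l, \<beta>) = (i, j, \<alpha>) then cconst ?c * E i j \<alpha> else 0)"
      unfolding commutator_corner[OF X N ij(1,2)] using ij(3,4)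
      by (cases "k = i \<and> l = j \<and> \<beta> = \<alpha>") (auto simp: cconst_def)
  qed
  also have "\<dots> = cconst ?c * E i j \<alpha>" using v by (simp add: basis_index_def)
  finally show "lin_emb L N (\<lambda>\<beta>. commutator N (diag_emb L X \<beta>) (matrix_unit i j \<alpha> \<beta>)) * partial (i, j, \<alpha>) f
      = cconst ?c * (E i j \<alpha> * partial (i, j, \<alpha>) f)" by (simp add: mult.assoc)
qed

lemma corner_weight:
  assumes f: "f \<in> inv_alg (N - 1) L N" and N: "1 \<le> N" and m: "m \<in> Poly_Mapping.keys f"
  shows "(\<Sum>(i, j, \<alpha>)\<in>basis_index L N. (of_bool (i = N) - of_bool (j = N))
            * (of_nat (Poly_Mapping.lookup m (i, j, \<alpha>)) :: complex)) = 0"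
proof -
  define X :: cmat where "X = (\<lambda>i j. if i = N \<and> j = N then 1 else 0)"
  have X: "X \<in> gl (N - 1) N" using N by (auto simp: X_def gl_def)
  have lk: "Poly_Mapping.lookup (cconst c * p) m = c * Poly_Mapping.lookup p m" for c and p :: salg
  proof -
    have "cconst c * p = (\<Sum>k\<in>Poly_Mapping.keys p. Poly_Mapping.single k (c * Poly_Mapping.lookup p k))"
      by (subst sum_single_keys[of p, symmetric])
         (simp add: sum_distrib_left cconst_def mult_single)
    then show ?thesis by (simp add: lookup_sum_single in_keys_iff)
  qed
  have "0 = Poly_Mapping.lookup (ad_action L N (diag_emb L X) f) m"
    using f X by (simp add: inv_alg_def)
  also have "\<dots> = (\<Sum>(i, j, \<alpha>)\<in>basis_index L N. (of_bool (i = N) - of_bool (j = N))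
            * (of_nat (Poly_Mapping.lookup m (i, j, \<alpha>)) * Poly_Mapping.lookup f m))"
    unfolding ad_action_corner[OF X N] lookup_sum
  proof (rule sum.cong[OF refl], clarify)
    fix i j \<alpha>
    have "Poly_Mapping.lookup (E i j \<alpha> * partial (i, j, \<alpha>) f) m
        = of_nat (Poly_Mapping.lookup m (i, j, \<alpha>)) * Poly_Mapping.lookup f m"
      unfolding E_def cvar_partial using m by (simp add: lookup_sum_single)
    moreover have "X N N = 1" by (simp add: X_def)
    ultimately show "Poly_Mapping.lookup (cconst (X N N * (of_bool (i = N) - of_bool (j = N)))
          * (E i j \<alpha> * partial (i, j, \<alpha>) f)) m
        = (of_bool (i = N) - of_bool (j = N))
          * (of_nat (Poly_Mapping.lookup m (i, j, \<alpha>)) * Poly_Mapping.lookup f m)"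
      by (simp only: lk mult_1_left)
  qed
  also have "\<dots> = (\<Sum>(i, j, \<alpha>)\<in>basis_index L N. (of_bool (i = N) - of_bool (j = N))
            * of_nat (Poly_Mapping.lookup m (i, j, \<alpha>))) * Poly_Mapping.lookup f m"
    by (simp add: sum_distrib_right case_prod_beta mult.assoc)
  finally show ?thesis using m by (simp add: in_keys_iff)
qed

lemma sym_alg_subset_inv_alg:
  assumes g: "g \<in> sym_alg L (N - 1)" and N: "1 \<le> N"
  shows "g \<in> inv_alg (N - 1) L N"
proof -
  have "basis_index L (N - 1) \<subseteq> basis_index L N" by (auto simp: basis_index_def)
  then have "g \<in> sym_alg L N" using g by (force simp: sym_alg_def polys_in_def)
  moreover have "ad_action L N (diag_emb L X) g = 0" if X: "X \<in> gl (N - 1) N" for X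
    unfolding ad_action_corner[OF X N]
  proof (rule sum.neutral, clarify)
    fix i j \<alpha>
    show "cconst (X N N * (of_bool (i = N) - of_bool (j = N))) * (E i j \<alpha> * partial (i, j, \<alpha>) g) = 0"
    proof (cases "i = N \<or> j = N")
      case True
      then have "partial (i, j, \<alpha>) g = 0"
        using g N by (intro partial_notin) (fastforce simp: sym_alg_def polys_in_def basis_index_def)
      then show ?thesis by simp
    qed (simp add: cconst_def)
  qed
  ultimately show ?thesis by (simp add: inv_alg_def)
qed

lemma ideal_plus_key:
  assumes "h \<in> ideal_plus L N" "m \<in> Poly_Mapping.keys h"
  shows "\<exists>i \<alpha>. (i, N, \<alpha>) \<in> Poly_Mapping.keys m"
proof -
  obtain q where "h = (\<Sum>(i, \<alpha>)\<in>{1..N} \<times> {1..L}. q i \<alpha> * E i N \<alpha>)"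
    using assms(1) by (auto simp: ideal_plus_def)
  then obtain i \<alpha> where "Poly_Mapping.lookup (q i \<alpha> * E i N \<alpha>) m \<noteq> 0"
    using assms(2) by (auto simp: in_keys_iff lookup_sum elim!: sum.not_neutral_contains_not_neutral)
  then have "m \<in> Poly_Mapping.keys (q i \<alpha> * E i N \<alpha>)" by (simp add: in_keys_iff)
  then obtain a where "m = a + Poly_Mapping.single (i, N, \<alpha>) 1"
    using keys_mult[of "q i \<alpha>" "E i N \<alpha>"] by (auto simp: E_def cvar_def)
  then have "(i, N, \<alpha>) \<in> Poly_Mapping.keys m" by (simp add: in_keys_iff lookup_add)
  then show ?thesis by blast
qed

lemma ideal_plus_single:
  assumes "(i, N, \<alpha>) \<in> Poly_Mapping.keys m" "Poly_Mapping.keys m \<subseteq> basis_index L N"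
  shows "Poly_Mapping.single m c \<in> ideal_plus L N"
proof -
  let ?s = "Poly_Mapping.single (m - Poly_Mapping.single (i, N, \<alpha>) 1) c"
  define q where "q = (\<lambda>i' \<alpha>'. if i' = i \<and> \<alpha>' = \<alpha> then ?s else 0)"
  have mem: "(i, \<alpha>) \<in> {1..N} \<times> {1..L}" using assms by (auto simp: basis_index_def)
  have "Poly_Mapping.keys (m - Poly_Mapping.single (i, N, \<alpha>) 1) \<subseteq> Poly_Mapping.keys m"
    by (auto simp: in_keys_iff lookup_minus)
  then have "?s \<in> sym_alg L N" using assms(2) by (auto simp: sym_alg_def polys_in_def)
  then have q: "\<forall>i \<alpha>. q i \<alpha> \<in> sym_alg L N" by (simp add: q_def sym_alg_def polys_in_def)
  have "(\<Sum>(i', \<alpha>')\<in>{1..N} \<times> {1..L}. q i' \<alpha>' * E i' N \<alpha>')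
      = (\<Sum>u\<in>{1..N} \<times> {1..L}. if u = (i, \<alpha>) then ?s * E i N \<alpha> else 0)"
  proof (rule sum.cong[OF refl], clarify)
    fix i' \<alpha>'
    show "q i' \<alpha>' * E i' N \<alpha>' = (if (i', \<alpha>') = (i, \<alpha>) then ?s * E i N \<alpha> else 0)"
      by (cases "i' = i \<and> \<alpha>' = \<alpha>") (auto simp: q_def)
  qed
  also have "\<dots> = ?s * E i N \<alpha>" using mem by (simp only: sum.delta finite_SigmaI finite_atLeastAtMost if_True)
  also have "\<dots> = Poly_Mapping.single m c"
    using assms(1) minus_single_add[of m "(i, N, \<alpha>)"]
    unfolding E_def cvar_def mult_single in_keys_iff by (metis mult_1_right)
  finally have "Poly_Mapping.single m c = (\<Sum>(i, \<alpha>)\<in>{1..N} \<times> {1..L}. q i \<alpha> * E i N \<alpha>)" ..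
  with q show ?thesis unfolding ideal_plus_def by (intro CollectI exI[of _ q] conjI)
qed

lemma ideal_plus_sum:
  assumes "finite A" "\<And>a. a \<in> A \<Longrightarrow> h a \<in> ideal_plus L N"
  shows "(\<Sum>a\<in>A. h a) \<in> ideal_plus L N"
proof -
  have "\<forall>a\<in>A. \<exists>q. h a = (\<Sum>(i, \<alpha>)\<in>{1..N} \<times> {1..L}. q i \<alpha> * E i N \<alpha>) \<and> (\<forall>i \<alpha>. q i \<alpha> \<in> sym_alg L N)"
    using assms(2) by (auto simp: ideal_plus_def)
  then obtain q where q: "\<And>a. a \<in> A \<Longrightarrow> h a = (\<Sum>(i, \<alpha>)\<in>{1..N} \<times> {1..L}. q a i \<alpha> * E i N \<alpha>)"
      "\<And>a i \<alpha>. a \<in> A \<Longrightarrow> q a i \<alpha> \<in> sym_alg L N"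
    unfolding bchoice_iff by blast
  have "(\<Sum>a\<in>A. h a) = (\<Sum>(i, \<alpha>)\<in>{1..N} \<times> {1..L}. (\<Sum>a\<in>A. q a i \<alpha>) * E i N \<alpha>)"
  proof -
    have "(\<Sum>a\<in>A. h a) = (\<Sum>a\<in>A. \<Sum>(i, \<alpha>)\<in>{1..N} \<times> {1..L}. q a i \<alpha> * E i N \<alpha>)"
      by (rule sum.cong[OF refl]) (rule q(1))
    also have "\<dots> = (\<Sum>(i, \<alpha>)\<in>{1..N} \<times> {1..L}. \<Sum>a\<in>A. q a i \<alpha> * E i N \<alpha>)"
      unfolding case_prod_beta by (rule sum.swap)
    finally show ?thesis by (simp only: sum_distrib_right)
  qed
  moreover have "(\<Sum>a\<in>A. q a i \<alpha>) \<in> sym_alg L N" for i \<alpha>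
  proof -
    have "Poly_Mapping.keys (\<Sum>a\<in>A. q a i \<alpha>) \<subseteq> (\<Union>a\<in>A. Poly_Mapping.keys (q a i \<alpha>))"
      by (auto simp: in_keys_iff lookup_sum elim!: sum.not_neutral_contains_not_neutral)
    then show ?thesis using q(2) unfolding sym_alg_def polys_in_def by blast
  qed
  ultimately show ?thesis unfolding ideal_plus_def
    by (intro CollectI exI[of _ "\<lambda>i \<alpha>. \<Sum>a\<in>A. q a i \<alpha>"] conjI allI)
qed

lemma proj_unique_exists:
  assumes N: "1 \<le> N" and f: "f \<in> inv_alg (N - 1) L N"
  shows "\<exists>!g. g \<in> sym_alg L (N - 1) \<and> f - g \<in> inv_alg (N - 1) L N \<inter> ideal_plus L N"
proof (rule ex_ex1I)
  let ?B = "basis_index L (N - 1)"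
  define K where "K = {m \<in> Poly_Mapping.keys f. Poly_Mapping.keys m \<subseteq> ?B}"
  define g where "g = (\<Sum>m\<in>K. Poly_Mapping.single m (Poly_Mapping.lookup f m))"
  have lg: "Poly_Mapping.lookup g m = (if m \<in> K then Poly_Mapping.lookup f m else 0)" for m
    by (simp add: g_def K_def lookup_sum_single)
  have gS: "g \<in> sym_alg L (N - 1)"
    unfolding sym_alg_def polys_in_def mem_Collect_eq
  proof
    fix m assume "m \<in> Poly_Mapping.keys g"
    then have "m \<in> K" by (simp add: in_keys_iff lg split: if_splits)
    then show "Poly_Mapping.keys m \<subseteq> ?B" by (simp add: K_def)
  qed
  have "f - g \<in> inv_alg (N - 1) L N"
  proof -
    have "Poly_Mapping.keys (f - g) \<subseteq> Poly_Mapping.keys f"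
      by (auto simp: in_keys_iff lookup_minus lg split: if_splits)
    then have "f - g \<in> sym_alg L N" using f by (auto simp: inv_alg_def sym_alg_def polys_in_def)
    then show ?thesis using f sym_alg_subset_inv_alg[OF gS N]
      by (simp add: inv_alg_def ad_action_diff)
  qed
  moreover have "f - g \<in> ideal_plus L N"
  proof -
    have "Poly_Mapping.single m (Poly_Mapping.lookup (f - g) m) \<in> ideal_plus L N"
      if "m \<in> Poly_Mapping.keys (f - g)" for m
    proof -
      have m: "m \<in> Poly_Mapping.keys f" and nB: "\<not> Poly_Mapping.keys m \<subseteq> ?B"
        using that by (auto simp: in_keys_iff lookup_minus lg K_def split: if_splits)
      have mS: "Poly_Mapping.keys m \<subseteq> basis_index L N"
        using f m by (auto simp: inv_alg_def sym_alg_def polys_in_def)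
      have "\<exists>i \<alpha>. (i, N, \<alpha>) \<in> Poly_Mapping.keys m"
      proof (rule ccontr)
        assume no: "\<not> ?thesis"
        obtain i j \<alpha> where v: "(i, j, \<alpha>) \<in> Poly_Mapping.keys m" "(i, j, \<alpha>) \<notin> ?B" using nB by auto
        then have vB: "(i, j, \<alpha>) \<in> basis_index L N" using mS by auto
        have iN: "i = N" 
        proof (rule ccontr)
          assume "i \<noteq> N"
          moreover have "j \<noteq> N" using v(1) no by blast
          ultimately show False using v(2) vB unfolding basis_index_def by simp arith
        qed
        have "0 = (\<Sum>(i, j, \<alpha>)\<in>basis_index L N. (of_bool (i = N) - of_bool (j = N))
            * (of_nat (Poly_Mapping.lookup m (i, j, \<alpha>)) :: complex))"
          using corner_weight[OF f N m] by simp
        also have "\<dots> = (\<Sum>(i, j, \<alpha>)\<in>basis_index L N.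
            of_nat (of_bool (i = N) * Poly_Mapping.lookup m (i, j, \<alpha>)))"
          by (rule sum.cong[OF refl]) (use no in \<open>auto simp: in_keys_iff\<close>)
        also have "\<dots> = of_nat (\<Sum>(i, j, \<alpha>)\<in>basis_index L N. of_bool (i = N) * Poly_Mapping.lookup m (i, j, \<alpha>))"
          by (simp add: case_prod_beta)
        finally have "(\<Sum>(i, j, \<alpha>)\<in>basis_index L N. of_bool (i = N) * Poly_Mapping.lookup m (i, j, \<alpha>)) = 0"
          unfolding of_nat_0_eq_iff by (rule sym)
        moreover have "finite (basis_index L N)" by (simp add: basis_index_def)
        ultimately have "\<forall>u\<in>basis_index L N.
            (case u of (i, j, \<alpha>) \<Rightarrow> of_bool (i = N) * Poly_Mapping.lookup m (i, j, \<alpha>)) = 0"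
          by (simp only: sum_eq_0_iff)
        from bspec[OF this vB] have "Poly_Mapping.lookup m (i, j, \<alpha>) = 0" using iN by simp
        then show False using v(1) by (simp add: in_keys_iff)
      qed
      then show ?thesis using ideal_plus_single mS by blast
    qed
    then have "(\<Sum>m\<in>Poly_Mapping.keys (f - g). Poly_Mapping.single m (Poly_Mapping.lookup (f - g) m))
        \<in> ideal_plus L N" by (intro ideal_plus_sum) auto
    then show ?thesis by (simp only: sum_single_keys)
  qed
  ultimately show "\<exists>g. g \<in> sym_alg L (N - 1) \<and> f - g \<in> inv_alg (N - 1) L N \<inter> ideal_plus L N"
    using gS by blast
next
  fix g g' assume a: "g \<in> sym_alg L (N - 1) \<and> f - g \<in> inv_alg (N - 1) L N \<inter> ideal_plus L N"
    and b: "g' \<in> sym_alg L (N - 1) \<and> f - g' \<in> inv_alg (N - 1) L N \<inter> ideal_plus L N"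
  show "g = g'"
  proof (rule poly_mapping_eqI, rule ccontr)
    fix m assume ne: "Poly_Mapping.lookup g m \<noteq> Poly_Mapping.lookup g' m"
    then have "m \<in> Poly_Mapping.keys g \<or> m \<in> Poly_Mapping.keys g'" by (auto simp: in_keys_iff)
    then have "Poly_Mapping.keys m \<subseteq> basis_index L (N - 1)"
      using a b by (auto simp: sym_alg_def polys_in_def)
    moreover have "m \<in> Poly_Mapping.keys (f - g) \<or> m \<in> Poly_Mapping.keys (f - g')"
      using ne by (auto simp: in_keys_iff lookup_minus)
    then have "\<exists>i \<alpha>. (i, N, \<alpha>) \<in> Poly_Mapping.keys m" using a b ideal_plus_key by blast
    ultimately show False using N by (auto simp: basis_index_def)
  qed
qed

end

theory Submission
  imports Defs "HOL-Library.Multiset"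
begin

text \<open>A monomial in matrix units is read as a finite directed multigraph: the matrix unit
  \<open>E i j \<alpha>\<close> is an edge from \<open>i\<close> to \<open>j\<close> labelled \<open>\<alpha>\<close>, and a vertex is called interior if it
  exceeds \<open>d\<close>. A summand of a generator \<open>Path i j w\<close> is a walk from \<open>i\<close> to \<open>j\<close> whose labels spell
  \<open>w\<close>, a summand of \<open>Circ c\<close> is a closed walk. Hence the monomials of a product of generators
  are the edge multisets of collections of walks, called configurations; the multiset of
  generators to which the walks belong is the type of the configuration. A configuration is
  generic if all vertices over which the generators sum are interior and distinct.

  Invariance under the diagonal matrix unit at an interior vertex \<open>a\<close> says that as many edges
  enter \<open>a\<close> as leave it, in every monomial of an invariant (\<open>inv_balanced\<close>). So each
  such monomial decomposes into walks between vertices \<open>\<le> d\<close> and closed walks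
  (\<open>euler_decomposition\<close>). Invariance under the matrix unit with row \<open>b\<close> and column \<open>a\<close> gives linear
  relations between the coefficients (\<open>inv_relation\<close>). Let \<open>b\<close> be a vertex that does not occur. If
  \<open>a\<close> is visited more than once, they express a coefficient by coefficients of monomials with
  more interior vertices (\<open>inv_split_vertex\<close>); if \<open>a\<close> is visited once, they say that \<open>a\<close> may be
  renamed to \<open>b\<close> (\<open>inv_rename_vertex\<close>, \<open>inv_rename_loop\<close>). When \<open>N\<close> is large compared with the
  degree there are always unused vertices, so an invariant is determined by its coefficients
  at generic configurations, and these depend only on the type (\<open>inv_zero_of_types\<close>). This is the
  first fundamental theorem in the stable range, obtained without representation theory.

  On the other hand, the type of a generic configuration can be recovered from its monomial by
  following edges (\<open>config_type_unique\<close>). Choose one generic configuration of each type. The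
  coefficient of a product of generators of type \<open>T\<close> at the chosen monomial of type \<open>S\<close> is nonzero
  for \<open>S = T\<close>, and otherwise vanishes unless \<open>S\<close> has fewer interior vertices than \<open>T\<close>: the
  generators also sum over indices \<open>\<le> d\<close>, which cut a walk into shorter ones
  (\<open>config_type_triangular\<close>). This triangular system yields the algebraic independence of the
  generators (\<open>gen_eval_eq_0_imp\<close>) and, together with the determination above, that they generate
  (\<open>lim_comp_in_image\<close>). The projections only delete monomials (\<open>proj_eq_iff\<close>), so in the limit \<open>N\<close>
  may be taken as large as the degree requires.\<close>

section \<open>Monomials, polynomials and their coefficients\<close>

lemma mon_degree_sum:
  assumes "finite K" "Poly_Mapping.keys m \<subseteq> K"
  shows "mon_degree w m = (\<Sum>x\<in>K. w x * Poly_Mapping.lookup m x)"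
  unfolding mon_degree_def using assms
  by (intro sum.mono_neutral_left) (auto simp: in_keys_iff)

lemma mon_degree_zero [simp]: "mon_degree w 0 = 0"
  by (simp add: mon_degree_def)

lemma mon_degree_single [simp]: "mon_degree w (Poly_Mapping.single x n) = w x * n"
  by (cases "n = 0") (simp_all add: mon_degree_def)

lemma mon_degree_add [simp]: "mon_degree w (m + m') = mon_degree w m + mon_degree w m'"
proof -
  let ?K = "Poly_Mapping.keys m \<union> Poly_Mapping.keys m'"
  have K: "finite ?K" "Poly_Mapping.keys (m + m') \<subseteq> ?K" by (simp, rule keys_add)
  show ?thesis
    unfolding mon_degree_sum[OF K] mon_degree_sum[OF K(1) Un_upper1] mon_degree_sum[OF K(1) Un_upper2]
    by (simp add: lookup_add sum.distrib distrib_left)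
qed

lemma mon_degree_eq_0: "mon_degree w m = 0 \<longleftrightarrow> (\<forall>x\<in>Poly_Mapping.keys m. w x = 0)"
  by (auto simp: mon_degree_def in_keys_iff)

lemma monomial_split:
  fixes m :: "'x \<Rightarrow>\<^sub>0 nat"
  assumes "x \<in> Poly_Mapping.keys m"
  shows "Poly_Mapping.single x 1 + (m - Poly_Mapping.single x 1) = m"
  using minus_single_add[of m x] assms by (simp add: in_keys_iff add.commute)

lemma monomial_split_ex:
  fixes m :: "'x \<Rightarrow>\<^sub>0 nat"
  assumes "x \<in> Poly_Mapping.keys m"
  obtains m' where "m = Poly_Mapping.single x 1 + m'"
  using monomial_split[OF assms] by metis

lemma keys_add_nat: "Poly_Mapping.keys (m + m') = Poly_Mapping.keys m \<union> Poly_Mapping.keys m'"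
  for m m' :: "'x \<Rightarrow>\<^sub>0 nat"
  by (auto simp: in_keys_iff lookup_add)

lemma monomial_induct [case_names zero add]:
  fixes m :: "'x \<Rightarrow>\<^sub>0 nat"
  assumes "P 0" and step: "\<And>x m. P m \<Longrightarrow> P (Poly_Mapping.single x 1 + m)"
  shows "P m"
proof (induction "mon_degree (\<lambda>_. 1) m" arbitrary: m)
  case 0
  then have "\<forall>x\<in>Poly_Mapping.keys m. (1::nat) = 0" by (metis mon_degree_eq_0)
  then have "m = 0" by (intro poly_mapping_eqI) (auto simp: in_keys_iff)
  then show ?case using assms(1) by simp
next
  case (Suc n)
  then obtain x where "x \<in> Poly_Mapping.keys m"
    by (metis Zero_not_Suc mon_degree_eq_0)
  then obtain m' where m: "m = Poly_Mapping.single x 1 + m'" by (rule monomial_split_ex)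
  have "P m'" using Suc(2) by (intro Suc(1)) (simp add: m)
  then show ?case unfolding m by (rule step)
qed

lemma poly_induct [case_names zero single add]:
  fixes f :: "'x cpoly"
  assumes "P 0" and s: "\<And>m c. P (Poly_Mapping.single m c)"
    and a: "\<And>f g. P f \<Longrightarrow> P g \<Longrightarrow> P (f + g)"
  shows "P f"
proof -
  have "P (\<Sum>m\<in>K. Poly_Mapping.single m (Poly_Mapping.lookup f m))" for K
    using assms by (induction K rule: infinite_finite_induct) auto
  from this[of "Poly_Mapping.keys f"] show ?thesis by (simp only: sum_single_keys)
qed

lemma mult_eq_double_sum:
  fixes f g :: "'x cpoly"
  shows
  "f * g = (\<Sum>a\<in>Poly_Mapping.keys f. \<Sum>b\<in>Poly_Mapping.keys g.
     Poly_Mapping.single (a + b) (Poly_Mapping.lookup f a * Poly_Mapping.lookup g b))"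
proof -
  have "f * g = (\<Sum>a\<in>Poly_Mapping.keys f. Poly_Mapping.single a (Poly_Mapping.lookup f a))
      * (\<Sum>b\<in>Poly_Mapping.keys g. Poly_Mapping.single b (Poly_Mapping.lookup g b))"
    by (simp only: sum_single_keys)
  then show ?thesis by (simp only: sum_product mult_single)
qed

lemma cconst_simps [simp]: "cconst 0 = 0" "cconst 1 = 1"
  "cconst (a + b) = cconst a + cconst b" "cconst (a * b) = cconst a * cconst b"
  "cconst (a - b) = cconst a - cconst b" "cconst (- a) = - cconst a"
  by (simp_all add: cconst_def single_add single_diff single_uminus mult_single)

lemma lookup_cconst_mult [simp]:
  "Poly_Mapping.lookup (cconst c * f) m = c * Poly_Mapping.lookup f m"
proof -
  have "cconst c * f = (\<Sum>k\<in>Poly_Mapping.keys f. Poly_Mapping.single k (c * Poly_Mapping.lookup f k))"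
    by (subst sum_single_keys[of f, symmetric])
       (simp add: sum_distrib_left cconst_def mult_single)
  then show ?thesis by (simp add: lookup_sum_single in_keys_iff)
qed

lemma polys_in_iff: "f \<in> polys_in X \<longleftrightarrow>
    (\<forall>m. Poly_Mapping.lookup f m \<noteq> 0 \<longrightarrow> Poly_Mapping.keys m \<subseteq> X)"
  by (auto simp: polys_in_def in_keys_iff)

lemma homogeneous_iff: "homogeneous w n f \<longleftrightarrow>
    (\<forall>m. Poly_Mapping.lookup f m \<noteq> 0 \<longrightarrow> mon_degree w m = n)"
  by (auto simp: homogeneous_def in_keys_iff)

lemma polys_in_add: "f \<in> polys_in X \<Longrightarrow> g \<in> polys_in X \<Longrightarrow> f + g \<in> polys_in X"
  using keys_add[of f g] by (auto simp: polys_in_def)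

lemma polys_in_mult: "f \<in> polys_in X \<Longrightarrow> g \<in> polys_in X \<Longrightarrow> f * g \<in> polys_in X"
  using keys_mult[of f g] by (force simp: polys_in_def keys_add_nat)

lemma polys_in_cconst [simp]: "cconst c \<in> polys_in X"
  by (simp add: polys_in_def cconst_def)

lemma polys_in_sum: "(\<And>a. a \<in> A \<Longrightarrow> f a \<in> polys_in X) \<Longrightarrow> (\<Sum>a\<in>A. f a) \<in> polys_in X"
  by (induction A rule: infinite_finite_induct) (auto simp: polys_in_add, simp_all add: polys_in_def)

section \<open>Invariants form a subalgebra\<close>

lemma partial_add: "partial x (f + g) = partial x f + partial x g"
  by (rule poly_mapping_eqI) (simp add: lookup_partial lookup_add algebra_simps)

lemma partial_single: "partial x (Poly_Mapping.single m c) =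
    Poly_Mapping.single (m - Poly_Mapping.single x 1) (of_nat (Poly_Mapping.lookup m x) * c)"
  by (cases "c = 0") (simp_all add: partial_def)

lemma partial_single_mult:
  "partial x (Poly_Mapping.single m c * Poly_Mapping.single k e) =
     partial x (Poly_Mapping.single m c) * Poly_Mapping.single k e
     + Poly_Mapping.single m c * partial x (Poly_Mapping.single k e)"
proof -
  let ?e = "Poly_Mapping.single x (1::nat)"
  have *: "Poly_Mapping.single (m - ?e + k) (of_nat (Poly_Mapping.lookup m x) * c * e)
      = Poly_Mapping.single (m + k - ?e) (of_nat (Poly_Mapping.lookup m x) * c * e)" for m k and c e :: complex
  proof (cases "Poly_Mapping.lookup m x = 0")
    case False
    then have "m - ?e + k = m + k - ?e"
      by (intro poly_mapping_eqI) (auto simp: lookup_add lookup_minus lookup_single when_def)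
    then show ?thesis by simp
  qed simp
  show ?thesis
    using *[of m k c e] *[of k m e c]
    by (simp add: mult_single partial_single lookup_add algebra_simps flip: single_add)
qed

lemma partial_zero [simp]: "partial x 0 = 0"
  by (simp add: partial_def)

lemma partial_mult: "partial x (f * g) = partial x f * g + f * partial x g"
proof (induction f rule: poly_induct)
  case (single m c)
  show ?case
  proof (induction g rule: poly_induct)
    case (single k e)
    show ?case by (rule partial_single_mult)
  next
    case (add g h)
    then show ?case by (simp add: distrib_left partial_add)
  qed simp
next
  case (add f h)
  then show ?case by (simp add: distrib_right partial_add)
qed simp

lemma ad_action_mult:
  "ad_action L N X (f * g) = ad_action L N X f * g + f * ad_action L N X g"
  by (simp add: ad_action_def partial_mult case_prod_beta sum_distrib_left sum_distrib_right
      distrib_left sum.distrib mult_ac)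

lemma ad_action_add: "ad_action L N X (f + g) = ad_action L N X f + ad_action L N X g"
  by (simp add: ad_action_def partial_add case_prod_beta sum.distrib distrib_left)

lemma ad_action_zero [simp]: "ad_action L N X 0 = 0"
  using ad_action_diff[of L N X 0 0] by simp

lemma ad_action_sum: "ad_action L N X (\<Sum>a\<in>A. f a) = (\<Sum>a\<in>A. ad_action L N X (f a))"
  by (induction A rule: infinite_finite_induct) (simp_all add: ad_action_add)

lemma ad_action_cconst [simp]: "ad_action L N X (cconst c) = 0"
  unfolding ad_action_def
  by (intro sum.neutral ballI, clarify, subst partial_notin) (auto simp: cconst_def)

lemma inv_alg_add: "f \<in> inv_alg d L N \<Longrightarrow> g \<in> inv_alg d L N \<Longrightarrow> f + g \<in> inv_alg d L N"
  by (simp add: inv_alg_def sym_alg_def polys_in_add ad_action_add)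

lemma inv_alg_mult: "f \<in> inv_alg d L N \<Longrightarrow> g \<in> inv_alg d L N \<Longrightarrow> f * g \<in> inv_alg d L N"
  by (simp add: inv_alg_def sym_alg_def polys_in_mult ad_action_mult)

lemma inv_alg_cconst: "cconst c \<in> inv_alg d L N"
  by (simp add: inv_alg_def sym_alg_def)

lemma inv_alg_one: "1 \<in> inv_alg d L N"
  using inv_alg_cconst[of 1] by simp

lemma inv_alg_power: "f \<in> inv_alg d L N \<Longrightarrow> f ^ n \<in> inv_alg d L N"
  by (induction n) (simp_all add: inv_alg_one inv_alg_mult)

lemma inv_alg_prod: "(\<And>a. a \<in> A \<Longrightarrow> f a \<in> inv_alg d L N) \<Longrightarrow> (\<Prod>a\<in>A. f a) \<in> inv_alg d L N"
  by (induction A rule: infinite_finite_induct) (auto simp: inv_alg_one inv_alg_mult)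

lemma inv_alg_zero: "0 \<in> inv_alg d L N"
  using inv_alg_cconst[of 0] by simp

lemma lin_emb_commutator:
  assumes "(i, j, \<alpha>) \<in> basis_index L N"
  shows "lin_emb L N (\<lambda>\<beta>. commutator N (diag_emb L X \<beta>) (matrix_unit i j \<alpha> \<beta>))
    = (\<Sum>k=1..N. cconst (X k i) * E k j \<alpha>) - (\<Sum>k=1..N. cconst (X j k) * E i k \<alpha>)"
proof -
  have ij: "i \<in> {1..N}" "j \<in> {1..N}" "\<alpha> \<in> {1..L}" using assms by (auto simp: basis_index_def)
  have c: "commutator N (diag_emb L X \<beta>) (matrix_unit i j \<alpha> \<beta>) k l
      = (if \<beta> = \<alpha> then (if l = j then X k i else 0) - (if k = i then X j l else 0) else 0)" for \<beta> k l
  proof (cases "\<beta> = \<alpha>")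
    case True
    have "(\<Sum>m=1..N. X k m * (if m = i \<and> l = j then 1 else 0)) = (if l = j then X k i else 0)"
      using ij by (cases "l = j") (simp_all add: if_distrib[of "\<lambda>t. _ * t"] cong: if_cong)
    moreover have "(\<Sum>m=1..N. (if k = i \<and> m = j then 1 else 0) * X m l) = (if k = i then X j l else 0)"
      using ij by (cases "k = i") (simp_all add: if_distrib[of "\<lambda>t. t * _"] cong: if_cong)
    ultimately show ?thesis using True ij(3)
      by (auto simp: commutator_def mat_prod_def diag_emb_def matrix_unit_def simp flip: One_nat_def)
  qed (auto simp: commutator_def mat_prod_def diag_emb_def matrix_unit_def)
  have "lin_emb L N (\<lambda>\<beta>. commutator N (diag_emb L X \<beta>) (matrix_unit i j \<alpha> \<beta>))
     = (\<Sum>k\<in>{1..N}. \<Sum>l\<in>{1..N}. \<Sum>\<beta>\<in>{1..L}. if \<beta> = \<alpha> then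
           (if l = j then cconst (X k i) * E k l \<alpha> else 0) - (if k = i then cconst (X j l) * E k l \<alpha> else 0) else 0)"
    unfolding lin_emb_def basis_index_def sum.cartesian_product
    by (rule sum.cong[OF refl]) (simp add: c left_diff_distrib split: prod.splits)
  also have "\<dots> = (\<Sum>k\<in>{1..N}. \<Sum>l\<in>{1..N}.
           (if l = j then cconst (X k i) * E k l \<alpha> else 0) - (if k = i then cconst (X j l) * E k l \<alpha> else 0))"
    using ij(3) by (intro sum.cong refl) (simp only: sum.delta finite_atLeastAtMost if_True)
  also have "\<dots> = (\<Sum>k=1..N. cconst (X k i) * E k j \<alpha>) - (\<Sum>k=1..N. cconst (X j k) * E i k \<alpha>)"
  proof -
    have "(\<Sum>k\<in>{1..N}. \<Sum>l\<in>{1..N}. if k = i then cconst (X j l) * E k l \<alpha> else 0)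
        = (\<Sum>k=1..N. cconst (X j k) * E i k \<alpha>)"
      using ij(1) by (subst sum.swap, simp only: sum.delta finite_atLeastAtMost if_True)
    moreover have "(\<Sum>k\<in>{1..N}. \<Sum>l\<in>{1..N}. if l = j then cconst (X k i) * E k l \<alpha> else 0)
        = (\<Sum>k=1..N. cconst (X k i) * E k j \<alpha>)"
      using ij(2) by (simp only: sum.delta finite_atLeastAtMost if_True)
    ultimately show ?thesis by (simp add: sum_subtractf)
  qed
  finally show ?thesis .
qed

lemma partial_E: "partial v (E i j \<alpha>) = (if v = (i, j, \<alpha>) then 1 else 0)"
  by (cases v) (auto simp: E_def cvar_def partial_single lookup_single)

lemma ad_action_E:
  assumes "(i, j, \<alpha>) \<in> basis_index L N"
  shows "ad_action L N (diag_emb L X) (E i j \<alpha>)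
    = (\<Sum>k=1..N. cconst (X k i) * E k j \<alpha>) - (\<Sum>k=1..N. cconst (X j k) * E i k \<alpha>)"
proof -
  have fin: "finite (basis_index L N)" by (simp add: basis_index_def)
  have "ad_action L N (diag_emb L X) (E i j \<alpha>) = (\<Sum>v\<in>basis_index L N. if v = (i, j, \<alpha>) then
     lin_emb L N (\<lambda>\<beta>. commutator N (diag_emb L X \<beta>) (matrix_unit i j \<alpha> \<beta>)) else 0)"
    unfolding ad_action_def by (rule sum.cong[OF refl]) (auto simp: partial_E split: prod.splits)
  also have "\<dots> = lin_emb L N (\<lambda>\<beta>. commutator N (diag_emb L X \<beta>) (matrix_unit i j \<alpha> \<beta>))"
    using assms fin by (simp only: sum.delta if_True)
  finally show ?thesis using lin_emb_commutator[OF assms] by simp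
qed

text \<open>Congruence modulo the ideal generated by the variables outside \<open>X\<close>.\<close>

definition cong_outside :: "'x set \<Rightarrow> 'x cpoly \<Rightarrow> 'x cpoly \<Rightarrow> bool" where
  "cong_outside X f g \<longleftrightarrow> (\<forall>m. Poly_Mapping.keys m \<subseteq> X \<longrightarrow> Poly_Mapping.lookup f m = Poly_Mapping.lookup g m)"

lemma cong_outside_refl [simp]: "cong_outside X f f"
  by (simp add: cong_outside_def)

lemma cong_outside_add: "cong_outside X f f' \<Longrightarrow> cong_outside X g g' \<Longrightarrow> cong_outside X (f + g) (f' + g')"
  by (simp add: cong_outside_def lookup_add)

lemma cong_outside_sum:
  "(\<And>a. a \<in> A \<Longrightarrow> cong_outside X (f a) (g a)) \<Longrightarrow> cong_outside X (\<Sum>a\<in>A. f a) (\<Sum>a\<in>A. g a)"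
  by (simp add: cong_outside_def lookup_sum)

text \<open>A product of two monomials has all its variables in \<open>X\<close> only if both factors do, so the
  coefficients at such monomials do not see the rest of the two polynomials.\<close>

lemma cong_outside_mult:
  assumes "cong_outside X f f'" "cong_outside X g g'"
  shows "cong_outside X (f * g) (f' * g')"
  unfolding cong_outside_def
proof (intro allI impI)
  fix m :: "'a \<Rightarrow>\<^sub>0 nat" assume m: "Poly_Mapping.keys m \<subseteq> X"
  have g: "(Poly_Mapping.lookup g k when m = l + k) = (Poly_Mapping.lookup g' k when m = l + k)" for l k
    using m assms(2) by (auto simp: when_def cong_outside_def keys_add_nat)
  have f: "Poly_Mapping.lookup f l * Sum_any (\<lambda>k. Poly_Mapping.lookup g' k when m = l + k)
      = Poly_Mapping.lookup f' l * Sum_any (\<lambda>k. Poly_Mapping.lookup g' k when m = l + k)" for l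
  proof (cases "Poly_Mapping.keys l \<subseteq> X")
    case False
    then have "m \<noteq> l + k" for k using m by (auto simp: keys_add_nat)
    then show ?thesis by simp
  qed (use assms(1) in \<open>simp add: cong_outside_def\<close>)
  show "Poly_Mapping.lookup (f * g) m = Poly_Mapping.lookup (f' * g') m"
    unfolding lookup_mult g f ..
qed

lemma cong_outside_power: "cong_outside X f g \<Longrightarrow> cong_outside X (f ^ n) (g ^ n)"
  by (induction n) (simp_all add: cong_outside_mult)

lemma cong_outside_prod:
  "(\<And>a. a \<in> A \<Longrightarrow> cong_outside X (f a) (g a)) \<Longrightarrow> cong_outside X (\<Prod>a\<in>A. f a) (\<Prod>a\<in>A. g a)"
  by (induction A rule: infinite_finite_induct) (simp_all add: cong_outside_mult)

lemma E_cong_outside_0: "(i, j, \<alpha>) \<notin> X \<Longrightarrow> cong_outside X (E i j \<alpha>) 0"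
  by (auto simp: cong_outside_def E_def cvar_def lookup_single when_def)

lemma inv_alg_antimono:
  assumes "d \<le> d'"
  shows "inv_alg d L N \<subseteq> inv_alg d' L N"
proof -
  have "gl d' N \<subseteq> gl d N" using assms by (force simp: gl_def)
  then show ?thesis by (auto simp: inv_alg_def)
qed

text \<open>Every monomial of the ideal involves the index \<open>N\<close>, so the projection deletes exactly the
  monomials with that index. In this form compatibility with the projections is evidently
  preserved by sums and products.\<close>

lemma proj_eq_iff:
  assumes N: "1 \<le> N" and f: "f \<in> inv_alg (N - 1) L N" and g: "g \<in> sym_alg L (N - 1)"
  shows "proj L N f = g \<longleftrightarrow> cong_outside (basis_index L (N - 1)) f g"
proof -
  let ?X = "basis_index L (N - 1)"
  define p where "p = proj L N f"
  have p: "p \<in> sym_alg L (N - 1)" "f - p \<in> ideal_plus L N"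
    using theI'[OF proj_unique_exists[OF N f]] unfolding p_def proj_def by auto
  have "cong_outside ?X f p"
    unfolding cong_outside_def
  proof (intro allI impI, rule ccontr)
    fix m assume m: "Poly_Mapping.keys m \<subseteq> ?X" "Poly_Mapping.lookup f m \<noteq> Poly_Mapping.lookup p m"
    then have "m \<in> Poly_Mapping.keys (f - p)" by (simp add: in_keys_iff lookup_minus)
    from ideal_plus_key[OF p(2) this] m(1) N show False by (auto simp: basis_index_def)
  qed
  moreover have "p = g" if "cong_outside ?X p g"
  proof (rule poly_mapping_eqI)
    fix m show "Poly_Mapping.lookup p m = Poly_Mapping.lookup g m"
      using that p(1) g unfolding sym_alg_def polys_in_iff cong_outside_def by metis
  qed
  ultimately show ?thesis unfolding p_def[symmetric] by (auto simp: cong_outside_def)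
qed

lemma lim_comp_iff:
  "f \<in> lim_comp d L n \<longleftrightarrow> (\<forall>k. f k \<in> inv_alg d L (d + k) \<and> homogeneous (\<lambda>_. 1) n (f k) \<and>
     cong_outside (basis_index L (d + k)) (f (Suc k)) (f k))"
proof -
  have "proj L (Suc (d + k)) (f (Suc k)) = f k \<longleftrightarrow> cong_outside (basis_index L (d + k)) (f (Suc k)) (f k)"
    if "f (Suc k) \<in> inv_alg d L (d + Suc k)" "f k \<in> inv_alg d L (d + k)" for k
  proof -
    have "f (Suc k) \<in> inv_alg (d + k) L (Suc (d + k))"
      using that(1) inv_alg_antimono[of d "d + k" L "Suc (d + k)"] by auto
    moreover have "f k \<in> sym_alg L (d + k)" using that(2) by (simp add: inv_alg_def)
    ultimately show ?thesis using proj_eq_iff[of "Suc (d + k)" "f (Suc k)" L "f k"] by simp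
  qed
  then show ?thesis unfolding lim_comp_def by blast
qed

section \<open>Path polynomials\<close>

lemma index_lists_0: "index_lists N 0 = {[]}"
  by (auto simp: index_lists_def)

lemma index_lists_Suc:
  "index_lists N (Suc n) = (\<lambda>(k, a). k # a) ` ({1..N} \<times> index_lists N n)"
proof
  show "index_lists N (Suc n) \<subseteq> (\<lambda>(k, a). k # a) ` ({1..N} \<times> index_lists N n)"
  proof
    fix b assume "b \<in> index_lists N (Suc n)"
    then show "b \<in> (\<lambda>(k, a). k # a) ` ({1..N} \<times> index_lists N n)"
      by (cases b) (auto simp: index_lists_def image_iff)
  qed
qed (auto simp: index_lists_def)

lemma sum_index_lists_Suc:
  "(\<Sum>b\<in>index_lists N (Suc n). f b) = (\<Sum>k=1..N. \<Sum>a\<in>index_lists N n. f (k # a))"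
proof -
  have "inj_on (\<lambda>(k, a). k # a) ({1..N} \<times> index_lists N n)" by (auto simp: inj_on_def)
  then show ?thesis
    unfolding index_lists_Suc by (subst sum.reindex) (simp_all add: sum.cartesian_product case_prod_beta)
qed

lemma p_path_single: "p_path i j [\<alpha>] N = E i j \<alpha>"
  by (simp add: p_path_def index_lists_0)

lemma p_path_Cons:
  assumes "w \<noteq> []"
  shows "p_path i j (\<alpha> # w) N = (\<Sum>k=1..N. E i k \<alpha> * p_path k j w N)"
proof -
  obtain n where n: "length w = Suc n" using assms by (cases w) auto
  show ?thesis
    unfolding p_path_def n length_Cons diff_Suc_1 sum_index_lists_Suc
    by (simp only: prod.lessThan_Suc_shift[of _ "Suc n"] nth_Cons_0 nth_Cons_Suc append_Cons sum_distrib_left)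
qed

text \<open>The trace of a matrix product; it reduces statements about circular words to paths.\<close>

lemma p_word_eq_sum_p_path:
  assumes "w \<noteq> []"
  shows "p_word w N = (\<Sum>x=1..N. p_path x x w N)"
proof -
  obtain n where n: "length w = Suc n" using assms by (cases w) auto
  have *: "(\<Prod>r<Suc n. E ((x # a) ! r) ((x # a) ! (Suc r mod Suc n)) (w ! r))
      = (\<Prod>r<Suc n. E ((x # a @ [x]) ! r) ((x # a @ [x]) ! Suc r) (w ! r))"
    if "a \<in> index_lists N n" for x a
  proof (rule prod.cong[OF refl])
    fix r assume "r \<in> {..<Suc n}"
    moreover have "length a = n" using that by (simp add: index_lists_def)
    ultimately have "(x # a) ! r = (x # a @ [x]) ! r"
        "(x # a) ! (Suc r mod Suc n) = (x # a @ [x]) ! Suc r"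
      by (auto simp: nth_append nth_Cons split: nat.splits)
        (metis less_Suc_eq mod_Suc mod_less nat.distinct(1))
    then show "E ((x # a) ! r) ((x # a) ! (Suc r mod Suc n)) (w ! r)
      = E ((x # a @ [x]) ! r) ((x # a @ [x]) ! Suc r) (w ! r)" by simp
  qed
  show ?thesis
    unfolding p_word_def p_path_def n diff_Suc_1 sum_index_lists_Suc
    by (intro sum.cong refl *)
qed

text \<open>The polynomials \<open>p_path i j w N\<close> are the entries of the product of the matrices
  \<open>(E i j \<alpha>)\<close> along \<open>w\<close>. The action of \<open>X\<close> is a commutator with each factor, hence with the
  product: the contributions at the inner summation indices cancel.\<close>

lemma ad_action_p_path:
  assumes "i \<in> {1..N}" "j \<in> {1..N}" "w \<in> words L"
  shows "ad_action L N (diag_emb L X) (p_path i j w N)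
    = (\<Sum>k=1..N. cconst (X k i) * p_path k j w N) - (\<Sum>k=1..N. cconst (X j k) * p_path i k w N)"
  using assms
proof (induction w arbitrary: i)
  case (Cons \<alpha> w)
  have \<alpha>: "\<alpha> \<in> {1..L}" using Cons(4) by (simp add: words_def)
  show ?case
  proof (cases "w = []")
    case True
    then show ?thesis using Cons(2,3) \<alpha> by (simp add: p_path_single ad_action_E basis_index_def)
  next
    case False
    let ?P = "\<lambda>k. p_path k j w N"
    have w: "w \<in> words L" using Cons(4) False by (simp add: words_def)
    have "ad_action L N (diag_emb L X) (p_path i j (\<alpha> # w) N)
      = (\<Sum>k=1..N. ((\<Sum>l=1..N. cconst (X l i) * E l k \<alpha>) - (\<Sum>l=1..N. cconst (X k l) * E i l \<alpha>)) * ?P k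
           + E i k \<alpha> * ((\<Sum>l=1..N. cconst (X l k) * ?P l) - (\<Sum>l=1..N. cconst (X j l) * p_path k l w N)))"
      unfolding p_path_Cons[OF False] ad_action_sum ad_action_mult
      by (intro sum.cong refl arg_cong2[of _ _ _ _ "(+)"] arg_cong2[of _ _ _ _ "(*)"])
         (use Cons(2,3) \<alpha> w Cons.IH in \<open>auto simp: ad_action_E basis_index_def\<close>)
    also have "\<dots> = (\<Sum>k=1..N. \<Sum>l=1..N. cconst (X l i) * E l k \<alpha> * ?P k)
        - (\<Sum>k=1..N. \<Sum>l=1..N. cconst (X k l) * E i l \<alpha> * ?P k)
        + (\<Sum>k=1..N. \<Sum>l=1..N. cconst (X l k) * E i k \<alpha> * ?P l)
        - (\<Sum>k=1..N. \<Sum>l=1..N. cconst (X j l) * E i k \<alpha> * p_path k l w N)"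
      by (simp add: sum.distrib sum_subtractf algebra_simps sum_distrib_left sum_distrib_right)
    \<comment> \<open>the terms at the index that joins the first factor to the rest; they cancel\<close>
    also have "(\<Sum>k=1..N. \<Sum>l=1..N. cconst (X l k) * E i k \<alpha> * ?P l)
        = (\<Sum>k=1..N. \<Sum>l=1..N. cconst (X k l) * E i l \<alpha> * ?P k)" by (rule sum.swap)
    also have "(\<Sum>k=1..N. \<Sum>l=1..N. cconst (X l i) * E l k \<alpha> * ?P k)
        = (\<Sum>k=1..N. cconst (X k i) * p_path k j (\<alpha> # w) N)"
      by (subst sum.swap) (simp add: p_path_Cons[OF False] sum_distrib_left mult.assoc)
    also have "(\<Sum>k=1..N. \<Sum>l=1..N. cconst (X j l) * E i k \<alpha> * p_path k l w N)
        = (\<Sum>k=1..N. cconst (X j k) * p_path i k (\<alpha> # w) N)"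
      by (subst sum.swap) (simp add: p_path_Cons[OF False] sum_distrib_left mult.assoc)
    finally show ?thesis by simp
  qed
qed (simp add: words_def)

lemma p_path_annihilated:
  assumes "i \<in> {1..d}" "j \<in> {1..d}" "d \<le> N" "w \<in> words L" "X \<in> gl d N"
  shows "ad_action L N (diag_emb L X) (p_path i j w N) = 0"
proof -
  have "X k i = 0" "X j k = 0" for k using assms by (fastforce simp: gl_def)+
  then show ?thesis using assms by (subst ad_action_p_path) auto
qed

text \<open>A commutator has trace zero.\<close>

lemma p_word_annihilated:
  assumes "w \<in> words L"
  shows "ad_action L N (diag_emb L X) (p_word w N) = 0"
proof -
  have "w \<noteq> []" using assms by (simp add: words_def)
  then have "ad_action L N (diag_emb L X) (p_word w N)
    = (\<Sum>x=1..N. (\<Sum>k=1..N. cconst (X k x) * p_path k x w N) - (\<Sum>k=1..N. cconst (X x k) * p_path x k w N))"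
    unfolding p_word_eq_sum_p_path[OF \<open>w \<noteq> []\<close>] ad_action_sum
    by (intro sum.cong refl ad_action_p_path assms)
  also have "\<dots> = 0"
    unfolding sum_subtractf by (subst sum.swap) simp
  finally show ?thesis .
qed

lemma p_path_cong_outside_0:
  assumes "w \<noteq> []"
  shows "cong_outside (basis_index L N) (p_path (Suc N) j w (Suc N)) 0"
proof -
  have E0: "cong_outside (basis_index L N) (E (Suc N) k \<alpha>) 0" for k \<alpha>
    by (rule E_cong_outside_0) (simp add: basis_index_def)
  show ?thesis
  proof (cases w)
    case (Cons \<alpha> v)
    then show ?thesis
    proof (cases "v = []")
      case True
      then show ?thesis using E0 by (simp add: Cons p_path_single)
    next
      case False
      have "cong_outside (basis_index L N) (\<Sum>k=1..Suc N. E (Suc N) k \<alpha> * p_path k j v (Suc N))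
          (\<Sum>k=1..Suc N. 0 * p_path k j v (Suc N))"
        by (intro cong_outside_sum cong_outside_mult E0 cong_outside_refl)
      then show ?thesis by (simp add: Cons p_path_Cons[OF False])
    qed
  qed (use assms in simp)
qed

lemma p_path_cong_outside:
  assumes "w \<noteq> []"
  shows "cong_outside (basis_index L N) (p_path i j w (Suc N)) (p_path i j w N)"
  using assms
proof (induction w arbitrary: i)
  case (Cons \<alpha> w)
  show ?case
  proof (cases "w = []")
    case False
    have "cong_outside (basis_index L N)
       ((\<Sum>k=1..N. E i k \<alpha> * p_path k j w (Suc N)) + E i (Suc N) \<alpha> * p_path (Suc N) j w (Suc N))
       ((\<Sum>k=1..N. E i k \<alpha> * p_path k j w N) + E i (Suc N) \<alpha> * 0)"
      by (intro cong_outside_add cong_outside_sum cong_outside_mult Cons.IH[OF False] cong_outside_refl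
          p_path_cong_outside_0[OF False])
    then show ?thesis by (simp add: p_path_Cons[OF False])
  qed (simp add: p_path_single)
qed simp

lemma p_word_cong_outside:
  assumes "w \<noteq> []"
  shows "cong_outside (basis_index L N) (p_word w (Suc N)) (p_word w N)"
proof -
  have "cong_outside (basis_index L N)
      ((\<Sum>x=1..N. p_path x x w (Suc N)) + p_path (Suc N) (Suc N) w (Suc N)) ((\<Sum>x=1..N. p_path x x w N) + 0)"
    by (intro cong_outside_add cong_outside_sum p_path_cong_outside[OF assms] p_path_cong_outside_0[OF assms])
  then show ?thesis by (simp add: p_word_eq_sum_p_path[OF assms])
qed

text \<open>The exponent of an edge is written \<open>1\<close> throughout; it must not be rewritten to \<open>Suc 0\<close>, or
  simplification rules about edges would no longer apply.\<close>

declare One_nat_def [simp del]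

section \<open>Strands and the monomials they trace\<close>

type_synonym edge = "nat \<times> nat \<times> nat"
type_synonym salg_mon = "edge \<Rightarrow>\<^sub>0 nat"

abbreviation edge :: "nat \<Rightarrow> nat \<Rightarrow> nat \<Rightarrow> salg_mon" where
  "edge i j \<alpha> \<equiv> Poly_Mapping.single (i, j, \<alpha>) 1"

text \<open>A step is a pair of a label and the vertex it leads to.\<close>

fun walk :: "nat \<Rightarrow> (nat \<times> nat) list \<Rightarrow> salg_mon" where
  "walk x [] = 0"
| "walk x ((\<alpha>, y) # s) = edge x y \<alpha> + walk y s"

definition walk_end :: "nat \<Rightarrow> (nat \<times> nat) list \<Rightarrow> nat" where
  "walk_end x s = (if s = [] then x else snd (last s))"

lemma walk_end_simps [simp]: "walk_end x [] = x" "walk_end x ((\<alpha>, y) # s) = walk_end y s"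
  "walk_end x (s @ [(\<alpha>, y)]) = y"
  by (auto simp: walk_end_def)

lemma walk_append [simp]: "walk x (s @ t) = walk x s + walk (walk_end x s) t"
  by (induction x s rule: walk.induct) (simp_all add: add.assoc)

lemma walk_end_append [simp]: "walk_end x (s @ t) = walk_end (walk_end x s) t"
  by (auto simp: walk_end_def)

text \<open>A closed strand carries no starting vertex: it starts where its last step ends.\<close>

datatype strand = Open nat "(nat \<times> nat) list" | Closed "(nat \<times> nat) list"

fun strand_mon :: "strand \<Rightarrow> salg_mon" where
  "strand_mon (Open x s) = walk x s"
| "strand_mon (Closed s) = walk (snd (last s)) s"

fun strand_steps :: "strand \<Rightarrow> (nat \<times> nat) list" where
  "strand_steps (Open x s) = s"
| "strand_steps (Closed s) = s"

text \<open>The vertices over which the generator of the strand sums: the ends of an open strand are fixed.\<close>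

fun strand_verts :: "strand \<Rightarrow> nat list" where
  "strand_verts (Open x s) = map snd (butlast s)"
| "strand_verts (Closed s) = map snd s"

fun strand_gen :: "nat \<Rightarrow> strand \<Rightarrow> gen_index" where
  "strand_gen L (Open x s) = Path x (snd (last s)) (map fst s)"
| "strand_gen L (Closed s) = Circ (rotation_rel L `` {map fst s})"

fun strand_in :: "nat \<Rightarrow> nat \<Rightarrow> nat \<Rightarrow> strand \<Rightarrow> bool" where
  "strand_in d L N (Open x s) \<longleftrightarrow> x \<in> {1..d} \<and> snd (last s) \<in> {1..d} \<and> map fst s \<in> words L
     \<and> snd ` set (butlast s) \<subseteq> {1..N}"
| "strand_in d L N (Closed s) \<longleftrightarrow> map fst s \<in> words L \<and> snd ` set s \<subseteq> {1..N}"

section \<open>The monomials of the generators\<close>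

text \<open>Without signs nothing cancels, so the monomials of a product are all the products of
  monomials of the factors.\<close>

definition nat_coeffs :: "'x cpoly \<Rightarrow> bool" where
  "nat_coeffs f \<longleftrightarrow> (\<forall>m. Poly_Mapping.lookup f m \<in> \<nat>)"

lemma sum_Nats_eq_0_iff:
  fixes f :: "'a \<Rightarrow> complex"
  assumes "finite A" "\<And>a. a \<in> A \<Longrightarrow> f a \<in> \<nat>"
  shows "(\<Sum>a\<in>A. f a) = 0 \<longleftrightarrow> (\<forall>a\<in>A. f a = 0)"
proof -
  have "\<forall>a\<in>A. \<exists>n. f a = of_nat n" using assms(2) by (auto elim: Nats_cases)
  then obtain n where n: "\<And>a. a \<in> A \<Longrightarrow> f a = of_nat (n a)" by metis
  then have "(\<Sum>a\<in>A. f a) = of_nat (\<Sum>a\<in>A. n a)" by simp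
  then show ?thesis using n assms(1) by (simp del: of_nat_sum)
qed

lemma nat_coeffs_sum: "(\<And>a. a \<in> A \<Longrightarrow> nat_coeffs (f a)) \<Longrightarrow> nat_coeffs (\<Sum>a\<in>A. f a)"
proof (induction A rule: infinite_finite_induct)
  case (insert a A)
  then show ?case by (auto simp: nat_coeffs_def lookup_add intro!: Nats_add)
qed (simp_all add: nat_coeffs_def)

lemma keys_sum_nat_coeffs:
  assumes "finite A" "\<And>a. a \<in> A \<Longrightarrow> nat_coeffs (f a)"
  shows "Poly_Mapping.keys (\<Sum>a\<in>A. f a) = (\<Union>a\<in>A. Poly_Mapping.keys (f a))"
  using assms by (auto simp: in_keys_iff lookup_sum nat_coeffs_def sum_Nats_eq_0_iff)

lemma nat_coeffs_single: "c \<in> \<nat> \<Longrightarrow> nat_coeffs (Poly_Mapping.single m c)"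
  by (simp add: nat_coeffs_def lookup_single when_def)

lemma nat_coeffs_mult: "nat_coeffs f \<Longrightarrow> nat_coeffs g \<Longrightarrow> nat_coeffs (f * g)"
  unfolding mult_eq_double_sum
  by (intro nat_coeffs_sum nat_coeffs_single) (simp add: nat_coeffs_def)

lemma keys_mult_nat_coeffs:
  assumes f: "nat_coeffs f" and g: "nat_coeffs g"
  shows "Poly_Mapping.keys (f * g) = {a + b | a b. a \<in> Poly_Mapping.keys f \<and> b \<in> Poly_Mapping.keys g}"
proof -
  let ?c = "\<lambda>a b. Poly_Mapping.single (a + b) (Poly_Mapping.lookup f a * Poly_Mapping.lookup g b)"
  have n: "nat_coeffs (?c a b)" for a b
    using f g by (intro nat_coeffs_single) (simp add: nat_coeffs_def)
  have "Poly_Mapping.keys (f * g) = (\<Union>a\<in>Poly_Mapping.keys f. Poly_Mapping.keys (\<Sum>b\<in>Poly_Mapping.keys g. ?c a b))"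
    unfolding mult_eq_double_sum by (intro keys_sum_nat_coeffs nat_coeffs_sum n finite_keys)
  also have "\<dots> = (\<Union>a\<in>Poly_Mapping.keys f. \<Union>b\<in>Poly_Mapping.keys g. Poly_Mapping.keys (?c a b))"
    by (intro SUP_cong refl keys_sum_nat_coeffs n finite_keys)
  also have "\<dots> = (\<Union>a\<in>Poly_Mapping.keys f. \<Union>b\<in>Poly_Mapping.keys g. {a + b})"
    by (intro SUP_cong refl) (simp add: in_keys_iff)
  finally show ?thesis by auto
qed

lemma nat_coeffs_E: "nat_coeffs (E i j \<alpha>)"
  by (simp add: E_def cvar_def nat_coeffs_single)

lemma keys_E: "Poly_Mapping.keys (E i j \<alpha>) = {edge i j \<alpha>}"
  by (simp add: E_def cvar_def)

lemma nat_coeffs_p_path: "w \<noteq> [] \<Longrightarrow> nat_coeffs (p_path i j w N)"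
proof (induction w arbitrary: i)
  case (Cons \<alpha> w)
  then show ?case
    by (cases "w = []")
       (auto simp: p_path_single p_path_Cons intro!: nat_coeffs_E nat_coeffs_sum nat_coeffs_mult)
qed simp

lemma keys_p_path:
  assumes "w \<noteq> []"
  shows "Poly_Mapping.keys (p_path i j w N) =
    {walk i s | s. map fst s = w \<and> snd (last s) = j \<and> snd ` set (butlast s) \<subseteq> {1..N}}"
  using assms
proof (induction w arbitrary: i)
  case (Cons \<alpha> w)
  show ?case
  proof (cases "w = []")
    case True
    have *: "s = [(\<alpha>, j)] \<longleftrightarrow> map fst s = [\<alpha>] \<and> snd (last s) = j \<and> snd ` set (butlast s) \<subseteq> {1..N}" for s
      by auto
    have "{edge i j \<alpha>} = {walk i s | s. s = [(\<alpha>, j)]}" by simp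
    then show ?thesis unfolding True p_path_single keys_E * .
  next
    case False
    have "Poly_Mapping.keys (p_path i j (\<alpha> # w) N) = (\<Union>k\<in>{1..N}. {edge i k \<alpha> + b | b. b \<in> Poly_Mapping.keys (p_path k j w N)})"
    proof -
      have "Poly_Mapping.keys (E i k \<alpha> * p_path k j w N) = {edge i k \<alpha> + b | b. b \<in> Poly_Mapping.keys (p_path k j w N)}" for k
        by (simp add: keys_mult_nat_coeffs nat_coeffs_E nat_coeffs_p_path[OF False] keys_E)
      moreover have "Poly_Mapping.keys (\<Sum>k=1..N. E i k \<alpha> * p_path k j w N)
          = (\<Union>k\<in>{1..N}. Poly_Mapping.keys (E i k \<alpha> * p_path k j w N))"
        by (intro keys_sum_nat_coeffs nat_coeffs_mult nat_coeffs_E nat_coeffs_p_path[OF False] finite_atLeastAtMost)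
      ultimately show ?thesis unfolding p_path_Cons[OF False] by simp
    qed
    also have "\<dots> = {walk i s | s. map fst s = \<alpha> # w \<and> snd (last s) = j \<and> snd ` set (butlast s) \<subseteq> {1..N}}"
      (is "?A = ?B")
    proof
      show "?A \<subseteq> ?B"
      proof
        fix m assume "m \<in> ?A"
        then obtain k s where s: "k \<in> {1..N}" "m = edge i k \<alpha> + walk k s" "map fst s = w"
           "snd (last s) = j" "snd ` set (butlast s) \<subseteq> {1..N}"
          unfolding Cons.IH[OF False] by auto
        then show "m \<in> ?B" using False by (intro CollectI exI[of _ "(\<alpha>, k) # s"]) auto
      qed
      show "?B \<subseteq> ?A"
      proof
        fix m assume "m \<in> ?B"
        then obtain s where s: "m = walk i s" "map fst s = \<alpha> # w"
           "snd (last s) = j" "snd ` set (butlast s) \<subseteq> {1..N}" by (elim CollectE exE conjE) (rule that)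
        then obtain k t where t: "s = (\<alpha>, k) # t" "map fst t = w" by (cases s) auto
        then have "t \<noteq> []" using False by auto
        then have "walk k t \<in> Poly_Mapping.keys (p_path k j w N)" "k \<in> {1..N}" "m = edge i k \<alpha> + walk k t"
          using s t unfolding Cons.IH[OF False] by auto
        then show "m \<in> ?A" by blast
      qed
    qed
    finally show ?thesis .
  qed
qed simp

lemma nat_coeffs_p_word: "w \<noteq> [] \<Longrightarrow> nat_coeffs (p_word w N)"
  by (simp add: p_word_eq_sum_p_path nat_coeffs_sum nat_coeffs_p_path)

lemma keys_p_word:
  assumes "w \<noteq> []"
  shows "Poly_Mapping.keys (p_word w N) = {walk (snd (last s)) s | s. map fst s = w \<and> snd ` set s \<subseteq> {1..N}}"
proof -
  have *: "snd ` set s \<subseteq> {1..N} \<longleftrightarrow> snd (last s) \<in> {1..N} \<and> snd ` set (butlast s) \<subseteq> {1..N}"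
    if "map fst s = w" for s :: "(nat \<times> nat) list"
    using that assms by (cases s rule: rev_cases) auto
  have "Poly_Mapping.keys (p_word w N) = (\<Union>x\<in>{1..N}. Poly_Mapping.keys (p_path x x w N))"
    unfolding p_word_eq_sum_p_path[OF assms] using nat_coeffs_p_path[OF assms]
    by (intro keys_sum_nat_coeffs) auto
  also have "\<dots> = {walk (snd (last s)) s | s. map fst s = w \<and> snd ` set s \<subseteq> {1..N}}"
    (is "?A = ?B")
  proof
    show "?A \<subseteq> ?B"
    proof
      fix m assume "m \<in> ?A"
      then obtain s where "m = walk (snd (last s)) s" "map fst s = w" "snd (last s) \<in> {1..N}" "snd ` set (butlast s) \<subseteq> {1..N}"
        unfolding keys_p_path[OF assms] by auto
      then show "m \<in> ?B" using *[of s] by (intro CollectI exI[of _ s]) simp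
    qed
    show "?B \<subseteq> ?A"
    proof
      fix m assume "m \<in> ?B"
      then obtain s where "m = walk (snd (last s)) s" "map fst s = w" "snd ` set s \<subseteq> {1..N}" by auto
      then show "m \<in> ?A" using *[of s] unfolding keys_p_path[OF assms]
        by (intro UN_I[of "snd (last s)"] CollectI exI[of _ s]) simp_all
    qed
  qed
  finally show ?thesis .
qed

fun gen_poly :: "gen_index \<Rightarrow> nat \<Rightarrow> salg" where
  "gen_poly (Circ c) N = p_circ c N"
| "gen_poly (Path i j w) N = p_path i j w N"

lemma circular_words_cases:
  assumes "c \<in> circular_words L"
  obtains w where "w \<in> words L" "c = rotation_rel L `` {w}"
  using assms by (auto simp: circular_words_def elim: quotientE)

lemma gen_indices_cases:
  assumes "g \<in> gen_indices d L"
  obtains (circ) w where "w \<in> words L" "g = Circ (rotation_rel L `` {w})"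
  | (path) i j w where "g = Path i j w" "i \<in> {1..d}" "j \<in> {1..d}" "w \<in> words L"
  using assms by (auto simp: gen_indices_def elim!: circular_words_cases)

lemma rotation_class_eq_iff:
  "u \<in> words L \<Longrightarrow> v \<in> words L \<Longrightarrow> rotation_rel L `` {u} = rotation_rel L `` {v} \<longleftrightarrow> (\<exists>k. v = rotate k u)"
  using eq_equiv_class_iff[OF equiv_rotation_rel, of u L v] by (auto simp: rotation_rel_def)

lemma nat_coeffs_gen_poly: "g \<in> gen_indices d L \<Longrightarrow> nat_coeffs (gen_poly g N)"
  by (erule gen_indices_cases) (auto simp: p_circ_class words_def intro: nat_coeffs_p_word nat_coeffs_p_path)

lemma keys_gen_poly:
  assumes g: "g \<in> gen_indices d L"
  shows "Poly_Mapping.keys (gen_poly g N) = {strand_mon c | c. strand_in d L N c \<and> strand_gen L c = g}"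
  using g
proof (cases rule: gen_indices_cases)
  case (circ w)
  then have w: "w \<noteq> []" by (simp add: words_def)
  have "Poly_Mapping.keys (gen_poly g N) = {walk (snd (last s)) s | s. map fst s = w \<and> snd ` set s \<subseteq> {1..N}}"
    by (simp add: circ p_circ_class keys_p_word w)
  also have "\<dots> = {strand_mon c | c. strand_in d L N c \<and> strand_gen L c = g}" (is "?A = ?B")
  proof
    show "?A \<subseteq> ?B"
    proof
      fix m assume "m \<in> ?A"
      then obtain s where "m = walk (snd (last s)) s" "map fst s = w" "snd ` set s \<subseteq> {1..N}" by auto
      then show "m \<in> ?B" using circ by (intro CollectI exI[of _ "Closed s"]) auto
    qed
    show "?B \<subseteq> ?A"
    proof
      fix m assume "m \<in> ?B"
      then obtain c where c: "m = strand_mon c" "strand_in d L N c" "strand_gen L c = g" by auto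
      then obtain s where s: "c = Closed s" using circ by (cases c) auto
      let ?u = "map fst s"
      have u: "?u \<in> words L" "snd ` set s \<subseteq> {1..N}" using c(2) by (auto simp: s)
      then have "?u \<noteq> []" by (simp add: words_def)
      then have "m \<in> Poly_Mapping.keys (p_word ?u N)"
        unfolding keys_p_word[OF \<open>?u \<noteq> []\<close>] using c(1) u(2) by (auto simp: s)
      moreover obtain k where "w = rotate k ?u"
        using c(3) circ rotation_class_eq_iff[of ?u L w] u(1) by (auto simp: s)
      ultimately have "m \<in> Poly_Mapping.keys (p_word w N)" by (simp add: p_word_rotate)
      then show "m \<in> ?A" by (simp add: keys_p_word w)
    qed
  qed
  finally show ?thesis .
next
  case (path i j w)
  then have w: "w \<noteq> []" by (simp add: words_def)
  have "Poly_Mapping.keys (gen_poly g N) = {walk i s | s. map fst s = w \<and> snd (last s) = j \<and> snd ` set (butlast s) \<subseteq> {1..N}}"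
    by (simp add: path keys_p_path w)
  also have "\<dots> = {strand_mon c | c. strand_in d L N c \<and> strand_gen L c = g}" (is "?A = ?B")
  proof
    show "?A \<subseteq> ?B"
    proof
      fix m assume "m \<in> ?A"
      then obtain s where "m = walk i s" "map fst s = w" "snd (last s) = j" "snd ` set (butlast s) \<subseteq> {1..N}" by auto
      then show "m \<in> ?B" using path by (intro CollectI exI[of _ "Open i s"]) auto
    qed
    show "?B \<subseteq> ?A"
    proof
      fix m assume "m \<in> ?B"
      then obtain c where c: "m = strand_mon c" "strand_in d L N c" "strand_gen L c = g" by auto
      then show "m \<in> ?A" using path by (cases c) auto
    qed
  qed
  finally show ?thesis .
qed

section \<open>Configurations of strands and monomials in the generators\<close>

definition config_mon :: "strand multiset \<Rightarrow> salg_mon" where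
  "config_mon C = (\<Sum>c\<in>#C. strand_mon c)"

definition config_type :: "nat \<Rightarrow> strand multiset \<Rightarrow> gen_index \<Rightarrow>\<^sub>0 nat" where
  "config_type L C = (\<Sum>c\<in>#C. Poly_Mapping.single (strand_gen L c) 1)"

definition config_in :: "nat \<Rightarrow> nat \<Rightarrow> nat \<Rightarrow> strand multiset \<Rightarrow> bool" where
  "config_in d L N C \<longleftrightarrow> (\<forall>c\<in>#C. strand_in d L N c)"

lemma config_simps [simp]:
  "config_mon {#} = 0" "config_mon (add_mset c C) = strand_mon c + config_mon C"
  "config_mon (C + D) = config_mon C + config_mon D"
  "config_type L {#} = 0" "config_type L (add_mset c C) = Poly_Mapping.single (strand_gen L c) 1 + config_type L C"
  "config_type L (C + D) = config_type L C + config_type L D"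
  "config_in d L N {#}" "config_in d L N (add_mset c C) \<longleftrightarrow> strand_in d L N c \<and> config_in d L N C"
  "config_in d L N (C + D) \<longleftrightarrow> config_in d L N C \<and> config_in d L N D"
  by (auto simp: config_mon_def config_type_def config_in_def)

definition gen_monomial :: "(gen_index \<Rightarrow>\<^sub>0 nat) \<Rightarrow> nat \<Rightarrow> salg" where
  "gen_monomial T N = (\<Prod>g\<in>Poly_Mapping.keys T. gen_poly g N ^ Poly_Mapping.lookup T g)"

lemma gen_monomial_superset:
  assumes "finite K" "Poly_Mapping.keys T \<subseteq> K"
  shows "gen_monomial T N = (\<Prod>g\<in>K. gen_poly g N ^ Poly_Mapping.lookup T g)"
  unfolding gen_monomial_def using assms
  by (intro prod.mono_neutral_left) (auto simp: in_keys_iff)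

lemma gen_monomial_0 [simp]: "gen_monomial 0 N = 1"
  by (simp add: gen_monomial_def)

lemma gen_monomial_add: "gen_monomial (S + T) N = gen_monomial S N * gen_monomial T N"
proof -
  let ?K = "Poly_Mapping.keys S \<union> Poly_Mapping.keys T"
  have K: "finite ?K" "Poly_Mapping.keys (S + T) \<subseteq> ?K" by (simp_all add: keys_add_nat)
  show ?thesis
    unfolding gen_monomial_superset[OF K] gen_monomial_superset[OF K(1) Un_upper1]
      gen_monomial_superset[OF K(1) Un_upper2]
    by (simp add: lookup_add power_add prod.distrib)
qed

lemma gen_monomial_single [simp]: "gen_monomial (Poly_Mapping.single g 1) N = gen_poly g N"
  by (simp add: gen_monomial_def)

lemma nat_coeffs_gen_monomial:
  assumes "Poly_Mapping.keys T \<subseteq> gen_indices d L"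
  shows "nat_coeffs (gen_monomial T N)"
  using assms
proof (induction T rule: monomial_induct)
  case zero
  show ?case using nat_coeffs_single[of 1 0] by simp
next
  case (add g T)
  then show ?case
    by (auto simp: gen_monomial_add keys_add_nat intro!: nat_coeffs_mult nat_coeffs_gen_poly)
qed

lemma config_type_split:
  assumes "config_type L C = Poly_Mapping.single g 1 + T"
  obtains c D where "C = add_mset c D" "strand_gen L c = g" "config_type L D = T"
proof -
  have "Poly_Mapping.lookup (config_type L C) g > 0" unfolding assms by (simp add: lookup_add)
  moreover have "Poly_Mapping.lookup (config_type L C) g > 0 \<Longrightarrow> \<exists>c\<in>#C. strand_gen L c = g"
    by (induction C) (auto simp: lookup_add lookup_single when_def split: if_splits)
  ultimately obtain c where c: "c \<in># C" "strand_gen L c = g" by auto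
  then obtain D where "C = add_mset c D" by (metis insert_DiffM)
  then show ?thesis using that assms c by auto
qed

text \<open>Expanding a product of generators chooses one strand for each factor.\<close>

lemma keys_gen_monomial:
  assumes "Poly_Mapping.keys T \<subseteq> gen_indices d L"
  shows "Poly_Mapping.keys (gen_monomial T N) = {config_mon C | C. config_in d L N C \<and> config_type L C = T}"
  using assms
proof (induction T rule: monomial_induct)
  case zero
  have "mon_degree (\<lambda>_. 1) (config_type L C) = size C" for C
    by (induction C) auto
  then have "config_type L C = 0 \<longleftrightarrow> C = {#}" for C
    by (metis mon_degree_zero size_eq_0_iff_empty config_simps(4))
  then show ?case by auto
next
  case (add g T)
  then have g: "g \<in> gen_indices d L" and T: "Poly_Mapping.keys T \<subseteq> gen_indices d L"
    by (auto simp: keys_add_nat)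
  have "Poly_Mapping.keys (gen_monomial (Poly_Mapping.single g 1 + T) N)
     = {a + b | a b. a \<in> Poly_Mapping.keys (gen_poly g N) \<and> b \<in> Poly_Mapping.keys (gen_monomial T N)}"
    unfolding gen_monomial_add gen_monomial_single
    by (intro keys_mult_nat_coeffs nat_coeffs_gen_poly[OF g] nat_coeffs_gen_monomial[OF T])
  also have "\<dots> = {config_mon C | C. config_in d L N C \<and> config_type L C = Poly_Mapping.single g 1 + T}"
    (is "?A = ?B")
  proof
    show "?A \<subseteq> ?B"
    proof
      fix m assume "m \<in> ?A"
      then obtain c C where "m = strand_mon c + config_mon C" "strand_in d L N c" "strand_gen L c = g"
        "config_in d L N C" "config_type L C = T"
        unfolding add.IH[OF T] keys_gen_poly[OF g] by auto
      then show "m \<in> ?B" by (intro CollectI exI[of _ "add_mset c C"]) auto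
    qed
    show "?B \<subseteq> ?A"
    proof
      fix m assume "m \<in> ?B"
      then obtain C where C: "m = config_mon C" "config_in d L N C"
          "config_type L C = Poly_Mapping.single g 1 + T" by auto
      obtain c D where "C = add_mset c D" "strand_gen L c = g" "config_type L D = T"
        by (rule config_type_split[OF C(3)])
      then show "m \<in> ?A" using C(1,2) unfolding add.IH[OF T] keys_gen_poly[OF g] by auto
    qed
  qed
  finally show ?case .
qed

lemma degree_walk: "mon_degree (\<lambda>_. 1) (walk x s) = length s"
  by (induction x s rule: walk.induct) auto

text \<open>Makes products of generators homogeneous, since each of their monomials comes from a
  configuration of the same type.\<close>

lemma degree_config_mon:
  assumes "config_in d L N C"
  shows "mon_degree (\<lambda>_. 1) (config_mon C) = mon_degree gen_degree (config_type L C)"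
proof -
  have "mon_degree (\<lambda>_. 1) (strand_mon c) = gen_degree (strand_gen L c)" if "strand_in d L N c" for c
    using that by (cases c) (auto simp: degree_walk circ_length_class)
  then show ?thesis using assms by (induction C) auto
qed

lemma keys_walk:
  "Poly_Mapping.keys (walk x s) \<subseteq> insert x (snd ` set (butlast s)) \<times> (snd ` set s) \<times> (fst ` set s)"
proof (induction x s rule: walk.induct)
  case (2 x \<alpha> y s)
  let ?A = "insert x (snd ` set (butlast ((\<alpha>, y) # s))) \<times> (snd ` set ((\<alpha>, y) # s)) \<times> (fst ` set ((\<alpha>, y) # s))"
  have "Poly_Mapping.keys (walk y s) \<subseteq> ?A"
  proof (cases "s = []")
    case False
    then have "insert y (snd ` set (butlast s)) \<times> (snd ` set s) \<times> (fst ` set s) \<subseteq> ?A"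
      by (intro Sigma_mono) auto
    with 2 show ?thesis by (rule order_trans)
  qed simp
  moreover have "(x, y, \<alpha>) \<in> ?A" by simp
  ultimately show ?case unfolding walk.simps keys_add_nat by simp
qed simp

lemma keys_strand_mon:
  assumes "strand_in d L N c" "d \<le> N"
  shows "Poly_Mapping.keys (strand_mon c) \<subseteq> basis_index L N"
proof -
  have *: "Poly_Mapping.keys (walk x s) \<subseteq> basis_index L N"
    if "x \<in> {1..N}" "snd (last s) \<in> {1..N}" "map fst s \<in> words L" "snd ` set (butlast s) \<subseteq> {1..N}" for x s
  proof -
    have "s \<noteq> []" "fst ` set s \<subseteq> {1..L}" using that(3) by (auto simp: words_def)
    then have "set s = insert (last s) (set (butlast s))" by (cases s rule: rev_cases) auto
    then have "insert x (snd ` set (butlast s)) \<subseteq> {1..N}" "snd ` set s \<subseteq> {1..N}" using that by auto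
    then have "insert x (snd ` set (butlast s)) \<times> snd ` set s \<times> fst ` set s \<subseteq> basis_index L N"
      unfolding basis_index_def using \<open>fst ` set s \<subseteq> {1..L}\<close> by (intro Sigma_mono)
    then show ?thesis using keys_walk by (rule order_trans[rotated])
  qed
  show ?thesis
  proof (cases c)
    case (Open x s)
    then have "x \<in> {1..N}" "snd (last s) \<in> {1..N}" "map fst s \<in> words L" "snd ` set (butlast s) \<subseteq> {1..N}"
      using assms by auto
    from *[OF this] show ?thesis by (simp only: Open strand_mon.simps)
  next
    case (Closed s)
    then have "s \<noteq> []" "snd ` set s \<subseteq> {1..N}" using assms(1) by (auto simp: words_def)
    then have "snd (last s) \<in> {1..N}" "snd ` set (butlast s) \<subseteq> {1..N}"
      by (auto simp: image_subset_iff dest: in_set_butlastD)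
    moreover have "map fst s \<in> words L" using assms(1) Closed by simp
    ultimately have "Poly_Mapping.keys (walk (snd (last s)) s) \<subseteq> basis_index L N" by (intro *)
    then show ?thesis by (simp only: Closed strand_mon.simps)
  qed
qed

lemma keys_config_mon:
  assumes "config_in d L N C" "d \<le> N"
  shows "Poly_Mapping.keys (config_mon C) \<subseteq> basis_index L N"
  using assms by (induction C) (auto simp: keys_add_nat dest: keys_strand_mon)

lemma homogeneous_gen_monomial:
  assumes "Poly_Mapping.keys T \<subseteq> gen_indices d L"
  shows "homogeneous (\<lambda>_. 1) (mon_degree gen_degree T) (gen_monomial T N)"
  unfolding homogeneous_def keys_gen_monomial[OF assms] using degree_config_mon by blast

lemma gen_poly_inv:
  assumes g: "g \<in> gen_indices d L" and d: "d \<le> N"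
  shows "gen_poly g N \<in> inv_alg d L N"
proof -
  have "gen_poly g N \<in> sym_alg L N"
    unfolding sym_alg_def polys_in_def mem_Collect_eq keys_gen_poly[OF g] using keys_strand_mon[OF _ d] by blast
  moreover have "ad_action L N (diag_emb L X) (gen_poly g N) = 0" if "X \<in> gl d N" for X
    using g by (cases rule: gen_indices_cases)
      (simp_all add: p_circ_class p_word_annihilated p_path_annihilated[OF _ _ d _ that])
  ultimately show ?thesis by (simp add: inv_alg_def)
qed

lemma gen_monomial_inv:
  assumes "Poly_Mapping.keys T \<subseteq> gen_indices d L" "d \<le> N"
  shows "gen_monomial T N \<in> inv_alg d L N"
  unfolding gen_monomial_def using assms by (intro inv_alg_prod inv_alg_power gen_poly_inv) auto

lemma gen_monomial_cong_outside:
  assumes "Poly_Mapping.keys T \<subseteq> gen_indices d L"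
  shows "cong_outside (basis_index L N) (gen_monomial T (Suc N)) (gen_monomial T N)"
  unfolding gen_monomial_def
proof (intro cong_outside_prod cong_outside_power)
  fix g assume "g \<in> Poly_Mapping.keys T"
  then have "g \<in> gen_indices d L" using assms by auto
  then show "cong_outside (basis_index L N) (gen_poly g (Suc N)) (gen_poly g N)"
    by (cases rule: gen_indices_cases)
      (auto simp: p_circ_class words_def intro: p_word_cong_outside p_path_cong_outside)
qed

lemma gen_monomial_lim:
  assumes "Poly_Mapping.keys T \<subseteq> gen_indices d L"
  shows "(\<lambda>k. gen_monomial T (d + k)) \<in> lim_comp d L (mon_degree gen_degree T)"
  unfolding lim_comp_iff add_Suc_right
  by (intro allI conjI gen_monomial_inv[OF assms] homogeneous_gen_monomial[OF assms]
      gen_monomial_cong_outside[OF assms] le_add1)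

section \<open>Balance at interior vertices and Euler decompositions\<close>

definition row_deg :: "nat \<Rightarrow> salg_mon \<Rightarrow> nat" where
  "row_deg a = mon_degree (\<lambda>(i, j, \<alpha>). of_bool (i = a))"

definition col_deg :: "nat \<Rightarrow> salg_mon \<Rightarrow> nat" where
  "col_deg a = mon_degree (\<lambda>(i, j, \<alpha>). of_bool (j = a))"

lemma row_col_deg_simps [simp]:
  "row_deg a 0 = 0" "row_deg a (m + m') = row_deg a m + row_deg a m'" "row_deg a (edge i j \<alpha>) = of_bool (i = a)"
  "col_deg a 0 = 0" "col_deg a (m + m') = col_deg a m + col_deg a m'" "col_deg a (edge i j \<alpha>) = of_bool (j = a)"
  by (simp_all add: row_deg_def col_deg_def)

lemma row_deg_pos_iff: "row_deg a m > 0 \<longleftrightarrow> (\<exists>j \<alpha>. (a, j, \<alpha>) \<in> Poly_Mapping.keys m)"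
  unfolding row_deg_def neq0_conv[symmetric] mon_degree_eq_0 by force

lemma col_deg_pos_iff: "col_deg a m > 0 \<longleftrightarrow> (\<exists>i \<alpha>. (i, a, \<alpha>) \<in> Poly_Mapping.keys m)"
  unfolding col_deg_def neq0_conv[symmetric] mon_degree_eq_0 by force

lemma col_deg_walk: "col_deg a (walk x s) = count (mset (map snd s)) a"
  by (induction x s rule: walk.induct) auto

text \<open>A walk leaves every vertex as often as it enters it, up to its two ends.\<close>

lemma row_deg_walk: "row_deg a (walk x s) + of_bool (walk_end x s = a) = col_deg a (walk x s) + of_bool (x = a)"
  by (induction x s rule: walk.induct) auto

lemma row_deg_closed:
  assumes "s \<noteq> []"
  shows "row_deg a (walk (snd (last s)) s) = count (mset (map snd s)) a"
  using row_deg_walk[of a "snd (last s)" s] assms by (simp add: walk_end_def col_deg_walk)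

lemma row_deg_open:
  assumes "s \<noteq> []"
  shows "row_deg a (walk x s) = of_bool (x = a) + count (mset (map snd (butlast s))) a"
proof -
  have "mset (map snd s) = mset (map snd (butlast s)) + {#snd (last s)#}"
    using assms by (cases s rule: rev_cases) auto
  then have "col_deg a (walk x s) = count (mset (map snd (butlast s))) a + of_bool (snd (last s) = a)"
    by (simp add: col_deg_walk del: mset_map)
  then show ?thesis
    using row_deg_walk[of a x s] assms by (simp add: walk_end_def)
qed

definition config_verts :: "strand multiset \<Rightarrow> nat multiset" where
  "config_verts C = (\<Sum>c\<in>#C. mset (strand_verts c))"

lemma config_verts_simps [simp]:
  "config_verts {#} = {#}" "config_verts (add_mset c C) = mset (strand_verts c) + config_verts C"
  "config_verts (C + D) = config_verts C + config_verts D"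
  by (simp_all add: config_verts_def)

lemma row_deg_config:
  assumes "config_in d L N C" "d < a"
  shows "row_deg a (config_mon C) = count (config_verts C) a"
  using assms
proof (induction C)
  case (add c C)
  have "row_deg a (strand_mon c) = count (mset (strand_verts c)) a"
  proof (cases c)
    case (Open x s)
    then show ?thesis using add.prems by (subst Open, simp, subst row_deg_open) (auto simp: words_def)
  next
    case (Closed s)
    then show ?thesis using add.prems by (subst Closed, simp, subst row_deg_closed) (auto simp: words_def)
  qed
  then show ?case using add by simp
qed simp

text \<open>The strands met while a monomial is being decomposed: the ends of an open strand may
  still be interior vertices, at which it can be prolonged.\<close>

fun partial_strand :: "nat \<Rightarrow> nat \<Rightarrow> nat \<Rightarrow> strand \<Rightarrow> bool" where
  "partial_strand d L N (Open x s) \<longleftrightarrow> s \<noteq> [] \<and> x \<in> {1..N} \<and> fst ` set s \<subseteq> {1..L} \<and> snd ` set s \<subseteq> {1..N}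
     \<and> snd ` set (butlast s) \<subseteq> {d<..}"
| "partial_strand d L N (Closed s) \<longleftrightarrow> s \<noteq> [] \<and> fst ` set s \<subseteq> {1..L} \<and> snd ` set s \<subseteq> {1..N}
     \<and> snd ` set s \<subseteq> {d<..}"

fun starts_at :: "nat \<Rightarrow> strand \<Rightarrow> nat" where
  "starts_at a (Open x s) = of_bool (x = a)"
| "starts_at a (Closed s) = 0"

fun ends_at :: "nat \<Rightarrow> strand \<Rightarrow> nat" where
  "ends_at a (Open x s) = of_bool (walk_end x s = a)"
| "ends_at a (Closed s) = 0"

lemma config_balance:
  assumes "\<forall>c\<in>#C. partial_strand d L N c"
  shows "row_deg a (config_mon C) + (\<Sum>c\<in>#C. ends_at a c) = col_deg a (config_mon C) + (\<Sum>c\<in>#C. starts_at a c)"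
  using assms
proof (induction C)
  case (add c C)
  have "row_deg a (strand_mon c) + ends_at a c = col_deg a (strand_mon c) + starts_at a c"
    using add.prems row_deg_walk by (cases c) (auto simp: row_deg_closed col_deg_walk)
  then show ?case using add by simp
qed simp

lemma edge_config_exists:
  assumes "Poly_Mapping.keys m \<subseteq> basis_index L N"
  shows "\<exists>C. (\<forall>c\<in>#C. partial_strand d L N c) \<and> config_mon C = m"
  using assms
proof (induction m rule: monomial_induct)
  case zero
  then show ?case by (intro exI[of _ "{#}"]) simp
next
  case (add v m)
  then obtain C where C: "\<forall>c\<in>#C. partial_strand d L N c" "config_mon C = m" by (auto simp: keys_add_nat)
  obtain i j \<alpha> where v: "v = (i, j, \<alpha>)" by (cases v)
  show ?case
    using add.prems C by (intro exI[of _ "add_mset (Open i [(\<alpha>, j)]) C"]) (auto simp: v keys_add_nat basis_index_def)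
qed

text \<open>Take a decomposition into strands with as few open strands as possible. If an open strand
  started at an interior vertex, balance would provide an open strand ending there; joining the
  two, or closing the strand up if they coincide, would leave fewer open strands.\<close>

lemma euler_decomposition:
  assumes m: "Poly_Mapping.keys m \<subseteq> basis_index L N"
    and bal: "\<And>a. d < a \<Longrightarrow> row_deg a m = col_deg a m"
  obtains C where "config_in d L N C" "config_mon C = m" "\<forall>v\<in>#config_verts C. d < v"
proof -
  define P where "P = (\<lambda>C. (\<forall>c\<in>#C. partial_strand d L N c) \<and> config_mon C = m)"
  define opens :: "strand multiset \<Rightarrow> nat"
    where "opens = (\<lambda>C. \<Sum>c\<in>#C. case c of Open x s \<Rightarrow> 1 | Closed s \<Rightarrow> 0)"
  obtain C where C: "P C" and min: "\<And>C'. P C' \<Longrightarrow> opens C \<le> opens C'"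
    using edge_config_exists[OF m] ex_has_least_nat[of P _ opens] unfolding P_def by blast
  have balC: "(\<Sum>c\<in>#C. ends_at a c) = (\<Sum>c\<in>#C. starts_at a c)" if "d < a" for a
    using config_balance[of C d L N a] bal[OF that] C by (simp add: P_def)
  have start: "x \<le> d" if mem: "Open x s \<in># C" for x s
  proof (rule ccontr)
    assume x: "\<not> x \<le> d"
    obtain D where D: "C = add_mset (Open x s) D" using multi_member_split[OF mem] by blast
    have pre: "partial_strand d L N (Open x s)" "\<forall>c\<in>#D. partial_strand d L N c" and mon: "walk x s + config_mon D = m"
      using C by (auto simp: P_def D)
    show False
    proof (cases "walk_end x s = x")
      case True
      then have e: "snd (last s) = x" using pre(1) by (simp add: walk_end_def)
      have "set s = insert (last s) (set (butlast s))" using pre(1) by (cases s rule: rev_cases) auto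
      then have "P (add_mset (Closed s) D)" using pre mon x e by (auto simp: P_def)
      from min[OF this] show False by (simp add: opens_def D)
    next
      case False
      have "(\<Sum>c\<in>#C. ends_at x c) > 0" using balC[of x] x by (simp add: D)
      then have "(\<Sum>c\<in>#D. ends_at x c) > 0" using False by (simp add: D)
      then have "\<exists>c\<in>#D. ends_at x c \<noteq> 0" by (induction D) auto
      then obtain c where c: "c \<in># D" "ends_at x c \<noteq> 0" by blast
      then obtain y t where yt: "c = Open y t" "walk_end y t = x" by (cases c) (auto split: if_splits)
      obtain D' where D': "D = add_mset (Open y t) D'" using multi_member_split[OF c(1)[unfolded yt(1)]] by blast
      have pt: "partial_strand d L N (Open y t)" "\<forall>c\<in>#D'. partial_strand d L N c" using pre(2) by (auto simp: D')
      then have "snd (last t) = x" "set t = insert (last t) (set (butlast t))"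
        using yt(2) by (simp add: walk_end_def, cases t rule: rev_cases, auto)
      then have "snd ` set t \<subseteq> {d<..}" using pt(1) x by auto
      moreover have "butlast (t @ s) = t @ butlast s" using pre(1) by (simp add: butlast_append)
      ultimately have "partial_strand d L N (Open y (t @ s))" using pre(1) pt(1) by auto
      then have "P (add_mset (Open y (t @ s)) D')"
        using pt(2) mon yt(2) by (auto simp: P_def D' add_ac)
      from min[OF this] show False by (simp add: opens_def D D')
    qed
  qed
  have stop: "walk_end x s \<le> d" if mem: "Open x s \<in># C" for x s
  proof (rule ccontr)
    assume e: "\<not> walk_end x s \<le> d"
    have "(\<Sum>c\<in>#C. starts_at (walk_end x s) c) = 0"
    proof -
      have "starts_at (walk_end x s) c = 0" if c: "c \<in># C" for c
      proof (cases c)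
        case (Open y t)
        then have "y \<le> d" using start[of y t] c by simp
        then show ?thesis using e Open by auto
      qed simp
      then show ?thesis by simp
    qed
    then have "(\<Sum>c\<in>#C. ends_at (walk_end x s) c) = 0" using balC e by simp
    then have "ends_at (walk_end x s) (Open x s) = 0" using mem by auto
    then show False by simp
  qed
  have "strand_in d L N c \<and> (\<forall>v\<in>set (strand_verts c). d < v)" if c: "c \<in># C" for c
  proof (cases c)
    case (Open x s)
    have p: "partial_strand d L N (Open x s)" using C c unfolding P_def Open by blast
    then have s: "s \<noteq> []" "x \<in> {1..N}" "fst ` set s \<subseteq> {1..L}" "snd ` set s \<subseteq> {1..N}"
      "snd ` set (butlast s) \<subseteq> {d<..}" by simp_all
    have "snd (last s) \<le> d" "x \<le> d" using start[of x s] stop[of x s] c s(1) by (simp_all add: Open walk_end_def)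
    moreover have "snd (last s) \<in> {1..N}" using s(4) last_in_set[OF s(1)] by blast
    moreover have "snd ` set (butlast s) \<subseteq> {1..N}" using s(4) in_set_butlastD[of _ s] by blast
    moreover have "map fst s \<in> words L" using s(1,3) by (simp add: words_def)
    ultimately have "strand_in d L N (Open x s)" using s(2) by simp
    then show ?thesis using s(5) by (auto simp: Open)
  next
    case (Closed s)
    have "partial_strand d L N (Closed s)" using C c unfolding P_def Closed by blast
    then show ?thesis by (auto simp: Closed words_def)
  qed
  then have "config_in d L N C" "\<forall>v\<in>#config_verts C. d < v"
    by (auto simp: config_in_def config_verts_def)
  with C show ?thesis using that by (auto simp: P_def)
qed

section \<open>Generic configurations are determined by their monomials\<close>

text \<open>Each interior vertex is visited at most once and no vertex of the configuration is \<open>\<le> d\<close>,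
  apart from the ends of the open strands.\<close>

definition generic :: "nat \<Rightarrow> strand multiset \<Rightarrow> bool" where
  "generic d C \<longleftrightarrow> (\<forall>v. count (config_verts C) v \<le> 1) \<and> (\<forall>v\<in>#config_verts C. d < v)"

lemma generic_add_mset:
  "generic d (add_mset c D) \<longleftrightarrow> distinct (strand_verts c) \<and> (\<forall>v\<in>set (strand_verts c). d < v)
     \<and> set (strand_verts c) \<inter> set_mset (config_verts D) = {} \<and> generic d D"
proof -
  have "(\<forall>v. count (mset l) v + count V v \<le> 1) \<longleftrightarrow> distinct l \<and> set l \<inter> set_mset V = {} \<and> (\<forall>v. count V v \<le> 1)"
    for l :: "nat list" and V
  proof
    assume h: "\<forall>v. count (mset l) v + count V v \<le> 1"
    have "count (mset l) v = of_bool (v \<in> set l)" for v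
    proof (cases "v \<in> set l")
      case True
      then have "0 < count (mset l) v" by (simp only: count_greater_zero_iff set_mset_mset)
      moreover have "count (mset l) v \<le> 1" using h by (meson add_leD1)
      ultimately have "count (mset l) v = 1" by linarith
      then show ?thesis using True by simp
    qed (simp add: count_mset_0_iff)
    then have "distinct l" by (simp add: distinct_count_atmost_1 of_bool_def)
    moreover have "v \<notin># V" if "v \<in> set l" for v
      using h[rule_format, of v] that by (simp add: not_in_iff \<open>\<And>v. count (mset l) v = of_bool (v \<in> set l)\<close>)
    ultimately show "distinct l \<and> set l \<inter> set_mset V = {} \<and> (\<forall>v. count V v \<le> 1)"
      using h by (auto, metis add_leD2)
  next
    assume h: "distinct l \<and> set l \<inter> set_mset V = {} \<and> (\<forall>v. count V v \<le> 1)"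
    then have "count (mset l) v = of_bool (v \<in> set l)" for v by (simp add: distinct_count_atmost_1)
    moreover have "count V v = 0" if "v \<in> set l" for v using h that by (auto simp: not_in_iff[symmetric])
    ultimately show "\<forall>v. count (mset l) v + count V v \<le> 1" using h by auto
  qed
  then show ?thesis by (auto simp: generic_def)
qed

lemma edge_in_walk:
  assumes "(x, y, \<alpha>) \<in> Poly_Mapping.keys (walk z s)"
  obtains s1 s2 where "s = s1 @ (\<alpha>, y) # s2" "walk_end z s1 = x"
proof -
  have "\<exists>s1 s2. s = s1 @ (\<alpha>, y) # s2 \<and> walk_end z s1 = x"
    using assms
  proof (induction z s rule: walk.induct)
    case (2 z \<beta> u s)
    show ?case
    proof (cases "(x, y, \<alpha>) = (z, u, \<beta>)")
      case True
      then show ?thesis by (intro exI[of _ "[]"] exI[of _ s]) simp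
    next
      case False
      then obtain s1 s2 where "s = s1 @ (\<alpha>, y) # s2" "walk_end u s1 = x"
        using 2 by (auto simp: keys_add_nat)
      then show ?thesis by (intro exI[of _ "(\<beta>, u) # s1"] exI[of _ s2]) simp
    qed
  qed simp
  then show ?thesis using that by blast
qed

lemma row_unique:
  assumes "row_deg x m \<le> 1" "(x, y, \<alpha>) \<in> Poly_Mapping.keys m" "(x, z, \<beta>) \<in> Poly_Mapping.keys m"
  shows "(\<alpha>, y) = (\<beta>, z)"
proof (rule ccontr)
  assume ne: "(\<alpha>, y) \<noteq> (\<beta>, z)"
  obtain m' where m: "m = edge x y \<alpha> + m'" by (rule monomial_split_ex[OF assms(2)])
  then have "(x, z, \<beta>) \<in> Poly_Mapping.keys m'" using assms(3) ne by (auto simp: keys_add_nat)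
  then have "row_deg x m' > 0" unfolding row_deg_pos_iff by blast
  then show False using assms(1) by (simp add: m)
qed

text \<open>Outside \<open>Z\<close> there is at most one way to continue, so two walks that stop on reaching \<open>Z\<close>
  agree once they agree at the first step.\<close>

lemma walk_unique:
  assumes "\<And>a. a \<notin> Z \<Longrightarrow> row_deg a m \<le> 1"
    and "Poly_Mapping.keys (walk x s) \<subseteq> Poly_Mapping.keys m" "Poly_Mapping.keys (walk x t) \<subseteq> Poly_Mapping.keys m"
    and "s \<noteq> []" "snd (last s) \<in> Z" "snd ` set (butlast s) \<inter> Z = {}"
    and "t \<noteq> []" "snd (last t) \<in> Z" "snd ` set (butlast t) \<inter> Z = {}"
    and "x \<notin> Z \<or> hd s = hd t"
  shows "s = t"
  using assms(2-)
proof (induction s arbitrary: x t)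
  case (Cons p s)
  obtain \<alpha> y where p: "p = (\<alpha>, y)" by (cases p)
  obtain \<beta> z t' where t: "t = (\<beta>, z) # t'" using Cons.prems(6) by (cases t) auto
  have "(x, y, \<alpha>) \<in> Poly_Mapping.keys m" "(x, z, \<beta>) \<in> Poly_Mapping.keys m"
    using Cons.prems(1,2) by (auto simp: p t keys_add_nat)
  then have eq: "(\<alpha>, y) = (\<beta>, z)"
    using Cons.prems(9) row_unique[OF assms(1)] by (auto simp: p t)
  show ?case
  proof (cases "s = []")
    case True
    then have "y \<in> Z" using Cons.prems(4) by (simp add: p)
    then have "t' = []" using Cons.prems(8) eq by (auto simp: t split: if_splits)
    then show ?thesis using True eq by (simp add: p t)
  next
    case False
    then have "y \<notin> Z" using Cons.prems(5) by (auto simp: p)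
    then have "t' \<noteq> []" using Cons.prems(7) eq by (auto simp: t)
    then have "s = t'"
      using Cons.prems False eq \<open>y \<notin> Z\<close> by (intro Cons.IH[of y]) (auto simp: p t keys_add_nat)
    then show ?thesis using eq by (simp add: p t)
  qed
qed simp

lemma keys_config_mon_Union:
  "Poly_Mapping.keys (config_mon C) = (\<Union>c\<in>set_mset C. Poly_Mapping.keys (strand_mon c))"
  by (induction C) (auto simp: keys_add_nat)

lemma map_snd_snoc: "s \<noteq> [] \<Longrightarrow> map snd s = map snd (butlast s) @ [snd (last s)]"
  by (cases s rule: rev_cases) auto

text \<open>The vertices visited on the way are interior, so an edge that leaves a vertex \<open>\<le> d\<close> can
  only be the first step of an open strand.\<close>

lemma strand_step_boundary:
  assumes "strand_in d L N c" "\<forall>v\<in>set (strand_verts c). d < v"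
    and "(x, y, \<alpha>) \<in> Poly_Mapping.keys (strand_mon c)" "x \<le> d"
  obtains t where "c = Open x ((\<alpha>, y) # t)"
proof (cases c)
  case (Open z s)
  then obtain s1 s2 where s: "s = s1 @ (\<alpha>, y) # s2" "walk_end z s1 = x" using assms(3) by (auto elim: edge_in_walk)
  have "s1 = []"
  proof (rule ccontr)
    assume "s1 \<noteq> []"
    then have "x \<in> snd ` set (butlast s)" using s by (auto simp: walk_end_def butlast_append)
    then show False using assms(2,4) Open by auto
  qed
  then show ?thesis using that s Open by simp
next
  case (Closed s)
  then obtain s1 s2 where s: "s = s1 @ (\<alpha>, y) # s2" "walk_end (snd (last s)) s1 = x"
    using assms(3) by (auto elim: edge_in_walk)
  then have "x \<in> snd ` set s" by (auto simp: walk_end_def split: if_splits)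
  then show ?thesis using assms(2,4) Closed by auto
qed

lemma walk_rotate:
  assumes "s = s1 @ s2" "s2 \<noteq> []" "walk_end (snd (last s)) s1 = x"
  shows "walk (snd (last s)) s = walk x (s2 @ s1)" "snd (last (s2 @ s1)) = x"
proof -
  have e: "walk_end x s2 = snd (last s)" using assms by (simp add: walk_end_def)
  show "walk (snd (last s)) s = walk x (s2 @ s1)" using assms e by (simp add: add.commute)
  show "snd (last (s2 @ s1)) = x" using assms by (auto simp: walk_end_def)
qed

text \<open>A component of a generic configuration is recovered from any of its edges, by following
  the unique edge that leaves each interior vertex.\<close>

lemma generic_strand_match:
  assumes C: "config_in d L N (add_mset c D)" "generic d (add_mset c D)"
    and C': "config_in d L N C'" "generic d C'"
    and eq: "config_mon (add_mset c D) = config_mon C'"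
  obtains c' where "c' \<in># C'" "strand_mon c' = strand_mon c" "strand_gen L c' = strand_gen L c"
proof -
  define m where "m = config_mon C'"
  have row: "row_deg a m \<le> 1" if "d < a" for a
    using row_deg_config[OF C'(1) that] C'(2) by (simp add: generic_def m_def)
  have sub: "Poly_Mapping.keys (strand_mon b) \<subseteq> Poly_Mapping.keys m" if "b = c \<or> b \<in># C'" for b
  proof -
    have "Poly_Mapping.keys m = Poly_Mapping.keys (config_mon (add_mset c D))" using eq by (simp only: m_def)
    then show ?thesis using that unfolding m_def keys_config_mon_Union by auto
  qed
  have in': "strand_in d L N b" "distinct (strand_verts b)" "\<forall>v\<in>set (strand_verts b). d < v" if b: "b \<in># C'" for b
  proof -
    obtain D' where "C' = add_mset b D'" using multi_member_split[OF b] by blast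
    then show "strand_in d L N b" "distinct (strand_verts b)" "\<forall>v\<in>set (strand_verts b). d < v"
      using C' by (auto simp: generic_add_mset)
  qed
  have c: "strand_in d L N c" "distinct (strand_verts c)" "\<forall>v\<in>set (strand_verts c). d < v"
    using C by (auto simp: generic_add_mset)
  show ?thesis
  proof (cases c)
    case (Open x s)
    obtain \<alpha> y s' where s: "s = (\<alpha>, y) # s'" using c(1) by (cases s) (auto simp: Open words_def)
    have "(x, y, \<alpha>) \<in> Poly_Mapping.keys (strand_mon c)" by (simp add: Open s keys_add_nat)
    with sub[of c] have "(x, y, \<alpha>) \<in> Poly_Mapping.keys m" by auto
    then obtain c' where c': "c' \<in># C'" "(x, y, \<alpha>) \<in> Poly_Mapping.keys (strand_mon c')"
      by (auto simp: m_def keys_config_mon_Union)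
    have "x \<le> d" using c(1) by (simp add: Open)
    with strand_step_boundary[OF in'(1,3)[OF c'(1)] c'(2)] obtain t where t: "c' = Open x ((\<alpha>, y) # t)" by blast
    have "s = (\<alpha>, y) # t"
    proof (rule walk_unique[where Z = "{..d}" and m = m and x = x])
      show "row_deg a m \<le> 1" if "a \<notin> {..d}" for a using row that by simp
      show "Poly_Mapping.keys (walk x s) \<subseteq> Poly_Mapping.keys m" using sub[of c] by (simp add: Open)
      show "Poly_Mapping.keys (walk x ((\<alpha>, y) # t)) \<subseteq> Poly_Mapping.keys m" using sub[of c'] c'(1) by (simp add: t)
      show "snd (last s) \<in> {..d}" using c(1) by (simp add: Open)
      show "snd (last ((\<alpha>, y) # t)) \<in> {..d}" using in'(1)[OF c'(1)] by (simp add: t)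
      show "snd ` set (butlast s) \<inter> {..d} = {}" using c(3) by (force simp: Open)
      show "snd ` set (butlast ((\<alpha>, y) # t)) \<inter> {..d} = {}" using in'(3)[OF c'(1)] by (force simp: t)
    qed (simp_all add: s)
    then show ?thesis using that c'(1) Open t by simp
  next
    case (Closed s)
    obtain \<alpha> y s' where s: "s = (\<alpha>, y) # s'" using c(1) by (cases s) (auto simp: Closed words_def)
    define x where "x = snd (last s)"
    have x: "d < x" using c(3) by (auto simp: Closed x_def s)
    have ds: "distinct (map snd (butlast s) @ [x])"
    proof -
      have "map snd s = map snd (butlast s) @ [x]" unfolding x_def by (rule map_snd_snoc) (simp add: s)
      then show ?thesis using c(2) by (simp add: Closed)
    qed
    have "(x, y, \<alpha>) \<in> Poly_Mapping.keys (strand_mon c)" by (simp add: Closed s x_def keys_add_nat)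
    with sub[of c] have "(x, y, \<alpha>) \<in> Poly_Mapping.keys m" by auto
    then obtain c' where c': "c' \<in># C'" "(x, y, \<alpha>) \<in> Poly_Mapping.keys (strand_mon c')"
      by (auto simp: m_def keys_config_mon_Union)
    have walk_s: "Poly_Mapping.keys (walk x s) \<subseteq> Poly_Mapping.keys m" using sub[of c] by (simp add: Closed x_def)
    let ?Z = "insert x {..d}"
    have disj: "A \<inter> ?Z = {}" if "x \<notin> A" "\<forall>v\<in>A. d < v" for A using that by fastforce
    have uniq: "s = u" if "Poly_Mapping.keys (walk x u) \<subseteq> Poly_Mapping.keys m" "u \<noteq> []" "snd (last u) \<in> ?Z"
      "snd ` set (butlast u) \<inter> ?Z = {}" "hd u = (\<alpha>, y)" for u
    proof (rule walk_unique[where Z = ?Z and m = m and x = x])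
      show "row_deg a m \<le> 1" if "a \<notin> ?Z" for a using row that by simp
      have "x \<notin> snd ` set (butlast s)" using ds by simp
      moreover have "\<forall>v\<in>snd ` set (butlast s). d < v" using c(3) in_set_butlastD[of _ s] by (auto simp: Closed)
      ultimately show "snd ` set (butlast s) \<inter> ?Z = {}" by (rule disj)
    qed (use that walk_s in \<open>simp_all add: s x_def[symmetric] x_def\<close>)
    show ?thesis
    proof (cases c')
      case (Open z t)
      then obtain t1 t2 where t: "t = t1 @ (\<alpha>, y) # t2" "walk_end z t1 = x" using c'(2) by (auto elim: edge_in_walk)
      have z: "z \<le> d" "snd (last t) \<le> d" using in'(1)[OF c'(1)] by (auto simp: Open)
      then have t1: "t1 \<noteq> []" "snd (last t1) = x" using t(2) x by (auto simp: walk_end_def split: if_splits)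
      define u where "u = (\<alpha>, y) # t2"
      have tu: "t = t1 @ u" "u \<noteq> []" "hd u = (\<alpha>, y)" by (simp_all add: t(1) u_def)
      have bt: "map snd (butlast t) = map snd t1 @ map snd (butlast u)" using tu(2) by (simp add: tu(1) butlast_append)
      then have dis: "distinct (map snd t1 @ map snd (butlast u))" using in'(2)[OF c'(1)] by (simp add: Open)
      have "x \<in> set (map snd t1)" using t1 by (metis last_in_set last_map map_is_Nil_conv)
      then have "x \<notin> snd ` set (butlast u)" using dis by auto
      moreover have "\<forall>v\<in>set (map snd (butlast t)). d < v" using in'(3)[OF c'(1)] by (simp add: Open)
      then have "\<forall>v\<in>snd ` set (butlast u). d < v" unfolding bt by simp
      ultimately have "snd ` set (butlast u) \<inter> ?Z = {}" by (rule disj)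
      moreover have "Poly_Mapping.keys (walk x u) \<subseteq> Poly_Mapping.keys m"
        using sub[of c'] c'(1) t(2) by (simp add: Open tu(1) keys_add_nat)
      moreover have e: "snd (last u) \<le> d" using z(2) tu by simp
      ultimately have "s = u" using tu(2,3) by (intro uniq) simp_all
      then have "x \<le> d" using e by (simp add: x_def)
      then show ?thesis using x by simp
    next
      case (Closed t)
      then obtain t1 t2 where t: "t = t1 @ (\<alpha>, y) # t2" "walk_end (snd (last t)) t1 = x"
        using c'(2) by (auto elim: edge_in_walk)
      define u where "u = ((\<alpha>, y) # t2) @ t1"
      have u: "walk (snd (last t)) t = walk x u" "snd (last u) = x"
        unfolding u_def by (rule walk_rotate[OF t(1) _ t(2)]; simp)+
      have rot: "u = rotate (length t1) t" unfolding u_def t(1) by (rule rotate_append[symmetric])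
      have "map snd u = map snd (butlast u) @ [x]"
        unfolding u(2)[symmetric] by (rule map_snd_snoc) (simp add: u_def)
      moreover have "distinct (map snd u)" "\<forall>v\<in>set (map snd u). d < v"
        using in'(2,3)[OF c'(1)] by (simp_all add: Closed rot rotate_map[symmetric])
      ultimately have "snd ` set (butlast u) \<inter> ?Z = {}" by (intro disj) simp_all
      then have su: "s = u"
        using sub[of c'] c'(1) u by (intro uniq) (auto simp: Closed u_def)
      have "strand_mon c = walk x s" by (simp only: \<open>c = strand.Closed s\<close> strand_mon.simps x_def)
      moreover have "strand_mon c' = walk x u" by (simp only: Closed strand_mon.simps u(1))
      ultimately have "strand_mon c' = strand_mon c" by (simp only: su)
      moreover have "strand_gen L c' = strand_gen L c"
      proof -
        have w: "map fst t \<in> words L" using in'(1)[OF c'(1)] by (simp add: Closed)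
        have r: "map fst s = rotate (length t1) (map fst t)" unfolding su rot by (rule rotate_map[symmetric])
        then have "rotation_rel L `` {map fst t} = rotation_rel L `` {map fst s}"
          using w words_rotate[OF w] by (subst rotation_class_eq_iff) auto
        then show ?thesis by (simp only: Closed \<open>c = strand.Closed s\<close> strand_gen.simps)
      qed
      ultimately show ?thesis using that c'(1) by blast
    qed
  qed
qed

text \<open>How often an interior vertex is visited can be read off from the monomial.\<close>

lemma generic_mon_cong:
  assumes "config_in d L N C" "generic d C" "config_in d L N C'" "\<forall>v\<in>#config_verts C'. d < v"
    and "config_mon C = config_mon C'"
  shows "generic d C'"
proof -
  have "count (config_verts C') v \<le> 1" for v
  proof (cases "d < v")
    case True
    then show ?thesis using assms row_deg_config[OF assms(1) True] row_deg_config[OF assms(3) True]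
      by (simp add: generic_def)
  next
    case False
    then have "v \<notin># config_verts C'" using assms(4) by auto
    then show ?thesis by (simp add: not_in_iff)
  qed
  then show ?thesis using assms(4) by (simp add: generic_def)
qed

text \<open>Matching strands are removed one by one; what remains is generic again.\<close>

lemma config_type_unique:
  assumes "config_in d L N C" "generic d C" "config_in d L N C'" "generic d C'"
    and "config_mon C = config_mon C'"
  shows "config_type L C = config_type L C'"
  using assms
proof (induction C arbitrary: C')
  case empty
  have "False" if "c \<in># C'" for c
  proof -
    have "Poly_Mapping.keys (strand_mon c) = {}" using empty.prems(5) that keys_config_mon_Union[of C'] by auto
    then have "mon_degree (\<lambda>_. 1) (strand_mon c) = 0" by simp
    moreover have "strand_in d L N c" using empty.prems(3) that by (auto simp: config_in_def)
    ultimately show False by (cases c) (simp_all add: words_def degree_walk)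
  qed
  then have "C' = {#}" by (metis multiset_nonemptyE)
  then show ?case by simp
next
  case (add c D)
  obtain c' where c': "c' \<in># C'" "strand_mon c' = strand_mon c" "strand_gen L c' = strand_gen L c"
    using generic_strand_match[OF add.prems] by blast
  obtain D' where D': "C' = add_mset c' D'" using multi_member_split[OF c'(1)] by blast
  have "config_mon D = config_mon D'" using add.prems(5) c'(2) by (simp add: D')
  then have "config_type L D = config_type L D'"
    using add.prems by (intro add.IH) (auto simp: D' generic_add_mset)
  then show ?case using c'(3) by (simp add: D')
qed

text \<open>The number of summation indices of a generator.\<close>

fun gen_verts :: "gen_index \<Rightarrow> nat" where
  "gen_verts (Circ c) = circ_length c"
| "gen_verts (Path i j w) = length w - 1"

lemma size_config_verts:
  assumes "config_in d L N C"
  shows "size (config_verts C) = mon_degree gen_verts (config_type L C)"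
proof -
  have "length (strand_verts c) = gen_verts (strand_gen L c)" if "strand_in d L N c" for c
    using that by (cases c) (auto simp: circ_length_class)
  then show ?thesis using assms by (induction C) auto
qed

text \<open>Triangularity: letting a summation index of a generator take a value \<open>\<le> d\<close> only loses
  interior vertices.\<close>

lemma config_type_triangular:
  assumes C: "config_in d L N C" "generic d C" and C': "config_in d L N C'"
    and eq: "config_mon C = config_mon C'"
  shows "config_type L C = config_type L C' \<or>
    mon_degree gen_verts (config_type L C) < mon_degree gen_verts (config_type L C')"
proof -
  \<comment> \<open>both sides count the edges that leave an interior vertex\<close>
  have V: "config_verts C = filter_mset (\<lambda>v. d < v) (config_verts C')"
  proof (rule multiset_eqI)
    fix v
    show "count (config_verts C) v = count (filter_mset (\<lambda>v. d < v) (config_verts C')) v"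
    proof (cases "d < v")
      case True
      then show ?thesis using row_deg_config[OF C(1) True] row_deg_config[OF C' True] eq by simp
    next
      case False
      then have "v \<notin># config_verts C" using C(2) by (auto simp: generic_def)
      then show ?thesis using False by (simp add: not_in_iff)
    qed
  qed
  show ?thesis
  proof (cases "\<forall>v\<in>#config_verts C'. d < v")
    case True
    then show ?thesis using config_type_unique[OF C C' generic_mon_cong[OF C C' True eq] eq] by simp
  next
    case False
    then have "config_verts C \<subset># config_verts C'" unfolding V
      by (simp add: subset_mset.less_le filter_mset_eq_conv) 
    then have "size (config_verts C) < size (config_verts C')" by (rule mset_subset_size)
    then show ?thesis using size_config_verts[OF C(1)] size_config_verts[OF C'] by simp
  qed
qed

text \<open>The labels \<open>a\<close> become the vertices of the strand; a path needs one label less than its word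
  has letters, and the last one is dropped.\<close>

lemma gen_strand_exists:
  assumes g: "g \<in> gen_indices d L" and a: "distinct a" "length a = gen_degree g" "set a \<subseteq> {d<..N}"
  obtains c where "strand_in d L N c" "strand_gen L c = g" "distinct (strand_verts c)" "set (strand_verts c) \<subseteq> set a"
  using g
proof (cases rule: gen_indices_cases)
  case (circ w)
  then have l: "length a = length w" using a(2) by (simp add: circ_length_class)
  let ?c = "Closed (zip w a)"
  have "strand_in d L N ?c" using circ l a(3) by (auto simp: map_fst_zip words_def dest: set_zip_rightD)
  moreover have "strand_gen L ?c = g" using circ l by simp
  moreover have "strand_verts ?c = a" using l by simp
  ultimately show ?thesis using that[of ?c] a(1) by simp
next
  case (path i j w)
  define b where "b = take (length w - 1) a"
  have l: "length w = length (b @ [j])" using a(2) path by (simp add: b_def words_def Suc_le_eq)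
  let ?c = "Open i (zip w (b @ [j]))"
  have ne: "zip w (b @ [j]) \<noteq> []" using l by (cases w) auto
  have s: "map snd (zip w (b @ [j])) = b @ [j]" using l by simp
  have j: "snd (last (zip w (b @ [j]))) = j" using s ne by (metis last_map last_snoc)
  have v: "strand_verts ?c = b" using s by (simp add: map_butlast del: zip_append2)
  have b: "distinct b" "set b \<subseteq> set a" using a(1) by (auto simp: b_def dest: in_set_takeD)
  have "snd ` set (butlast (zip w (b @ [j]))) = set b" using v by (metis strand_verts.simps(1) set_map)
  moreover have "set b \<subseteq> {1..N}" using a(3) b(2) by force
  moreover have "map fst (zip w (b @ [j])) = w" using l by simp
  ultimately have "strand_in d L N ?c" using path j by simp
  moreover have "strand_gen L ?c = g" using path l j by simp
  moreover have "distinct (strand_verts ?c)" "set (strand_verts ?c) \<subseteq> set a"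
    unfolding v by (rule b)+
  ultimately show ?thesis by (rule that)
qed

lemma generic_config_exists:
  assumes "Poly_Mapping.keys T \<subseteq> gen_indices d L" "distinct a" "mon_degree gen_degree T \<le> length a" "set a \<subseteq> {d<..N}"
  shows "\<exists>C. config_in d L N C \<and> config_type L C = T \<and> generic d C \<and> set_mset (config_verts C) \<subseteq> set a"
  using assms
proof (induction T arbitrary: a rule: monomial_induct)
  case zero
  show ?case by (intro exI[of _ "{#}"]) (simp add: generic_def)
next
  case (add g T)
  define a1 a2 where "a1 = take (gen_degree g) a" and "a2 = drop (gen_degree g) a"
  have "a = a1 @ a2" by (simp add: a1_def a2_def)
  then have a: "set a = set a1 \<union> set a2" "distinct a1" "distinct a2" "set a1 \<inter> set a2 = {}" using add.prems(2) by auto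
  have "length a1 = gen_degree g" "mon_degree gen_degree T \<le> length a2"
    using add.prems(3) by (auto simp: a1_def a2_def)
  moreover have g: "g \<in> gen_indices d L" "Poly_Mapping.keys T \<subseteq> gen_indices d L"
    using add.prems(1) by (auto simp: keys_add_nat)
  ultimately obtain c C where "strand_in d L N c" "strand_gen L c = g" "distinct (strand_verts c)"
      "set (strand_verts c) \<subseteq> set a1" "config_in d L N C" "config_type L C = T" "generic d C"
      "set_mset (config_verts C) \<subseteq> set a2"
    using gen_strand_exists[OF g(1) a(2), of N] add.IH[of a2] add.prems(4) a by (metis Un_subset_iff)
  moreover from this have "generic d (add_mset c C)"
  proof -
    assume *: "distinct (strand_verts c)" "set (strand_verts c) \<subseteq> set a1" "generic d C"
      "set_mset (config_verts C) \<subseteq> set a2"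
    have "set (strand_verts c) \<inter> set_mset (config_verts C) = {}" using * a(4) by blast
    moreover have "set (strand_verts c) \<subseteq> {d<..N}" using * a(1) add.prems(4) by blast
    ultimately show ?thesis unfolding generic_add_mset using * by auto
  qed
  ultimately show ?case using a by (intro exI[of _ "add_mset c C"]) auto
qed

section \<open>The linear relations between the coefficients of an invariant\<close>

lemma lookup_cvar_mult_add:
  "Poly_Mapping.lookup (cvar v * g) (Poly_Mapping.single v 1 + m) = Poly_Mapping.lookup g m"
proof -
  have "cvar v * g = (\<Sum>b\<in>Poly_Mapping.keys g. Poly_Mapping.single (Poly_Mapping.single v 1 + b) (Poly_Mapping.lookup g b))"
    unfolding mult_eq_double_sum cvar_def by simp
  then have "Poly_Mapping.lookup (cvar v * g) (Poly_Mapping.single v 1 + m)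
    = (\<Sum>b\<in>Poly_Mapping.keys g. if b = m then Poly_Mapping.lookup g b else 0)"
    by (simp add: lookup_sum lookup_single when_def)
  then show ?thesis by (simp add: in_keys_iff)
qed

lemma lookup_cvar_mult_notin:
  assumes "v \<notin> Poly_Mapping.keys m"
  shows "Poly_Mapping.lookup (cvar v * g) m = 0"
proof (rule ccontr)
  assume "Poly_Mapping.lookup (cvar v * g) m \<noteq> 0"
  then have "m \<in> Poly_Mapping.keys (cvar v * g)" by (simp add: in_keys_iff)
  then obtain b where "m = Poly_Mapping.single v 1 + b"
    using keys_mult[of "cvar v" g] by (auto simp: cvar_def)
  then show False using assms by (simp add: keys_add_nat)
qed

lemma lookup_cvar_partial_add:
  "Poly_Mapping.lookup (cvar v * partial u f) (Poly_Mapping.single v 1 + m)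
     = of_nat (Poly_Mapping.lookup m u + 1) * Poly_Mapping.lookup f (m + Poly_Mapping.single u 1)"
  by (simp only: lookup_cvar_mult_add lookup_partial)

text \<open>The coefficient at \<open>m\<close> of the derivative of \<open>f\<close> along the matrix unit with row \<open>b\<close> and column
  \<open>a\<close>. Its action replaces a row index \<open>a\<close> by \<open>b\<close> (left) and, with a minus sign, a column index \<open>b\<close>
  by \<open>a\<close> (right).\<close>

lemma inv_relation:
  assumes f: "f \<in> inv_alg d L N" and a: "a \<in> {d<..N}" and b: "b \<in> {d<..N}"
  shows "(\<Sum>(j, \<alpha>)\<in>{1..N} \<times> {1..L}. Poly_Mapping.lookup (cvar (b, j, \<alpha>) * partial (a, j, \<alpha>) f) m)
    = (\<Sum>(i, \<alpha>)\<in>{1..N} \<times> {1..L}. Poly_Mapping.lookup (cvar (i, a, \<alpha>) * partial (i, b, \<alpha>) f) m)"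
proof -
  define X :: cmat where "X = (\<lambda>k l. if k = b \<and> l = a then 1 else 0)"
  have ab: "a \<in> {1..N}" "b \<in> {1..N}" using a b by auto
  have "X \<in> gl d N" using a b by (auto simp: X_def gl_def)
  then have "0 = ad_action L N (diag_emb L X) f" using f by (simp add: inv_alg_def)
  also have "\<dots> = (\<Sum>(i, j, \<alpha>)\<in>basis_index L N.
      (if i = a then E b j \<alpha> * partial (i, j, \<alpha>) f else 0) - (if j = b then E i a \<alpha> * partial (i, j, \<alpha>) f else 0))"
    unfolding ad_action_def
  proof (rule sum.cong[OF refl], clarify)
    fix i j \<alpha> assume v: "(i, j, \<alpha>) \<in> basis_index L N"
    have "(\<Sum>k=1..N. cconst (X k i) * E k j \<alpha>) = (\<Sum>k=1..N. if k = b then (if i = a then E b j \<alpha> else 0) else 0)"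
      by (rule sum.cong[OF refl]) (auto simp: X_def)
    also have "\<dots> = (if i = a then E b j \<alpha> else 0)" using ab(2) by (simp only: sum.delta finite_atLeastAtMost if_True)
    finally have 1: "(\<Sum>k=1..N. cconst (X k i) * E k j \<alpha>) = (if i = a then E b j \<alpha> else 0)" .
    have "(\<Sum>k=1..N. cconst (X j k) * E i k \<alpha>) = (\<Sum>k=1..N. if k = a then (if j = b then E i a \<alpha> else 0) else 0)"
      by (rule sum.cong[OF refl]) (auto simp: X_def)
    also have "\<dots> = (if j = b then E i a \<alpha> else 0)" using ab(1) by (simp only: sum.delta finite_atLeastAtMost if_True)
    finally have 2: "(\<Sum>k=1..N. cconst (X j k) * E i k \<alpha>) = (if j = b then E i a \<alpha> else 0)" .
    show "lin_emb L N (\<lambda>\<beta>. commutator N (diag_emb L X \<beta>) (matrix_unit i j \<alpha> \<beta>)) * partial (i, j, \<alpha>) f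
      = (if i = a then E b j \<alpha> * partial (i, j, \<alpha>) f else 0) - (if j = b then E i a \<alpha> * partial (i, j, \<alpha>) f else 0)"
      unfolding lin_emb_commutator[OF v] 1 2 by (simp add: left_diff_distrib)
  qed
  also have "\<dots> = (\<Sum>i\<in>{1..N}. \<Sum>j\<in>{1..N}. \<Sum>\<alpha>\<in>{1..L}. if i = a then E b j \<alpha> * partial (i, j, \<alpha>) f else 0)
       - (\<Sum>i\<in>{1..N}. \<Sum>j\<in>{1..N}. \<Sum>\<alpha>\<in>{1..L}. if j = b then E i a \<alpha> * partial (i, j, \<alpha>) f else 0)"
    by (simp add: basis_index_def sum.cartesian_product case_prod_beta sum_subtractf)
  also have "(\<Sum>i\<in>{1..N}. \<Sum>j\<in>{1..N}. \<Sum>\<alpha>\<in>{1..L}. if i = a then E b j \<alpha> * partial (i, j, \<alpha>) f else 0)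
      = (\<Sum>i\<in>{1..N}. if i = a then \<Sum>j\<in>{1..N}. \<Sum>\<alpha>\<in>{1..L}. E b j \<alpha> * partial (a, j, \<alpha>) f else 0)"
    by (rule sum.cong[OF refl]) simp
  also have "\<dots> = (\<Sum>j\<in>{1..N}. \<Sum>\<alpha>\<in>{1..L}. E b j \<alpha> * partial (a, j, \<alpha>) f)"
    using ab(1) by (simp only: sum.delta finite_atLeastAtMost if_True)
  also have "(\<Sum>i\<in>{1..N}. \<Sum>j\<in>{1..N}. \<Sum>\<alpha>\<in>{1..L}. if j = b then E i a \<alpha> * partial (i, j, \<alpha>) f else 0)
      = (\<Sum>i\<in>{1..N}. \<Sum>j\<in>{1..N}. if j = b then \<Sum>\<alpha>\<in>{1..L}. E i a \<alpha> * partial (i, b, \<alpha>) f else 0)"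
    by (intro sum.cong refl) simp
  also have "\<dots> = (\<Sum>i\<in>{1..N}. \<Sum>\<alpha>\<in>{1..L}. E i a \<alpha> * partial (i, b, \<alpha>) f)"
    using ab(2) by (simp only: sum.delta finite_atLeastAtMost if_True)
  finally have "(\<Sum>j\<in>{1..N}. \<Sum>\<alpha>\<in>{1..L}. E b j \<alpha> * partial (a, j, \<alpha>) f)
      = (\<Sum>i\<in>{1..N}. \<Sum>\<alpha>\<in>{1..L}. E i a \<alpha> * partial (i, b, \<alpha>) f)" by simp
  from arg_cong[OF this, of "\<lambda>p. Poly_Mapping.lookup p m"]
  show ?thesis by (simp add: lookup_sum sum.cartesian_product case_prod_beta E_def)
qed

lemma sum_single_term:
  assumes "finite A" "p \<in> A" "\<And>q. q \<in> A \<Longrightarrow> q \<noteq> p \<Longrightarrow> h q = 0"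
  shows "sum h A = h p"
  using assms by (simp add: sum.remove)

lemma inv_keys: "f \<in> inv_alg d L N \<Longrightarrow> Poly_Mapping.lookup f m \<noteq> 0 \<Longrightarrow> Poly_Mapping.keys m \<subseteq> basis_index L N"
  by (auto simp: inv_alg_def sym_alg_def polys_in_iff)

lemma row_deg_eq_sum:
  assumes "Poly_Mapping.keys m \<subseteq> basis_index L N" "a \<in> {1..N}"
  shows "row_deg a m = (\<Sum>(j, \<alpha>)\<in>{1..N} \<times> {1..L}. Poly_Mapping.lookup m (a, j, \<alpha>))"
proof -
  have "finite (basis_index L N)" by (simp add: basis_index_def)
  then have "row_deg a m = (\<Sum>(i, j, \<alpha>)\<in>basis_index L N. of_bool (i = a) * Poly_Mapping.lookup m (i, j, \<alpha>))"
    unfolding row_deg_def using assms(1) by (simp add: mon_degree_sum case_prod_beta)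
  also have "\<dots> = (\<Sum>i\<in>{1..N}. if i = a then \<Sum>(j, \<alpha>)\<in>{1..N} \<times> {1..L}. Poly_Mapping.lookup m (a, j, \<alpha>) else 0)"
    unfolding basis_index_def sum.cartesian_product[symmetric] by (intro sum.cong refl) simp
  finally show ?thesis using assms(2) by (simp only: sum.delta finite_atLeastAtMost if_True)
qed

lemma col_deg_eq_sum:
  assumes "Poly_Mapping.keys m \<subseteq> basis_index L N" "a \<in> {1..N}"
  shows "col_deg a m = (\<Sum>(i, \<alpha>)\<in>{1..N} \<times> {1..L}. Poly_Mapping.lookup m (i, a, \<alpha>))"
proof -
  have "finite (basis_index L N)" by (simp add: basis_index_def)
  then have "col_deg a m = (\<Sum>(i, j, \<alpha>)\<in>basis_index L N. of_bool (j = a) * Poly_Mapping.lookup m (i, j, \<alpha>))"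
    unfolding col_deg_def using assms(1) by (simp add: mon_degree_sum case_prod_beta)
  also have "\<dots> = (\<Sum>i\<in>{1..N}. \<Sum>j\<in>{1..N}. if j = a then \<Sum>\<alpha>\<in>{1..L}. Poly_Mapping.lookup m (i, a, \<alpha>) else 0)"
    unfolding basis_index_def sum.cartesian_product[symmetric] by (intro sum.cong refl) simp
  also have "\<dots> = (\<Sum>i\<in>{1..N}. \<Sum>\<alpha>\<in>{1..L}. Poly_Mapping.lookup m (i, a, \<alpha>))"
    using assms(2) by (simp only: sum.delta finite_atLeastAtMost if_True)
  finally show ?thesis by (simp add: sum.cartesian_product)
qed

text \<open>For \<open>a = b\<close> the two sides of the relation are the multiples of the coefficient at \<open>m\<close> by the
  row degree and by the column degree: this is the weight condition for the torus.\<close>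

lemma inv_balanced:
  assumes f: "f \<in> inv_alg d L N" and m: "Poly_Mapping.lookup f m \<noteq> 0" and a: "d < a"
  shows "row_deg a m = col_deg a m"
proof (cases "a \<le> N")
  case True
  note k = inv_keys[OF f m]
  have *: "Poly_Mapping.lookup (cvar v * partial v f) m = of_nat (Poly_Mapping.lookup m v) * Poly_Mapping.lookup f m" for v
    using m by (simp add: cvar_partial lookup_sum_single in_keys_iff)
  have "of_nat (row_deg a m) * Poly_Mapping.lookup f m = of_nat (col_deg a m) * Poly_Mapping.lookup f m"
    using inv_relation[OF f, of a a m] True a row_deg_eq_sum[OF k, of a] col_deg_eq_sum[OF k, of a]
    by (simp add: * sum_distrib_right case_prod_beta)
  then show ?thesis using m by simp
next
  case False
  have "\<not> row_deg a m > 0" "\<not> col_deg a m > 0"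
    unfolding row_deg_pos_iff col_deg_pos_iff using inv_keys[OF f m] False by (auto simp: basis_index_def)
  then show ?thesis by simp
qed

text \<open>In the relation at \<open>edge b j \<alpha> + m\<close> only one edge leaves the fresh vertex \<open>b\<close>, so the left side is
  a multiple of the coefficient at \<open>edge a j \<alpha> + m\<close>. On the right side an edge that enters \<open>a\<close> is
  redirected to \<open>b\<close>.\<close>

lemma inv_split_vertex:
  assumes f: "f \<in> inv_alg d L N" and a: "a \<in> {d<..N}" and b: "b \<in> {d<..N}"
    and j: "j \<in> {1..N}" "\<alpha> \<in> {1..L}" and fresh: "row_deg b m = 0"
    and zero: "\<And>i \<beta> m'. edge b j \<alpha> + m = edge i a \<beta> + m' \<Longrightarrow> Poly_Mapping.lookup f (m' + edge i b \<beta>) = 0"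
  shows "Poly_Mapping.lookup f (edge a j \<alpha> + m) = 0"
proof -
  let ?M = "edge b j \<alpha> + m"
  have "(\<Sum>(k, \<beta>)\<in>{1..N} \<times> {1..L}. Poly_Mapping.lookup (cvar (b, k, \<beta>) * partial (a, k, \<beta>) f) ?M)
      = Poly_Mapping.lookup (cvar (b, j, \<alpha>) * partial (a, j, \<alpha>) f) ?M"
  proof (subst sum_single_term[where p = "(j, \<alpha>)"], goal_cases)
    case (3 q)
    obtain k \<beta> where q: "q = (k, \<beta>)" by (cases q)
    have "(b, k, \<beta>) \<notin> Poly_Mapping.keys m" using fresh row_deg_pos_iff[of b m] by auto
    then have "(b, k, \<beta>) \<notin> Poly_Mapping.keys ?M" using 3 q by (auto simp: keys_add_nat)
    then show ?case by (simp add: q lookup_cvar_mult_notin)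
  qed (use j in auto)
  moreover have "(\<Sum>(i, \<beta>)\<in>{1..N} \<times> {1..L}. Poly_Mapping.lookup (cvar (i, a, \<beta>) * partial (i, b, \<beta>) f) ?M) = 0"
  proof (intro sum.neutral ballI, clarify)
    fix i \<beta>
    show "Poly_Mapping.lookup (cvar (i, a, \<beta>) * partial (i, b, \<beta>) f) ?M = 0"
    proof (cases "(i, a, \<beta>) \<in> Poly_Mapping.keys ?M")
      case True
      then obtain m' where m': "?M = edge i a \<beta> + m'" by (rule monomial_split_ex)
      show ?thesis unfolding m' lookup_cvar_partial_add zero[OF m'] by simp
    qed (simp add: lookup_cvar_mult_notin)
  qed
  \<comment> \<open>the factor is a nonzero multiplicity\<close>
  ultimately have "of_nat (Poly_Mapping.lookup m (a, j, \<alpha>) + 1) * Poly_Mapping.lookup f (m + edge a j \<alpha>) = 0"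
    using inv_relation[OF f a b, of ?M] by (simp only: lookup_cvar_partial_add)
  then have "Poly_Mapping.lookup f (m + edge a j \<alpha>) = 0"
    by (metis of_nat_eq_0_iff mult_eq_0_iff add_is_0 one_neq_zero)
  then show ?thesis by (simp add: add.commute)
qed

definition avoids :: "nat set \<Rightarrow> salg_mon \<Rightarrow> bool" where
  "avoids V m \<longleftrightarrow> (\<forall>v\<in>V. row_deg v m = 0 \<and> col_deg v m = 0)"

lemma avoids_simps [simp]:
  "avoids V (m + m') \<longleftrightarrow> avoids V m \<and> avoids V m'" "avoids V 0"
  "avoids V (edge i j \<alpha>) \<longleftrightarrow> i \<notin> V \<and> j \<notin> V"
  by (auto simp: avoids_def)

lemma avoids_walk: "x \<notin> V \<Longrightarrow> snd ` set s \<inter> V = {} \<Longrightarrow> avoids V (walk x s)"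
  by (induction x s rule: walk.induct) auto

lemma avoids_subset: "avoids V m \<Longrightarrow> W \<subseteq> V \<Longrightarrow> avoids W m"
  by (auto simp: avoids_def)

lemma avoids_lookup: "avoids V m \<Longrightarrow> i \<in> V \<or> j \<in> V \<Longrightarrow> Poly_Mapping.lookup m (i, j, \<alpha>) = 0"
  using row_deg_pos_iff[of i m] col_deg_pos_iff[of j m] by (auto simp: avoids_def in_keys_iff)

text \<open>The monomial \<open>m\<close> is halfway through renaming \<open>y\<close> to \<open>y'\<close>: the edge that leaves \<open>y\<close> has been moved,
  the edge that enters it has not. Each side of the relation at \<open>m\<close> has a single term, with
  multiplicity one: undoing the first move, or completing the second.\<close>

lemma inv_relation_rename:
  assumes f: "f \<in> inv_alg d L N" and y: "y \<in> {d<..N}" and y': "y' \<in> {d<..N}"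
    and m: "m = edge y' z \<beta> + mz" "m = edge x y \<alpha> + mx"
    and in': "z \<in> {1..N}" "\<beta> \<in> {1..L}" "x \<in> {1..N}" "\<alpha> \<in> {1..L}"
    and row: "row_deg y' mz = 0" and col: "col_deg y mx = 0"
    and z0: "Poly_Mapping.lookup mz (y, z, \<beta>) = 0" and x0: "Poly_Mapping.lookup mx (x, y', \<alpha>) = 0"
  shows "Poly_Mapping.lookup f (mz + edge y z \<beta>) = Poly_Mapping.lookup f (mx + edge x y' \<alpha>)"
proof -
  have "(\<Sum>(k, \<gamma>)\<in>{1..N} \<times> {1..L}. Poly_Mapping.lookup (cvar (y', k, \<gamma>) * partial (y, k, \<gamma>) f) m)
      = Poly_Mapping.lookup (cvar (y', z, \<beta>) * partial (y, z, \<beta>) f) m"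
  proof (subst sum_single_term[where p = "(z, \<beta>)"], goal_cases)
    case (3 q)
    obtain k \<gamma> where q: "q = (k, \<gamma>)" by (cases q)
    have "(y', k, \<gamma>) \<notin> Poly_Mapping.keys mz" using row row_deg_pos_iff[of y' mz] by auto
    then have "(y', k, \<gamma>) \<notin> Poly_Mapping.keys m" using 3 q by (auto simp: m(1) keys_add_nat)
    then show ?case by (simp add: q lookup_cvar_mult_notin)
  qed (use in' in auto)
  also have "\<dots> = Poly_Mapping.lookup f (mz + edge y z \<beta>)"
    unfolding m(1) lookup_cvar_partial_add z0 by simp
  finally have l: "(\<Sum>(k, \<gamma>)\<in>{1..N} \<times> {1..L}. Poly_Mapping.lookup (cvar (y', k, \<gamma>) * partial (y, k, \<gamma>) f) m)
      = Poly_Mapping.lookup f (mz + edge y z \<beta>)" .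
  have "(\<Sum>(k, \<gamma>)\<in>{1..N} \<times> {1..L}. Poly_Mapping.lookup (cvar (k, y, \<gamma>) * partial (k, y', \<gamma>) f) m)
      = Poly_Mapping.lookup (cvar (x, y, \<alpha>) * partial (x, y', \<alpha>) f) m"
  proof (subst sum_single_term[where p = "(x, \<alpha>)"], goal_cases)
    case (3 q)
    obtain k \<gamma> where q: "q = (k, \<gamma>)" by (cases q)
    have "(k, y, \<gamma>) \<notin> Poly_Mapping.keys mx" using col col_deg_pos_iff[of y mx] by auto
    then have "(k, y, \<gamma>) \<notin> Poly_Mapping.keys m" using 3 q by (auto simp: m(2) keys_add_nat)
    then show ?case by (simp add: q lookup_cvar_mult_notin)
  qed (use in' in auto)
  also have "\<dots> = Poly_Mapping.lookup f (mx + edge x y' \<alpha>)"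
    unfolding m(2) lookup_cvar_partial_add x0 by simp
  finally show ?thesis using l inv_relation[OF f y y', of m] by simp
qed

lemma inv_rename_loop:
  assumes f: "f \<in> inv_alg d L N" and y: "y \<in> {d<..N}" and y': "y' \<in> {d<..N}" and "y \<noteq> y'"
    and \<alpha>: "\<alpha> \<in> {1..L}" and m: "avoids {y, y'} m"
  shows "Poly_Mapping.lookup f (m + edge y y \<alpha>) = Poly_Mapping.lookup f (m + edge y' y' \<alpha>)"
proof (rule inv_relation_rename[OF f y y'])
  show "edge y' y \<alpha> + m = edge y' y \<alpha> + m" "edge y' y \<alpha> + m = edge y' y \<alpha> + m" by simp_all
qed (use assms avoids_lookup[OF m] in \<open>auto simp: avoids_def\<close>)

lemma inv_rename_vertex:
  assumes f: "f \<in> inv_alg d L N" and y: "y \<in> {d<..N}" and y': "y' \<in> {d<..N}" and "y \<noteq> y'"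
    and xz: "x \<in> {1..N}" "\<alpha> \<in> {1..L}" "z \<in> {1..N}" "\<beta> \<in> {1..L}" "x \<notin> {y, y'}" "z \<notin> {y, y'}"
    and m: "avoids {y, y'} m"
  shows "Poly_Mapping.lookup f (m + edge x y \<alpha> + edge y z \<beta>) = Poly_Mapping.lookup f (m + edge x y' \<alpha> + edge y' z \<beta>)"
proof -
  have "Poly_Mapping.lookup f ((m + edge x y \<alpha>) + edge y z \<beta>) = Poly_Mapping.lookup f ((m + edge y' z \<beta>) + edge x y' \<alpha>)"
  proof (rule inv_relation_rename[OF f y y'])
    show "edge y' z \<beta> + (m + edge x y \<alpha>) = edge y' z \<beta> + (m + edge x y \<alpha>)" by simp
    show "edge y' z \<beta> + (m + edge x y \<alpha>) = edge x y \<alpha> + (m + edge y' z \<beta>)" by (simp add: add_ac)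
    show "Poly_Mapping.lookup (m + edge x y \<alpha>) (y, z, \<beta>) = 0"
      using avoids_lookup[OF m, of y z \<beta>] xz by (auto simp: lookup_add lookup_single when_def)
    show "Poly_Mapping.lookup (m + edge y' z \<beta>) (x, y', \<alpha>) = 0"
      using avoids_lookup[OF m, of x y' \<alpha>] xz by (auto simp: lookup_add lookup_single when_def)
  qed (use assms in \<open>auto simp: avoids_def\<close>)
  then show ?thesis by (simp add: add_ac)
qed

section \<open>Coefficients of an invariant at generic configurations\<close>

text \<open>The vertices are renamed one at a time from the start of the walk. An edge that has been
  dealt with joins \<open>m\<close>, and the walk continues from its renamed end; the ends \<open>x\<close> and \<open>e\<close> stay.\<close>

lemma inv_rename_walk:
  assumes f: "f \<in> inv_alg d L N"
    and st: "map fst s = map fst t" "s \<noteq> []" "walk_end x s = e" "walk_end x t = e" "fst ` set s \<subseteq> {1..L}"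
    and ends: "x \<in> {1..N}" "e \<in> {1..N}" "x \<notin> V \<union> W" "e \<notin> V \<union> W"
    and V: "distinct (map snd (butlast s))" "snd ` set (butlast s) \<subseteq> V"
    and W: "distinct (map snd (butlast t))" "snd ` set (butlast t) \<subseteq> W"
    and VW: "V \<inter> W = {}" "V \<union> W \<subseteq> {d<..N}" and m: "avoids (V \<union> W) m"
  shows "Poly_Mapping.lookup f (m + walk x s) = Poly_Mapping.lookup f (m + walk x t)"
  using st ends V W VW m
proof (induction s arbitrary: x t V W m)
  case (Cons p s)
  obtain \<alpha> y where p: "p = (\<alpha>, y)" by (cases p)
  obtain y' t' where t: "t = (\<alpha>, y') # t'" and t': "map fst s = map fst t'"
    using Cons.prems(1) p by (cases t) auto
  show ?case
  proof (cases s)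
    case Nil
    then show ?thesis using Cons.prems(3,4) t' by (simp add: p t)
  next
    case (Cons q s')
    obtain \<beta> z where q: "q = (\<beta>, z)" by (cases q)
    have t'0: "t' \<noteq> []" using t' Cons by auto
    note prems = Cons.prems
    have yV: "y \<in> V" and y'W: "y' \<in> W" using prems(11,13) Cons t'0 by (auto simp: p t)
    have neq: "y \<noteq> y'" "y \<noteq> x" "y' \<noteq> x" "y \<noteq> e" "y' \<noteq> e" using yV y'W prems(8,9,14) by auto
    have s_end: "walk_end y s = e" using prems(3) by (simp add: p)
    have ds: "y \<notin> snd ` set (butlast s)" "distinct (map snd (butlast s))" "snd ` set (butlast s) \<subseteq> V"
      using prems(10,11) Cons by (auto simp: p)
    have dt: "y' \<notin> snd ` set (butlast t')" "distinct (map snd (butlast t'))" "snd ` set (butlast t') \<subseteq> W"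
      using prems(12,13) t'0 by (auto simp: t)
    have sset: "snd ` set s = insert e (snd ` set (butlast s))"
      using arg_cong[OF map_snd_snoc[of s], of set] s_end Cons by (simp add: walk_end_def)
    have avs: "snd ` set s \<inter> {y, y'} = {}"
      unfolding sset using ds(1,3) y'W prems(14) neq by auto
    then have zy: "z \<notin> {y, y'}" and avz: "snd ` set s' \<inter> {y, y'} = {}" by (auto simp: Cons q)
    have VN: "V \<subseteq> {d<..N}" "W \<subseteq> {d<..N}" using prems(15) by blast+
    have "z \<in> insert e (snd ` set (butlast s))" unfolding sset[symmetric] by (simp add: Cons q)
    then have "z = e \<or> z \<in> V" using ds(3) by blast
    then have z: "z \<in> {1..N}" using prems(7) subsetD[OF VN(1), of z] by auto
    have y: "y \<in> {d<..N}" and y': "y' \<in> {d<..N}" using yV y'W VN by blast+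
    have ab: "\<alpha> \<in> {1..L}" "\<beta> \<in> {1..L}" using prems(5) by (simp_all add: p q Cons)
    have "Poly_Mapping.lookup f (m + walk x (p # s))
        = Poly_Mapping.lookup f ((m + walk z s') + edge x y \<alpha> + edge y z \<beta>)"
      by (simp add: p Cons q add_ac)
    also have "\<dots> = Poly_Mapping.lookup f ((m + walk z s') + edge x y' \<alpha> + edge y' z \<beta>)"
    proof (rule inv_rename_vertex[OF f y y' neq(1) prems(6) ab(1) z ab(2) _ zy])
      show "x \<notin> {y, y'}" using neq by simp
      show "avoids {y, y'} (m + walk z s')"
        using avoids_subset[OF prems(16), of "{y, y'}"] yV y'W avoids_walk[OF zy avz] by simp
    qed
    also have "\<dots> = Poly_Mapping.lookup f ((m + edge x y' \<alpha>) + walk y' s)"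
      by (simp add: Cons q add_ac)
    also have "\<dots> = Poly_Mapping.lookup f ((m + edge x y' \<alpha>) + walk y' t')"
    proof (rule Cons.IH[where V = "snd ` set (butlast s)" and W = "snd ` set (butlast t')"])
      show "walk_end y' s = e" "walk_end y' t' = e" using prems(3,4) Cons by (auto simp: p q t)
      show "fst ` set s \<subseteq> {1..L}" using prems(5) by simp
      show "y' \<in> {1..N}" using y' by simp
      show "y' \<notin> snd ` set (butlast s) \<union> snd ` set (butlast t')" using dt(1) ds(3) y'W prems(14) by auto
      show "e \<notin> snd ` set (butlast s) \<union> snd ` set (butlast t')" using ds(3) dt(3) prems(9) by auto
      have sub: "snd ` set (butlast s) \<union> snd ` set (butlast t') \<subseteq> V \<union> W" using ds(3) dt(3) by auto
      then show "snd ` set (butlast s) \<union> snd ` set (butlast t') \<subseteq> {d<..N}" using prems(15) by blast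
      show "snd ` set (butlast s) \<inter> snd ` set (butlast t') = {}" using ds(3) dt(3) prems(14) by blast
      show "avoids (snd ` set (butlast s) \<union> snd ` set (butlast t')) (m + edge x y' \<alpha>)"
      proof -
        have "x \<notin> snd ` set (butlast s) \<union> snd ` set (butlast t')" using sub prems(8) by blast
        moreover have "y' \<notin> snd ` set (butlast s) \<union> snd ` set (butlast t')" using dt(1) ds(3) y'W prems(14) by blast
        ultimately show ?thesis unfolding avoids_simps using avoids_subset[OF prems(16) sub] by blast
      qed
      show "s \<noteq> []" by (simp add: Cons)
    qed (rule t' prems(7) ds(2) dt(2) order_refl)+
    also have "(m + edge x y' \<alpha>) + walk y' t' = m + walk x t" by (simp add: t add_ac)
    finally show ?thesis .
  qed
qed simp

text \<open>Cut the closed walk at a vertex \<open>x\<close> and treat it as a walk from \<open>x\<close> to \<open>x\<close> to rename the other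
  vertices; then rename \<open>x\<close> itself.\<close>

lemma inv_rename_closed:
  assumes f: "f \<in> inv_alg d L N" and st: "map fst s = map fst t" "s \<noteq> []" "fst ` set s \<subseteq> {1..L}"
    and V: "distinct (map snd s)" and W: "distinct (map snd t)"
    and VW: "snd ` set s \<inter> snd ` set t = {}" "snd ` set s \<union> snd ` set t \<subseteq> {d<..N}"
    and m: "avoids (snd ` set s \<union> snd ` set t) m"
  shows "Poly_Mapping.lookup f (m + strand_mon (Closed s)) = Poly_Mapping.lookup f (m + strand_mon (Closed t))"
proof -
  obtain s' \<beta> x where s: "s = s' @ [(\<beta>, x)]" using st(2) by (cases s rule: rev_cases) auto
  obtain t' x' where t: "t = t' @ [(\<beta>, x')]" and st': "map fst s' = map fst t'"
    using st(1) s by (cases t rule: rev_cases) auto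
  have x: "x \<in> {d<..N}" "x' \<in> {d<..N}" "x \<noteq> x'" "\<beta> \<in> {1..L}"
    using VW st(3) by (auto simp: s t)
  have mx: "avoids {x, x'} m" using avoids_subset[OF m] by (simp add: s t)
  show ?thesis
  proof (cases t')
    case Nil
    then show ?thesis using st' inv_rename_loop[OF f x mx] by (simp add: s t)
  next
    case (Cons q t'')
    obtain \<alpha> y where q: "q = (\<alpha>, y)" by (cases q)
    define z where "z = walk_end y t''"
    have z: "z \<in> snd ` set t'" by (auto simp: Cons q z_def walk_end_def)
    have t'_sub: "snd ` set t' \<subseteq> {d<..N}" "x \<notin> snd ` set t'" "x' \<notin> snd ` set t'"
      using VW W by (auto simp: s t)
    have "Poly_Mapping.lookup f (m + strand_mon (Closed s)) = Poly_Mapping.lookup f (m + walk x s)" by (simp add: s)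
    also have "\<dots> = Poly_Mapping.lookup f (m + walk x (t' @ [(\<beta>, x)]))"
    proof (rule inv_rename_walk[OF f, where V = "snd ` set s'" and W = "snd ` set t'" and e = x])
      show "map fst s = map fst (t' @ [(\<beta>, x)])" using st' by (simp add: s)
      show "avoids (snd ` set s' \<union> snd ` set t') m" by (rule avoids_subset[OF m]) (auto simp: s t)
      show "snd ` set s' \<inter> snd ` set t' = {}" using VW(1) by (auto simp: s t)
    qed (use st x V W VW(2) t'_sub in \<open>auto simp: s t\<close>)
    also have "m + walk x (t' @ [(\<beta>, x)]) = (m + walk y t'') + edge z x \<beta> + edge x y \<alpha>"
      by (simp add: Cons q z_def add_ac)
    also have "Poly_Mapping.lookup f \<dots> = Poly_Mapping.lookup f ((m + walk y t'') + edge z x' \<beta> + edge x' y \<alpha>)"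
    proof (rule inv_rename_vertex[OF f x(1-3)])
      have y: "y \<notin> {x, x'}" using t'_sub by (auto simp: Cons q)
      show "y \<notin> {x, x'}" by (rule y)
      have "snd ` set t'' \<inter> {x, x'} = {}" using t'_sub by (auto simp: Cons)
      then show "avoids {x, x'} (m + walk y t'')" using mx avoids_walk[OF y] by simp
      show "z \<notin> {x, x'}" "z \<in> {1..N}" using z t'_sub by auto
      show "y \<in> {1..N}" using t'_sub(1) by (auto simp: Cons q)
      have "\<alpha> \<in> fst ` set t'" by (simp add: Cons q)
      also have "fst ` set t' = fst ` set s'" using arg_cong[OF st', of set] by simp
      finally show "\<alpha> \<in> {1..L}" using st(3) by (auto simp: s)
    qed (rule x(4))
    also have "(m + walk y t'') + edge z x' \<beta> + edge x' y \<alpha> = m + strand_mon (Closed t)"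
      by (simp add: t Cons q z_def add_ac)
    finally show ?thesis .
  qed
qed

lemma strand_mon_rotate: "strand_mon (Closed (rotate k s)) = strand_mon (Closed s)"
proof (cases "s = []")
  case False
  define n where "n = k mod length s"
  have n: "drop n s \<noteq> []" "s = take n s @ drop n s" using False by (simp_all add: n_def not_le)
  have r: "rotate k s = drop n s @ take n s" by (simp add: n_def rotate_drop_take)
  note w = walk_rotate[OF n(2,1) refl]
  show ?thesis unfolding strand_mon.simps r w(2) by (rule w(1)[symmetric])
qed simp

text \<open>Closed strands with the same generator spell the same word only up to rotation, which does
  not change the monomial.\<close>

lemma inv_rename_strand:
  assumes f: "f \<in> inv_alg d L N" and d: "d \<le> N"
    and b: "strand_in d L N b" "distinct (strand_verts b)" and c: "strand_in d L N c" "distinct (strand_verts c)"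
    and gen: "strand_gen L b = strand_gen L c"
    and disj: "set (strand_verts b) \<inter> set (strand_verts c) = {}"
      "set (strand_verts b) \<union> set (strand_verts c) \<subseteq> {d<..N}"
    and m: "avoids (set (strand_verts b) \<union> set (strand_verts c)) m"
  shows "Poly_Mapping.lookup f (m + strand_mon b) = Poly_Mapping.lookup f (m + strand_mon c)"
proof (cases b)
  case (Open x s)
  then obtain t where t: "c = Open x t" "map fst s = map fst t" "snd (last s) = snd (last t)"
    using gen by (cases c) auto
  have s: "s \<noteq> []" "t \<noteq> []" "fst ` set s \<subseteq> {1..L}" "x \<in> {1..d}" "snd (last s) \<in> {1..d}"
    using b(1) c(1) by (auto simp: Open t(1) words_def)
  let ?V = "snd ` set (butlast s)" and ?W = "snd ` set (butlast t)"
  have VW: "?V \<inter> ?W = {}" "?V \<union> ?W \<subseteq> {d<..N}" using disj by (simp_all add: Open t(1))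
  have nd: "a \<notin> ?V \<union> ?W" if "a \<in> {1..d}" for a
  proof
    assume "a \<in> ?V \<union> ?W"
    then have "a \<in> {d<..N}" using VW(2) by blast
    then show False using that by simp
  qed
  have "Poly_Mapping.lookup f (m + walk x s) = Poly_Mapping.lookup f (m + walk x t)"
  proof (rule inv_rename_walk[OF f t(2) s(1)])
    show "walk_end x s = snd (last s)" "walk_end x t = snd (last s)" using s t(3) by (simp_all add: walk_end_def)
    show "x \<notin> ?V \<union> ?W" "snd (last s) \<notin> ?V \<union> ?W" using nd s(4,5) by blast+
    show "avoids (?V \<union> ?W) m" using m by (simp add: Open t(1))
    show "x \<in> {1..N}" "snd (last s) \<in> {1..N}" using s(4,5) d by auto
    show "distinct (map snd (butlast s))" "distinct (map snd (butlast t))" using b(2) c(2) by (simp_all add: Open t(1))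
  qed (use VW s(3) in auto)
  then show ?thesis by (simp add: Open t(1))
next
  case (Closed s)
  then obtain t where t: "c = Closed t" "rotation_rel L `` {map fst s} = rotation_rel L `` {map fst t}"
    using gen by (cases c) auto
  have w: "map fst s \<in> words L" "map fst t \<in> words L" using b(1) c(1) by (simp_all add: Closed t(1))
  then obtain k where k: "map fst t = rotate k (map fst s)" using t(2) by (auto simp: rotation_class_eq_iff)
  have "Poly_Mapping.lookup f (m + strand_mon (Closed (rotate k s))) = Poly_Mapping.lookup f (m + strand_mon (Closed t))"
  proof (rule inv_rename_closed[OF f])
    show "map fst (rotate k s) = map fst t" by (simp add: k rotate_map)
    show "rotate k s \<noteq> []" using w by (auto simp: words_def)
    show "fst ` set (rotate k s) \<subseteq> {1..L}" using w by (auto simp: words_def)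
    show "distinct (map snd (rotate k s))" "distinct (map snd t)"
      using b(2) c(2) by (simp_all add: Closed t(1) rotate_map[symmetric])
  qed (use disj m in \<open>simp_all add: Closed t(1)\<close>)
  then show ?thesis unfolding Closed t(1) strand_mon_rotate .
qed

lemma col_deg_config:
  assumes "config_in d L N C" "d < a"
  shows "col_deg a (config_mon C) = count (config_verts C) a"
  using assms
proof (induction C)
  case (add c C)
  have "col_deg a (strand_mon c) = count (mset (strand_verts c)) a"
  proof (cases c)
    case (Open x s)
    then have s: "s \<noteq> []" "snd (last s) \<noteq> a" using add.prems by (auto simp: words_def)
    show ?thesis unfolding Open strand_mon.simps strand_verts.simps col_deg_walk map_snd_snoc[OF s(1)]
      using s(2) by simp
  qed (simp add: col_deg_walk)
  then show ?case using add by simp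
qed simp

lemma avoids_config:
  assumes "config_in d L N C" "V \<subseteq> {d<..}" "V \<inter> set_mset (config_verts C) = {}"
  shows "avoids V (config_mon C)"
proof -
  have "count (config_verts C) v = 0" "d < v" if "v \<in> V" for v
    using assms(2,3) that by (auto simp: not_in_iff[symmetric])
  then show ?thesis using row_deg_config[OF assms(1)] col_deg_config[OF assms(1)] by (simp add: avoids_def)
qed

lemma config_verts_le: "config_in d L N C \<Longrightarrow> v \<in># config_verts C \<Longrightarrow> v \<le> N"
proof (induction C)
  case (add c C)
  have "v \<le> N" if "v \<in> set (strand_verts c)"
    using that add.prems(1) by (cases c) auto
  then show ?case using add by auto
qed simp

text \<open>The strands of \<open>C\<close> are replaced by those of \<open>D\<close> one at a time; \<open>B\<close> collects the strands already
  replaced.\<close>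

lemma inv_rename_config_disjoint:
  assumes f: "f \<in> inv_alg d L N" and d: "d \<le> N"
    and "config_in d L N (B + C)" "config_in d L N (B + D)" "generic d (B + C)" "generic d (B + D)"
    and "set_mset (config_verts C) \<inter> set_mset (config_verts D) = {}" "config_type L C = config_type L D"
  shows "Poly_Mapping.lookup f (config_mon (B + C)) = Poly_Mapping.lookup f (config_mon (B + D))"
  using assms(3-)
proof (induction C arbitrary: B D)
  case empty
  have "mon_degree (\<lambda>_. 1) (config_type L D) = size D" by (induction D) auto
  then have "D = {#}" using empty.prems(6) by (simp flip: size_eq_0_iff_empty)
  then show ?case by simp
next
  case (add b C)
  obtain c D' where D: "D = add_mset c D'" "strand_gen L c = strand_gen L b" "config_type L D' = config_type L C"
    using add.prems(6) config_type_split[of L D "strand_gen L b" "config_type L C"] by (metis config_simps(5))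
  have ge: "generic d (add_mset b (B + C))" "generic d (add_mset c (B + D'))"
    using add.prems(3,4) by (simp_all add: D)
  then have b: "distinct (strand_verts b)" "set (strand_verts b) \<subseteq> {d<..}"
      "set (strand_verts b) \<inter> set_mset (config_verts (B + C)) = {}" "generic d (B + C)"
    and c: "distinct (strand_verts c)" "set (strand_verts c) \<subseteq> {d<..}"
      "set (strand_verts c) \<inter> set_mset (config_verts (B + D')) = {}" "generic d (B + D')"
    by (auto simp: generic_add_mset)
  have bc: "set (strand_verts b) \<inter> set (strand_verts c) = {}"
    and bD: "set (strand_verts b) \<inter> set_mset (config_verts D') = {}"
    and cC: "set (strand_verts c) \<inter> set_mset (config_verts C) = {}"
    and CD: "set_mset (config_verts C) \<inter> set_mset (config_verts D') = {}"
    using add.prems(5) by (auto simp: D)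
  have in': "strand_in d L N b" "strand_in d L N c" "config_in d L N (B + C)" "config_in d L N (B + D')"
    using add.prems(1,2) by (simp_all add: D)
  have le: "set (strand_verts b) \<union> set (strand_verts c) \<subseteq> {d<..N}"
    using b(2) c(2) config_verts_le[OF add.prems(1)] config_verts_le[OF add.prems(2)] by (auto simp: D)
  have "set (strand_verts c) \<inter> set_mset (config_verts (B + C)) = {}"
    using c(3) cC by auto
  then have "avoids (set (strand_verts b) \<union> set (strand_verts c)) (config_mon (B + C))"
    using b(2,3) c(2) by (intro avoids_config[OF in'(3)]) auto
  from inv_rename_strand[OF f d in'(1) b(1) in'(2) c(1) D(2)[symmetric] bc le this]
  have "Poly_Mapping.lookup f (config_mon (B + add_mset b C)) = Poly_Mapping.lookup f (config_mon (add_mset c B + C))"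
    by (simp add: add_ac)
  also have "\<dots> = Poly_Mapping.lookup f (config_mon (add_mset c B + D'))"
  proof (rule add.IH)
    show "generic d (add_mset c B + C)"
      using b(4) c \<open>set (strand_verts c) \<inter> set_mset (config_verts (B + C)) = {}\<close>
      by (auto simp: generic_add_mset)
    show "generic d (add_mset c B + D')" using ge(2) by simp
  qed (use in' CD D(3) in auto)
  finally show ?case by (simp add: D(1))
qed

lemma distinct_list_of_card:
  assumes "finite A" "n \<le> card A"
  obtains xs where "distinct xs" "length xs = n" "set xs \<subseteq> A"
proof -
  obtain B where "B \<subseteq> A" "card B = n" "finite B" using assms by (metis obtain_subset_with_card_n)
  then show ?thesis using that finite_distinct_list[of B] by (metis distinct_card)
qed

lemma keys_config_type:
  "config_in d L N C \<Longrightarrow> Poly_Mapping.keys (config_type L C) \<subseteq> gen_indices d L"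
proof (induction C)
  case (add c C)
  have "strand_gen L c \<in> gen_indices d L"
    using add.prems by (cases c) (auto simp: gen_indices_def circular_words_def intro: quotientI)
  then show ?case using add by (auto simp: keys_add_nat)
qed simp

lemma gen_verts_le_degree:
  assumes "Poly_Mapping.keys T \<subseteq> gen_indices d L"
  shows "mon_degree gen_verts T \<le> mon_degree gen_degree T"
proof -
  have "gen_verts g \<le> gen_degree g" for g by (cases g) auto
  then show ?thesis unfolding mon_degree_def by (intro sum_mono mult_le_mono1)
qed

text \<open>The vertices of both configurations are moved to labels that neither of them uses. Each of the
  three sets of labels has at most as many elements as the degree, whence the bound on \<open>N\<close>.\<close>

lemma inv_coeff_type:
  assumes f: "f \<in> inv_alg d L N" and N: "d + 3 * mon_degree gen_degree T \<le> N"
    and C: "config_in d L N C" "generic d C" "config_type L C = T"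
    and D: "config_in d L N D" "generic d D" "config_type L D = T"
  shows "Poly_Mapping.lookup f (config_mon C) = Poly_Mapping.lookup f (config_mon D)"
proof -
  let ?n = "mon_degree gen_degree T"
  let ?F = "{d<..N} - (set_mset (config_verts C) \<union> set_mset (config_verts D))"
  have T: "Poly_Mapping.keys T \<subseteq> gen_indices d L" using keys_config_type[OF C(1)] C(3) by simp
  have "size (config_verts C) \<le> ?n" "size (config_verts D) \<le> ?n"
    using size_config_verts[OF C(1)] size_config_verts[OF D(1)] gen_verts_le_degree[OF T] C(3) D(3) by simp_all
  moreover have "card (set_mset M) \<le> size M" for M :: "nat multiset" by (induction M) (auto simp: card_insert_if)
  ultimately have "card (set_mset (config_verts C) \<union> set_mset (config_verts D)) \<le> 2 * ?n"
    by (smt (verit, best) card_Un_le le_trans add_mono mult_2)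
  moreover have "card {d<..N} - card (set_mset (config_verts C) \<union> set_mset (config_verts D)) \<le> card ?F"
    by (rule diff_card_le_card_Diff) simp
  ultimately have "?n \<le> card ?F" using N by simp
  moreover have "finite ?F" by simp
  ultimately obtain a where a: "distinct a" "length a = ?n" "set a \<subseteq> ?F" using distinct_list_of_card by metis
  then obtain B where B: "config_in d L N B" "config_type L B = T" "generic d B" "set_mset (config_verts B) \<subseteq> set a"
    using generic_config_exists[OF T a(1), of N] by auto
  have dN: "d \<le> N" using N by simp
  have "Poly_Mapping.lookup f (config_mon ({#} + C)) = Poly_Mapping.lookup f (config_mon ({#} + B))"
    using a(3) B C by (intro inv_rename_config_disjoint[OF f dN]) auto
  moreover have "Poly_Mapping.lookup f (config_mon ({#} + D)) = Poly_Mapping.lookup f (config_mon ({#} + B))"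
    using a(3) B D by (intro inv_rename_config_disjoint[OF f dN]) auto
  ultimately show ?thesis by simp
qed

lemma card_keys_le_degree: "card (Poly_Mapping.keys m) \<le> mon_degree (\<lambda>_. 1) m"
proof -
  have "(\<Sum>x\<in>Poly_Mapping.keys m. 1) \<le> mon_degree (\<lambda>_. 1) m"
    unfolding mon_degree_def by (rule sum_mono) (simp add: in_keys_iff Suc_le_eq One_nat_def)
  then show ?thesis by simp
qed

text \<open>Descending induction on the number of interior vertices, which the degree bounds: either every
  interior vertex is visited at most once and the Euler decomposition is generic, or the relation
  for a fresh vertex \<open>b\<close> expresses the coefficient by those of monomials that visit one more vertex.\<close>

lemma inv_zero_of_generic:
  assumes f: "f \<in> inv_alg d L N" and hom: "homogeneous (\<lambda>_. 1) n f" and N: "d + n < N"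
    and gen: "\<And>C. config_in d L N C \<Longrightarrow> generic d C \<Longrightarrow> Poly_Mapping.lookup f (config_mon C) = 0"
  shows "f = 0"
proof -
  define R :: "salg_mon \<Rightarrow> nat set" where "R m = {a. d < a \<and> row_deg a m > 0}" for m
  have R_sub: "R m \<subseteq> fst ` Poly_Mapping.keys m" for m
    unfolding R_def row_deg_pos_iff by force
  have deg: "mon_degree (\<lambda>_. 1) m = n" if "Poly_Mapping.lookup f m \<noteq> 0" for m
    using hom that by (simp add: homogeneous_iff)
  have card_fst: "card (fst ` Poly_Mapping.keys m) \<le> n" if "Poly_Mapping.lookup f m \<noteq> 0" for m
    using card_keys_le_degree[of m] deg[OF that] card_image_le[of "Poly_Mapping.keys m" fst] by simp
  have card_R: "card (R m) \<le> n" if "Poly_Mapping.lookup f m \<noteq> 0" for m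
    using card_mono[OF _ R_sub[of m]] card_fst[OF that] by simp
  have fin_R: "finite (R m)" for m using R_sub by (rule finite_subset) simp
  have "Poly_Mapping.lookup f m = 0" for m
  proof (induction m rule: measure_induct_rule[where f = "\<lambda>m. n - card (R m)"])
    case (less m)
    show ?case
    proof (rule ccontr)
      assume nz: "Poly_Mapping.lookup f m \<noteq> 0"
      note k = inv_keys[OF f nz]
      show False
      proof (cases "\<forall>a>d. row_deg a m \<le> 1")
        case True
        obtain C where C: "config_in d L N C" "config_mon C = m" "\<forall>v\<in>#config_verts C. d < v"
          by (rule euler_decomposition[OF k inv_balanced[OF f nz]])
        have "count (config_verts C) v \<le> 1" for v
        proof (cases "d < v")
          case v: True
          then show ?thesis using row_deg_config[OF C(1) v] C(2) True by metis
        next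
          case False
          then have "v \<notin># config_verts C" using C(3) by auto
          then show ?thesis by (simp add: not_in_iff)
        qed
        then have "generic d C" using C(3) by (simp add: generic_def)
        then show False using gen[OF C(1)] nz C(2) by simp
      next
        case False
        then obtain a where a: "d < a" "row_deg a m > 1" by (auto simp: not_le)
        then obtain j \<alpha> where e: "(a, j, \<alpha>) \<in> Poly_Mapping.keys m"
          using row_deg_pos_iff[of a m] by (metis less_trans zero_less_one)
        then have r: "a \<in> {d<..N}" "j \<in> {1..N}" "\<alpha> \<in> {1..L}" using k a(1) by (auto simp: basis_index_def)
        obtain m0 where m: "m = edge a j \<alpha> + m0" by (rule monomial_split_ex[OF e])
        have "card (fst ` Poly_Mapping.keys m) < card {d<..N}" using card_fst[OF nz] N by simp
        then have "\<not> {d<..N} \<subseteq> fst ` Poly_Mapping.keys m" using card_mono[of "fst ` Poly_Mapping.keys m" "{d<..N}"] by auto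
        then obtain b where b: "b \<in> {d<..N}" "b \<notin> fst ` Poly_Mapping.keys m" by blast
        then have "\<not> row_deg b m > 0" unfolding row_deg_pos_iff by force
        then have bm: "row_deg b m = 0" "row_deg b m0 = 0" by (simp_all add: m)
        have "Poly_Mapping.lookup f (edge a j \<alpha> + m0) = 0"
        proof (rule inv_split_vertex[OF f r(1) b(1) r(2,3) bm(2)])
          fix i \<beta> m' assume eq: "edge b j \<alpha> + m0 = edge i a \<beta> + m'"
          let ?m = "m' + edge i b \<beta>"
          have row: "row_deg x ?m = of_bool (b = x) + row_deg x m0" for x
            using arg_cong[OF eq, of "row_deg x"] by simp
          have "R m \<subset> R ?m"
          proof
            show "R m \<subseteq> R ?m"
            proof
              fix x assume "x \<in> R m"
              then show "x \<in> R ?m" unfolding R_def mem_Collect_eq row using a by (auto simp: m split: if_splits)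
            qed
            have "b \<in> R ?m" "b \<notin> R m" unfolding R_def mem_Collect_eq row using b(1) bm(1) by simp_all
            then show "R m \<noteq> R ?m" by auto
          qed
          then have c: "card (R m) < card (R ?m)" by (rule psubset_card_mono[OF fin_R])
          \<comment> \<open>a nonzero coefficient forces degree n, which bounds the number of interior vertices of this monomial too\<close>
          show "Poly_Mapping.lookup f ?m = 0"
          proof (rule ccontr)
            assume nz': "Poly_Mapping.lookup f ?m \<noteq> 0"
            then have "n - card (R ?m) < n - card (R m)" using c card_R[OF nz'] by simp
            from less[OF this] nz' show False by simp
          qed
        qed
        then show False using nz m by simp
      qed
    qed
  qed
  then show ?thesis by (intro poly_mapping_eqI) simp
qed

lemma inv_zero_of_types:
  assumes f: "f \<in> inv_alg d L N" and hom: "homogeneous (\<lambda>_. 1) n f" and N: "d + 3 * n < N"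
    and rep: "\<And>T. Poly_Mapping.keys T \<subseteq> gen_indices d L \<Longrightarrow> mon_degree gen_degree T = n \<Longrightarrow>
      \<exists>C. config_in d L N C \<and> generic d C \<and> config_type L C = T \<and> Poly_Mapping.lookup f (config_mon C) = 0"
  shows "f = 0"
proof (rule inv_zero_of_generic[OF f hom])
  show "d + n < N" using N by simp
  fix C assume C: "config_in d L N C" "generic d C"
  show "Poly_Mapping.lookup f (config_mon C) = 0"
  proof (rule ccontr)
    assume nz: "Poly_Mapping.lookup f (config_mon C) \<noteq> 0"
    then have n: "mon_degree gen_degree (config_type L C) = n"
      using hom degree_config_mon[OF C(1)] by (simp add: homogeneous_iff)
    obtain D where D: "config_in d L N D" "generic d D" "config_type L D = config_type L C"
        "Poly_Mapping.lookup f (config_mon D) = 0"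
      using rep[OF keys_config_type[OF C(1)] n] by blast
    have "Poly_Mapping.lookup f (config_mon C) = Poly_Mapping.lookup f (config_mon D)"
      by (rule inv_coeff_type[OF f _ C refl D(1,2,3)]) (use N n in simp)
    then show False using nz D(4) by simp
  qed
qed

section \<open>The homogeneous components of the limit\<close>

lemma homogeneous_add: "homogeneous w n f \<Longrightarrow> homogeneous w n g \<Longrightarrow> homogeneous w n (f + g)"
  unfolding homogeneous_iff lookup_add by (metis add_0)

lemma lim_comp_add:
  assumes "F \<in> lim_comp d L n" "G \<in> lim_comp d L n"
  shows "F + G \<in> lim_comp d L n"
  using assms unfolding lim_comp_iff
  by (simp add: inv_alg_add cong_outside_add homogeneous_add)

lemma lim_comp_cconst_mult:
  assumes "F \<in> lim_comp d L n"
  shows "(\<lambda>k. cconst c * F k) \<in> lim_comp d L n"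
  using assms unfolding lim_comp_iff
  by (auto intro!: inv_alg_mult inv_alg_cconst cong_outside_mult simp: homogeneous_iff)

lemma lim_comp_zero: "0 \<in> lim_comp d L n"
  unfolding lim_comp_iff by (simp add: inv_alg_zero homogeneous_def)

lemma lim_comp_sum: "(\<And>a. a \<in> A \<Longrightarrow> F a \<in> lim_comp d L n) \<Longrightarrow> (\<Sum>a\<in>A. F a) \<in> lim_comp d L n"
  by (induction A rule: infinite_finite_induct) (simp_all add: lim_comp_zero lim_comp_add)

text \<open>The coefficient at a monomial is the same at all levels where the monomial makes sense.\<close>

lemma lim_comp_lookup:
  assumes F: "F \<in> lim_comp d L n" and m: "Poly_Mapping.keys m \<subseteq> basis_index L (d + k)" and "k \<le> k'"
  shows "Poly_Mapping.lookup (F k') m = Poly_Mapping.lookup (F k) m"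
  using assms(3)
proof (induction k' rule: dec_induct)
  case (step l)
  have "basis_index L (d + k) \<subseteq> basis_index L (d + l)" using step(1) by (auto simp: basis_index_def)
  then have "Poly_Mapping.keys m \<subseteq> basis_index L (d + l)" using m by blast
  then show ?case using F step(3) unfolding lim_comp_iff cong_outside_def by auto
qed simp

lemma lim_comp_eq_0I:
  assumes F: "F \<in> lim_comp d L n" and z: "\<And>k. k \<ge> K \<Longrightarrow> F k = 0"
  shows "F = 0"
proof
  fix k
  have "Poly_Mapping.lookup (F k) m = 0" for m
  proof (cases "Poly_Mapping.keys m \<subseteq> basis_index L (d + k)")
    case True
    then have "Poly_Mapping.lookup (F (max k K)) m = Poly_Mapping.lookup (F k) m"
      by (rule lim_comp_lookup[OF F]) simp
    then show ?thesis using z[of "max k K"] by simp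
  next
    case False
    moreover have "F k \<in> inv_alg d L (d + k)" using F unfolding lim_comp_iff by blast
    ultimately show ?thesis using inv_keys by blast
  qed
  then show "F k = 0 k" by (intro poly_mapping_eqI) simp
qed

section \<open>Evaluation at the generators\<close>

lemma sum_fun_apply: "(\<Sum>a\<in>A. f a) k = (\<Sum>a\<in>A. f a k)"
  by (induction A rule: infinite_finite_induct) auto

lemma prod_fun_apply: "(\<Prod>a\<in>A. f a) k = (\<Prod>a\<in>A. f a k)"
  by (induction A rule: infinite_finite_induct) auto

lemma power_fun_apply: "(f ^ n) k = f k ^ n"
  for f :: "'a \<Rightarrow> 'b::monoid_mult"
  by (induction n) auto

lemma gen_elem_eq: "gen_elem d g k = gen_poly g (d + k)"
  by (cases g) auto

definition gen_eval :: "nat \<Rightarrow> gen_index cpoly \<Rightarrow> nat \<Rightarrow> salg" where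
  "gen_eval d = cpoly_eval seq_const (gen_elem d)"

lemma gen_eval_superset:
  assumes "finite K" "Poly_Mapping.keys f \<subseteq> K"
  shows "gen_eval d f k = (\<Sum>T\<in>K. cconst (Poly_Mapping.lookup f T) * gen_monomial T (d + k))"
proof -
  have "gen_eval d f k = (\<Sum>T\<in>Poly_Mapping.keys f. cconst (Poly_Mapping.lookup f T) * gen_monomial T (d + k))"
    by (simp add: gen_eval_def cpoly_eval_def sum_fun_apply prod_fun_apply power_fun_apply gen_monomial_def seq_const_def gen_elem_eq)
  also have "\<dots> = (\<Sum>T\<in>K. cconst (Poly_Mapping.lookup f T) * gen_monomial T (d + k))"
    using assms by (intro sum.mono_neutral_left) (auto simp: in_keys_iff)
  finally show ?thesis .
qed

lemma gen_eval_add: "gen_eval d (f + g) = gen_eval d f + gen_eval d g"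
proof
  fix k
  let ?K = "Poly_Mapping.keys f \<union> Poly_Mapping.keys g"
  have K: "finite ?K" "Poly_Mapping.keys (f + g) \<subseteq> ?K" by (simp, rule keys_add)
  show "gen_eval d (f + g) k = (gen_eval d f + gen_eval d g) k"
    unfolding plus_fun_apply gen_eval_superset[OF K] gen_eval_superset[OF K(1) Un_upper1] gen_eval_superset[OF K(1) Un_upper2]
    by (simp add: lookup_add distrib_right sum.distrib)
qed

lemma gen_eval_zero [simp]: "gen_eval d 0 = 0"
  by (rule ext) (simp add: gen_eval_superset[of "{}"])

lemma gen_eval_sum: "gen_eval d (\<Sum>a\<in>A. f a) = (\<Sum>a\<in>A. gen_eval d (f a))"
  by (induction A rule: infinite_finite_induct) (simp_all add: gen_eval_add)

lemma gen_eval_single: "gen_eval d (Poly_Mapping.single T c) = (\<lambda>k. cconst c * gen_monomial T (d + k))"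
  by (rule ext) (simp add: gen_eval_superset[of "{T}"])

lemma gen_eval_lim:
  assumes "f \<in> polys_in (gen_indices d L)" "homogeneous gen_degree n f"
  shows "gen_eval d f \<in> lim_comp d L n"
proof -
  have "gen_eval d f = (\<Sum>T\<in>Poly_Mapping.keys f. (\<lambda>k. cconst (Poly_Mapping.lookup f T) * gen_monomial T (d + k)))"
    by (rule ext) (simp add: gen_eval_superset[OF _ subset_refl] sum_fun_apply)
  also have "\<dots> \<in> lim_comp d L n"
  proof (intro lim_comp_sum lim_comp_cconst_mult)
    fix T assume T: "T \<in> Poly_Mapping.keys f"
    then have "Poly_Mapping.keys T \<subseteq> gen_indices d L" "mon_degree gen_degree T = n"
      using assms by (auto simp: polys_in_def homogeneous_def)
    then show "(\<lambda>k. gen_monomial T (d + k)) \<in> lim_comp d L n" using gen_monomial_lim by metis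
  qed
  finally show ?thesis .
qed

section \<open>Test monomials and triangularity\<close>

lemma config_in_mono:
  assumes "config_in d L N C" "N \<le> N'"
  shows "config_in d L N' C"
proof -
  have "strand_in d L N' c" if "strand_in d L N c" for c
    using that assms(2) by (cases c) force+
  then show ?thesis using assms(1) by (simp add: config_in_def)
qed

text \<open>The bound on the labels is part of the choice, so that the test monomials of degree \<open>n\<close> can all
  be seen at the level \<open>d + n\<close>.\<close>

definition test_config :: "nat \<Rightarrow> nat \<Rightarrow> (gen_index \<Rightarrow>\<^sub>0 nat) \<Rightarrow> strand multiset" where
  "test_config d L T = (SOME C. config_in d L (d + mon_degree gen_degree T) C \<and> generic d C \<and> config_type L C = T)"

definition test_mon :: "nat \<Rightarrow> nat \<Rightarrow> (gen_index \<Rightarrow>\<^sub>0 nat) \<Rightarrow> salg_mon" where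
  "test_mon d L T = config_mon (test_config d L T)"

lemma test_config:
  assumes T: "Poly_Mapping.keys T \<subseteq> gen_indices d L" and N: "d + mon_degree gen_degree T \<le> N"
  shows "config_in d L N (test_config d L T)" "generic d (test_config d L T)" "config_type L (test_config d L T) = T"
proof -
  let ?n = "mon_degree gen_degree T"
  have "\<exists>C. config_in d L (d + ?n) C \<and> config_type L C = T \<and> generic d C \<and> set_mset (config_verts C) \<subseteq> set [Suc d..<Suc (d + ?n)]"
    by (rule generic_config_exists[OF T]) auto
  then have "\<exists>C. config_in d L (d + ?n) C \<and> generic d C \<and> config_type L C = T" by blast
  from someI_ex[OF this, folded test_config_def]
  show "config_in d L N (test_config d L T)" "generic d (test_config d L T)" "config_type L (test_config d L T) = T"
    using config_in_mono N by blast+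
qed

lemma keys_test_mon:
  assumes "Poly_Mapping.keys T \<subseteq> gen_indices d L" "d + mon_degree gen_degree T \<le> N"
  shows "Poly_Mapping.keys (test_mon d L T) \<subseteq> basis_index L N"
  unfolding test_mon_def using assms by (intro keys_config_mon[OF test_config(1)]) auto

lemma test_mon_diagonal:
  assumes "Poly_Mapping.keys T \<subseteq> gen_indices d L" "d + mon_degree gen_degree T \<le> N"
  shows "Poly_Mapping.lookup (gen_monomial T N) (test_mon d L T) \<noteq> 0"
proof -
  have "test_mon d L T \<in> Poly_Mapping.keys (gen_monomial T N)"
    unfolding keys_gen_monomial[OF assms(1)] test_mon_def using test_config[OF assms] by blast
  then show ?thesis by (simp add: in_keys_iff)
qed

lemma test_mon_triangular:
  assumes T: "Poly_Mapping.keys T \<subseteq> gen_indices d L" and S: "Poly_Mapping.keys S \<subseteq> gen_indices d L"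
    and nz: "Poly_Mapping.lookup (gen_monomial T N) (test_mon d L S) \<noteq> 0"
  shows "S = T \<or> mon_degree gen_verts S < mon_degree gen_verts T"
proof -
  have "test_mon d L S \<in> Poly_Mapping.keys (gen_monomial T N)" using nz by (simp add: in_keys_iff)
  then obtain C where C: "config_in d L N C" "config_type L C = T" "test_mon d L S = config_mon C"
    unfolding keys_gen_monomial[OF T] by blast
  let ?N = "max N (d + mon_degree gen_degree S)"
  have "config_in d L ?N C" using C(1) by (rule config_in_mono) simp
  from config_type_triangular[OF test_config(1,2)[OF S, of ?N] this] C test_config(3)[OF S le_refl]
  show ?thesis by (simp add: test_mon_def)
qed

lemma inj_test_mon:
  assumes T: "Poly_Mapping.keys T \<subseteq> gen_indices d L" and S: "Poly_Mapping.keys S \<subseteq> gen_indices d L"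
    and eq: "test_mon d L S = test_mon d L T"
  shows "S = T"
proof -
  let ?N = "d + max (mon_degree gen_degree S) (mon_degree gen_degree T)"
  show ?thesis
    using config_type_unique[OF test_config(1,2)[OF S, of ?N] test_config(1,2)[OF T, of ?N]]
      eq test_config(3)[OF S le_refl] test_config(3)[OF T le_refl] by (simp add: test_mon_def)
qed

text \<open>Among the monomials of \<open>f\<close> take one, \<open>T\<close>, with the most interior vertices. By triangularity
  no other monomial of \<open>f\<close> contributes to the coefficient at the test monomial of \<open>T\<close>.\<close>

lemma gen_eval_eq_0_imp:
  assumes f: "f \<in> polys_in (gen_indices d L)" and z: "gen_eval d f = 0"
  shows "f = 0"
proof (rule ccontr)
  assume "f \<noteq> 0"
  then have ne: "Poly_Mapping.keys f \<noteq> {}" by simp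
  define v where "v = mon_degree gen_verts"
  have types: "Poly_Mapping.keys T \<subseteq> gen_indices d L" if "T \<in> Poly_Mapping.keys f" for T
    using f that by (auto simp: polys_in_def)
  have "Max (v ` Poly_Mapping.keys f) \<in> v ` Poly_Mapping.keys f" using ne by (intro Max_in) auto
  then obtain T where T: "T \<in> Poly_Mapping.keys f" "v T = Max (v ` Poly_Mapping.keys f)" by auto
  have max: "v S \<le> v T" if "S \<in> Poly_Mapping.keys f" for S unfolding T(2) using that by simp
  let ?k = "mon_degree gen_degree T"
  let ?c = "\<lambda>S. Poly_Mapping.lookup f S * Poly_Mapping.lookup (gen_monomial S (d + ?k)) (test_mon d L T)"
  have "0 = Poly_Mapping.lookup (gen_eval d f ?k) (test_mon d L T)" by (simp add: z)
  also have "\<dots> = (\<Sum>S\<in>Poly_Mapping.keys f. ?c S)"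
    by (simp add: gen_eval_superset[OF _ subset_refl] lookup_sum)
  also have "\<dots> = ?c T"
  proof (rule sum_single_term[OF finite_keys T(1)])
    fix S assume S: "S \<in> Poly_Mapping.keys f" "S \<noteq> T"
    then show "?c S = 0"
      using test_mon_triangular[OF types[OF S(1)] types[OF T(1)]] max[OF S(1)] unfolding v_def by fastforce
  qed
  finally show False using test_mon_diagonal[OF types[OF T(1)] le_refl] T(1) by (simp add: in_keys_iff)
qed

lemma lim_comp_zero_of_test_mons:
  assumes F: "F \<in> lim_comp d L n"
    and z: "\<And>T. Poly_Mapping.keys T \<subseteq> gen_indices d L \<Longrightarrow> mon_degree gen_degree T = n \<Longrightarrow>
      Poly_Mapping.lookup (F n) (test_mon d L T) = 0"
  shows "F = 0"
proof (rule lim_comp_eq_0I[OF F])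
  fix k assume k: "k \<ge> Suc (3 * n)"
  show "F k = 0"
  proof (rule inv_zero_of_types)
    show "F k \<in> inv_alg d L (d + k)" "homogeneous (\<lambda>_. 1) n (F k)" using F unfolding lim_comp_iff by auto
    show "d + 3 * n < d + k" using k by simp
    fix T assume T: "Poly_Mapping.keys T \<subseteq> gen_indices d L" "mon_degree gen_degree T = n"
    have "Poly_Mapping.lookup (F k) (test_mon d L T) = Poly_Mapping.lookup (F n) (test_mon d L T)"
      using k T(2) by (intro lim_comp_lookup[OF F] keys_test_mon[OF T(1)]) auto
    then show "\<exists>C. config_in d L (d + k) C \<and> generic d C \<and> config_type L C = T \<and> Poly_Mapping.lookup (F k) (config_mon C) = 0"
      using test_config[OF T(1), of "d + k"] T(2) k z[OF T] by (intro exI[of _ "test_config d L T"]) (simp add: test_mon_def)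
  qed
qed

text \<open>Monomials in the generators are subtracted from \<open>F\<close> in layers, by decreasing number \<open>k\<close> of
  interior vertices; by triangularity a layer does not disturb the test coefficients of the
  layers above it. When all test coefficients vanish nothing is left.\<close>

lemma lim_comp_in_image:
  assumes "F \<in> lim_comp d L n"
    and "\<And>T. Poly_Mapping.keys T \<subseteq> gen_indices d L \<Longrightarrow> mon_degree gen_degree T = n \<Longrightarrow>
      k \<le> mon_degree gen_verts T \<Longrightarrow> Poly_Mapping.lookup (F n) (test_mon d L T) = 0"
  shows "\<exists>f\<in>polys_in (gen_indices d L). homogeneous gen_degree n f \<and> gen_eval d f = F"
  using assms
proof (induction k arbitrary: F)
  case 0
  then have "F = 0" by (intro lim_comp_zero_of_test_mons[of F d L n]) auto
  then show ?case by (intro bexI[of _ 0]) (auto simp: homogeneous_def polys_in_def)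
next
  case (Suc k)
  define B where "B = {T. Poly_Mapping.keys T \<subseteq> gen_indices d L \<and> mon_degree gen_degree T = n \<and>
      mon_degree gen_verts T = k \<and> Poly_Mapping.lookup (F n) (test_mon d L T) \<noteq> 0}"
  define A where "A = (\<lambda>S T. Poly_Mapping.lookup (gen_monomial S (d + n)) (test_mon d L T))"
  have "test_mon d L ` B \<subseteq> Poly_Mapping.keys (F n)" by (auto simp: B_def in_keys_iff)
  \<comment> \<open>the chosen level has finitely many monomials, so only finitely many types are involved\<close>
  moreover have "inj_on (test_mon d L) B" using inj_test_mon by (auto simp: inj_on_def B_def)
  ultimately have fin: "finite B" using finite_imageD finite_subset finite_keys by metis
  define c where "c = (\<lambda>T. Poly_Mapping.lookup (F n) (test_mon d L T) / A T T)"
  define g where "g = (\<Sum>T\<in>B. Poly_Mapping.single T (c T))"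
  have lg: "Poly_Mapping.lookup g T = (if T \<in> B then c T else 0)" for T
    unfolding g_def by (rule lookup_sum_single[OF fin])
  have g: "g \<in> polys_in (gen_indices d L)" "homogeneous gen_degree n g"
    by (auto simp: polys_in_iff homogeneous_iff lg B_def split: if_splits)
  define G where "G = F + (\<lambda>k. cconst (- 1) * gen_eval d g k)"
  have G: "G \<in> lim_comp d L n"
    unfolding G_def by (intro lim_comp_add lim_comp_cconst_mult Suc.prems(1) gen_eval_lim g)
  have FG: "F = G + gen_eval d g" by (rule ext) (simp add: G_def)
  have "Poly_Mapping.lookup (G n) (test_mon d L T) = 0"
    if T: "Poly_Mapping.keys T \<subseteq> gen_indices d L" "mon_degree gen_degree T = n" "k \<le> mon_degree gen_verts T" for T
  proof -
    have "Poly_Mapping.lookup (gen_eval d g n) (test_mon d L T) = (\<Sum>S\<in>B. c S * A S T)"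
      unfolding g_def gen_eval_sum gen_eval_single by (simp add: sum_fun_apply lookup_sum A_def)
    also have "\<dots> = (\<Sum>S\<in>B. if S = T then c T * A T T else 0)"
    proof (rule sum.cong[OF refl])
      fix S assume S: "S \<in> B"
      then show "c S * A S T = (if S = T then c T * A T T else 0)"
        using test_mon_triangular[of S d L T "d + n"] T by (auto simp: B_def A_def)
    qed
    also have "\<dots> = (if T \<in> B then Poly_Mapping.lookup (F n) (test_mon d L T) else 0)"
      using fin test_mon_diagonal[OF T(1), of "d + n"] T(2) by (simp add: c_def A_def)
    also have "\<dots> = Poly_Mapping.lookup (F n) (test_mon d L T)"
      using Suc.prems(2)[OF T(1,2)] T by (cases "mon_degree gen_verts T = k") (auto simp: B_def)
    finally show ?thesis by (simp add: G_def lookup_add lookup_minus)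
  qed
  then obtain f where f: "f \<in> polys_in (gen_indices d L)" "homogeneous gen_degree n f" "gen_eval d f = G"
    using Suc.IH[OF G] by blast
  have "homogeneous gen_degree n (f + g)" by (rule homogeneous_add[OF f(2) g(2)])
  then show ?case using f g FG by (intro bexI[of _ "f + g"]) (auto simp: gen_eval_add polys_in_add)
qed

lemma gen_eval_image_homogeneous:
  "gen_eval d ` {f \<in> polys_in (gen_indices d L). homogeneous gen_degree n f} = lim_comp d L n"
proof
  show "gen_eval d ` {f \<in> polys_in (gen_indices d L). homogeneous gen_degree n f} \<subseteq> lim_comp d L n"
    using gen_eval_lim by blast
  show "lim_comp d L n \<subseteq> gen_eval d ` {f \<in> polys_in (gen_indices d L). homogeneous gen_degree n f}"
  proof
    fix F assume F: "F \<in> lim_comp d L n"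
    have "\<exists>f\<in>polys_in (gen_indices d L). homogeneous gen_degree n f \<and> gen_eval d f = F"
    \<comment> \<open>a type of degree n has at most n interior vertices\<close>
    proof (rule lim_comp_in_image[OF F, where k = "Suc n"])
      fix T assume "Poly_Mapping.keys T \<subseteq> gen_indices d L" "mon_degree gen_degree T = n" "Suc n \<le> mon_degree gen_verts T"
      then show "Poly_Mapping.lookup (F n) (test_mon d L T) = 0" using gen_verts_le_degree[of T d L] by simp
    qed
    then show "F \<in> gen_eval d ` {f \<in> polys_in (gen_indices d L). homogeneous gen_degree n f}" by blast
  qed
qed

lemma gen_eval_image: "gen_eval d ` polys_in (gen_indices d L) = lim_alg d L"
proof
  show "gen_eval d ` polys_in (gen_indices d L) \<subseteq> lim_alg d L"
  proof
    fix F assume "F \<in> gen_eval d ` polys_in (gen_indices d L)"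
    then obtain f where f: "f \<in> polys_in (gen_indices d L)" "F = gen_eval d f" by blast
    define part where "part = (\<lambda>n. \<Sum>T\<in>{T \<in> Poly_Mapping.keys f. mon_degree gen_degree T = n}.
        Poly_Mapping.single T (Poly_Mapping.lookup f T))"
    have lp: "Poly_Mapping.lookup (part n) T = (if mon_degree gen_degree T = n then Poly_Mapping.lookup f T else 0)" for n T
      unfolding part_def by (subst lookup_sum_single) (auto simp: in_keys_iff)
    define m where "m = Max (insert 0 (mon_degree gen_degree ` Poly_Mapping.keys f))"
    have m: "mon_degree gen_degree T \<le> m" if "T \<in> Poly_Mapping.keys f" for T
      unfolding m_def using that by (intro Max_ge) auto
    have "f = (\<Sum>n\<le>m. part n)"
    proof (rule poly_mapping_eqI)
      fix T
      show "Poly_Mapping.lookup f T = Poly_Mapping.lookup (\<Sum>n\<le>m. part n) T"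
        using m[of T] by (cases "T \<in> Poly_Mapping.keys f") (auto simp: lookup_sum lp in_keys_iff)
    qed
    then have "F = (\<Sum>n\<le>m. gen_eval d (part n))" by (metis f(2) gen_eval_sum)
    moreover have "\<forall>n. gen_eval d (part n) \<in> lim_comp d L n"
    proof
      fix n
      show "gen_eval d (part n) \<in> lim_comp d L n"
        using f(1) by (intro gen_eval_lim) (auto simp: polys_in_iff homogeneous_iff lp split: if_splits)
    qed
    ultimately show "F \<in> lim_alg d L"
      unfolding lim_alg_def by (intro CollectI exI[of _ "\<lambda>n. gen_eval d (part n)"] exI[of _ m] conjI)
  qed
  show "lim_alg d L \<subseteq> gen_eval d ` polys_in (gen_indices d L)"
  proof
    fix F assume "F \<in> lim_alg d L"
    then obtain g m where g: "F = (\<Sum>n\<le>m. g n)" "\<forall>n. g n \<in> lim_comp d L n" unfolding lim_alg_def by blast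
    have "\<forall>n. \<exists>f. f \<in> polys_in (gen_indices d L) \<and> gen_eval d f = g n"
    proof
      fix n
      have "g n \<in> gen_eval d ` {f \<in> polys_in (gen_indices d L). homogeneous gen_degree n f}"
        using g(2) unfolding gen_eval_image_homogeneous by blast
      then show "\<exists>f. f \<in> polys_in (gen_indices d L) \<and> gen_eval d f = g n" by auto
    qed
    then obtain h where h: "\<And>n. h n \<in> polys_in (gen_indices d L)" "\<And>n. gen_eval d (h n) = g n" by metis
    have "F = gen_eval d (\<Sum>n\<le>m. h n)" by (simp add: gen_eval_sum h(2) g(1))
    moreover have "(\<Sum>n\<le>m. h n) \<in> polys_in (gen_indices d L)" by (rule polys_in_sum) (rule h(1))
    ultimately show "F \<in> gen_eval d ` polys_in (gen_indices d L)" by (rule image_eqI)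
  qed
qed

lemma inj_on_gen_eval: "inj_on (gen_eval d) (polys_in (gen_indices d L))"
proof (rule inj_onI)
  fix f g assume f: "f \<in> polys_in (gen_indices d L)" and g: "g \<in> polys_in (gen_indices d L)"
    and eq: "gen_eval d f = gen_eval d g"
  have "gen_eval d (f - g) + gen_eval d g = gen_eval d f" unfolding gen_eval_add[symmetric] by simp
  then have "gen_eval d (f - g) = 0" using eq by simp
  moreover have "f - g \<in> polys_in (gen_indices d L)"
    using f g unfolding polys_in_iff lookup_minus by (metis diff_self)
  ultimately have "f - g = 0" by (rule gen_eval_eq_0_imp[rotated])
  then show "f = g" by simp
qed

theorem theorem4p8:
  fixes L d :: nat
  assumes "L \<ge> 2" and "d \<ge> 1"
  shows "graded_freely_generated seq_const (lim_alg d L) (lim_comp d L)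
           (gen_indices d L) gen_degree (gen_elem d)"
  unfolding graded_freely_generated_def gen_eval_def[symmetric]
proof (intro conjI ballI allI)
  fix g assume g: "g \<in> gen_indices d L"
  have "gen_elem d g = (\<lambda>k. gen_monomial (Poly_Mapping.single g 1) (d + k))"
    by (rule ext) (simp add: gen_elem_eq)
  moreover have "(\<lambda>k. gen_monomial (Poly_Mapping.single g 1) (d + k)) \<in> lim_comp d L (gen_degree g)"
    using gen_monomial_lim[of "Poly_Mapping.single g 1" d L] g by simp
  ultimately show "gen_elem d g \<in> lim_comp d L (gen_degree g)" by simp
next
  show "bij_betw (gen_eval d) (polys_in (gen_indices d L)) (lim_alg d L)"
    using inj_on_gen_eval gen_eval_image by (rule bij_betw_imageI)
next
  show "gen_eval d ` {f \<in> polys_in (gen_indices d L). homogeneous gen_degree n f} = lim_comp d L n" for n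
    by (rule gen_eval_image_homogeneous)
qed

end
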